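(* Let $p$ be a prime and let $1\le n\le m$ be integers. The group $\mathrm{Ext}^0(E_m(n)_*/(J_n))$ is isomorphic to $\mathbb{Z}_{(p)}$, and $\mathrm{Ext}^1(E_m(n)_*/(J_n))$ is isomorphic to the direct sum of the cyclic modules over the ring $\mathbb{Z}_{(p)}[v_n^{\pm1},v_{n+1},\ldots,v_m]$ generated by $$\frac{v_{m+1}^{e_1}\cdots v_{m+n}^{e_n}}{p^{1+\nu(e_k)}}$$ of order $p^{1+\nu(e_k)}$, where $\nu(e_k)=\min\{\nu(e_1),\ldots,\nu(e_n)\}$ and $(e_1,\ldots,e_n)$ runs over the tuples of nonnegative integers, not all zero.
   Context: Let $BP$ be the Brown--Peterson spectrum at $p$, with $BP_*=\mathbb{Z}_{(p)}[v_1,v_2,\ldots]$ and $BP_*(BP)=BP_*[t_1,t_2,\ldots]$, $|v_i|=|t_i|=2(p^i-1)$. Put $\Gamma(m+1)=BP_*(BP)/(t_1,\ldots,t_m)=BP_*[t_{m+1},t_{m+2},\ldots]$; the pair $(BP_*,\Gamma(m+1))$ is a Hopf algebroid with structure maps inherited from $(BP_*,BP_*(BP))$. Let $E_m(n)_*=\mathbb{Z}_{(p)}[v_1,\ldots,v_{n-1},v_n^{\pm1},v_{n+1},\ldots,v_{n+m}]$, regarded as a $BP_*$-algebra with $v_k\mapsto0$ for $k>n+m$, and let $\Sigma(n,m+1)=E_m(n)_*\otimes_{BP_*}\Gamma(m+1)\otimes_{BP_*}E_m(n)_*$, so that $(E_m(n)_*,\Sigma(n,m+1))$ is a Hopf algebroid.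 Write $\mathrm{Ext}^s(N)=\mathrm{Ext}^s_{\Sigma(n,m+1)}(E_m(n)_*,N)$. $J_n$ denotes the sequence $v_1,\ldots,v_{n-1}$ (empty for $n=1$), and $\nu(\ell)$ is the exponent of the maximal power of $p$ dividing $\ell$, with $\nu(0)=\infty$. The fractions in the claim are elements of $\mathrm{Ext}^0(E_m(n)_*/(p^\infty,J_n))$, where $E_m(n)_*/(p^\infty,J_n)$ is the cokernel of $E_m(n)_*/(J_n)\to p^{-1}E_m(n)_*/(J_n)$; they name elements of $\mathrm{Ext}^1(E_m(n)_*/(J_n))$ through the connecting homomorphism associated to the short exact sequence $0\to E_m(n)_*/(J_n)\to p^{-1}E_m(n)_*/(J_n)\to E_m(n)_*/(p^\infty,J_n)\to0$.
   Formalization: The claim that Ext^0 is isomorphic to Z_(p) is false, since v_n^{±1}, v_{n+1}, …, v_m are invariant when n ≤ m; it is replaced by: Ext^0 is isomorphic to Z_(p)[v_n^{±1}, v_{n+1}, …, v_m] as a module over that ring. *)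

theory Defs
  imports
    "HOL-Computational_Algebra.Primes"
    "HOL-Library.Poly_Mapping"
    "HOL-Library.Extended_Nat"
    "HOL-Algebra.QuotRing"
    "HOL-Algebra.Module"
    "HOL-Algebra.Product_Groups"
begin

section \<open>Laurent polynomials in the generators\<close>

text \<open>
  \<open>V k\<close> is \<open>v\<^sub>k\<close>; \<open>T i k\<close> is \<open>t\<^sub>k\<close> in the \<open>i\<close>-th tensor factor (\<open>i \<ge> 1\<close>).  All rings below are
  subrings, or quotients of subrings, of the rational Laurent polynomial ring in these generators.
\<close>

datatype gen = V nat | T nat nat

type_synonym lpoly = "(gen \<Rightarrow>\<^sub>0 int) \<Rightarrow>\<^sub>0 rat"

definition const :: "rat \<Rightarrow> lpoly" where
  "const c = Poly_Mapping.single 0 c"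

definition gvar :: "gen \<Rightarrow> lpoly" where
  "gvar x = Poly_Mapping.single (Poly_Mapping.single x 1) 1"

definition gvar_inv :: "gen \<Rightarrow> lpoly" where
  "gvar_inv x = Poly_Mapping.single (Poly_Mapping.single x (- 1)) 1"

text \<open>
  Substitution \<open>x \<mapsto> f x\<close> in the nonnegative powers.  Negative powers of a generator are left alone,
  so this is a ring homomorphism on Laurent polynomials in which only generators fixed by \<open>f\<close>
  occur with negative exponents.
\<close>

definition lsubst :: "(gen \<Rightarrow> lpoly) \<Rightarrow> lpoly \<Rightarrow> lpoly" where
  "lsubst f P = (\<Sum>e\<in>Poly_Mapping.keys P. const (Poly_Mapping.lookup P e) *
     (\<Prod>x\<in>Poly_Mapping.keys e.
        if 0 \<le> Poly_Mapping.lookup e x then f x ^ nat (Poly_Mapping.lookup e x)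
        else gvar_inv x ^ nat (- Poly_Mapping.lookup e x)))"

text \<open>Coefficients in \<open>C\<close>, generators in \<open>S\<close>, of which those in \<open>U\<close> are inverted.\<close>

definition lpolys :: "rat set \<Rightarrow> gen set \<Rightarrow> gen set \<Rightarrow> lpoly set" where
  "lpolys C S U = {P. \<forall>e\<in>Poly_Mapping.keys P. Poly_Mapping.lookup P e \<in> C \<and>
     Poly_Mapping.keys e \<subseteq> S \<and> (\<forall>x. Poly_Mapping.lookup e x < 0 \<longrightarrow> x \<in> U)}"

definition set_ring :: "'a::comm_ring_1 set \<Rightarrow> 'a ring" where
  "set_ring S = \<lparr>carrier = S, mult = (*), one = 1, zero = 0, add = (+)\<rparr>"

definition Zloc :: "nat \<Rightarrow> rat set" where
  "Zloc p = {of_int a / of_int b | a b. \<not> int p dvd b}"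


section \<open>The Hopf algebroid structure\<close>

text \<open>
  Coefficients of the logarithm, for the Hazewinkel generators:
  \<open>p \<ell>\<^sub>k = \<Sum>\<^bsub>0\<le>i<k\<^esub> \<ell>\<^sub>i v\<^bsub>k-i\<^esub>^(p^i)\<close>.
\<close>

fun hlog :: "nat \<Rightarrow> nat \<Rightarrow> lpoly" where
  "hlog p k = (if k = 0 then 1
     else const (1 / of_nat p) * (\<Sum>i<k. hlog p i * gvar (V (k - i)) ^ (p ^ i)))"

declare hlog.simps [simp del]

text \<open>The image of \<open>t\<^sub>k\<close> in the \<open>i\<close>-th factor \<open>\<Gamma>(m+1)\<close>; here \<open>t\<^sub>0 = 1\<close>.\<close>

definition tgen :: "nat \<Rightarrow> nat \<Rightarrow> nat \<Rightarrow> lpoly" where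
  "tgen m i k = (if k = 0 then 1 else if k \<le> m then 0 else gvar (T i k))"

text \<open>
  \<open>\<Gamma>(m+1) \<otimes> \<dots> \<otimes> \<Gamma>(m+1)\<close> (\<open>s\<close> factors over \<open>BP\<^sub>*\<close>) is \<open>BP\<^sub>*[T i k | 1 \<le> i \<le> s, k > m]\<close>, and it
  receives \<open>s + 1\<close> unit maps \<open>\<eta>\<^sub>0, \<dots>, \<eta>\<^sub>s\<close> from \<open>BP\<^sub>*\<close>: \<open>\<eta>\<^sub>i\<close> is the right unit of the \<open>i\<close>-th factor
  and equals the left unit of the \<open>(i+1)\<close>-st one.  The formula is
  \<open>\<eta>\<^sub>R(\<ell>\<^sub>k) = \<Sum>\<^sub>j \<ell>\<^sub>j t\<^bsub>k-j\<^esub>^(p^j)\<close>; \<open>eta_log\<close> gives \<open>\<eta>\<^sub>i(\<ell>\<^sub>k)\<close> and \<open>eta_v\<close> gives \<open>\<eta>\<^sub>i(v\<^sub>k)\<close>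
  for \<open>k \<ge> 1\<close>, by solving Hazewinkel's formula for \<open>v\<^sub>k\<close>.
\<close>

fun eta_log :: "nat \<Rightarrow> nat \<Rightarrow> nat \<Rightarrow> nat \<Rightarrow> lpoly" where
  "eta_log p m 0 k = hlog p k"
| "eta_log p m (Suc i) k = (\<Sum>j\<le>k. eta_log p m i j * tgen m (Suc i) (k - j) ^ (p ^ j))"

fun eta_v :: "nat \<Rightarrow> nat \<Rightarrow> nat \<Rightarrow> nat \<Rightarrow> lpoly" where
  "eta_v p m i k = of_nat p * eta_log p m i k
     - (\<Sum>j\<in>{1..<k}. eta_log p m i j * eta_v p m i (k - j) ^ (p ^ j))"

declare eta_v.simps [simp del]

text \<open>
  The coproduct of \<open>t\<^sub>k\<close> in the \<open>i\<close>-th factor, with values in factors \<open>i\<close> and \<open>i + 1\<close>, from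
  \<open>\<Sum>\<^bsub>a+j=k\<^esub> \<ell>\<^sub>a \<Delta>(t\<^sub>j)^(p^a) = \<Sum>\<^bsub>a+b+c=k\<^esub> \<ell>\<^sub>a t\<^sub>b^(p^a) \<otimes> t\<^sub>c^(p^(a+b))\<close>.
\<close>

fun Delta :: "nat \<Rightarrow> nat \<Rightarrow> nat \<Rightarrow> nat \<Rightarrow> lpoly" where
  "Delta p m i k =
     (\<Sum>a\<le>k. \<Sum>b\<le>k - a. eta_log p m (i - 1) a * tgen m i b ^ (p ^ a)
                          * tgen m (Suc i) (k - a - b) ^ (p ^ (a + b)))
     - (\<Sum>a\<in>{1..k}. eta_log p m (i - 1) a * Delta p m i (k - a) ^ (p ^ a))"

declare Delta.simps [simp del]

text \<open>
  The cofaces of the cobar construction, from \<open>s\<close> to \<open>s + 1\<close> factors (\<open>0 \<le> j \<le> s + 1\<close>): \<open>j = 0\<close> is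
  the coaction \<open>\<eta>\<^sub>R\<close> on the coefficients, \<open>1 \<le> j \<le> s\<close> is \<open>\<Delta>\<close> on the \<open>j\<close>-th factor, and \<open>j = s + 1\<close>
  adds a last factor \<open>1\<close>.  When \<open>v\<^sub>n\<close> is inverted and \<open>n \<le> m\<close>, \<open>\<eta>\<^sub>R(v\<^sub>n) = v\<^sub>n\<close> in \<open>\<Gamma>(m+1)\<close>, as
  \<^const>\<open>lsubst\<close> requires.
\<close>

definition coface :: "nat \<Rightarrow> nat \<Rightarrow> nat \<Rightarrow> lpoly \<Rightarrow> lpoly" where
  "coface p m j = lsubst (\<lambda>x. case x of
       V k \<Rightarrow> if j = 0 then eta_v p m 1 k else gvar (V k)
     | T i k \<Rightarrow> if i < j then gvar (T i k) else if i = j then Delta p m i k else gvar (T (Suc i) k))"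

definition cobar_d :: "nat \<Rightarrow> nat \<Rightarrow> nat \<Rightarrow> lpoly \<Rightarrow> lpoly" where
  "cobar_d p m s x = (\<Sum>j\<le>Suc s. (- 1) ^ j * coface p m j x)"


section \<open>Cobar complexes over \<open>\<Sigma>(n,m+1)\<close>\<close>

text \<open>
  \<open>Gam C n m s\<close> is \<open>v\<^sub>n\<^sup>-\<^sup>1 \<Gamma>(m+1)\<^bsup>\<otimes>s\<^esup>\<close>, with coefficients extended to \<open>C\<close>.  Since
  \<open>E\<^sub>m(n)\<^sub>* = v\<^sub>n\<^sup>-\<^sup>1 BP\<^sub>* / (v\<^sub>k | k > n + m)\<close>, base change from \<open>BP\<^sub>*\<close> to \<open>E\<^sub>m(n)\<^sub>*\<close> along a unit map \<open>\<eta>\<^sub>i\<close>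
  inverts \<open>\<eta>\<^sub>i(v\<^sub>n)\<close> (which is \<open>v\<^sub>n\<close>, for \<open>n \<le> m\<close>) and kills \<open>\<eta>\<^sub>i(v\<^sub>k)\<close> for \<open>k > n + m\<close>.  Hence
  \<open>\<Sigma>(n,m+1)\<^bsup>\<otimes>s\<^esup> = E \<otimes> \<Gamma>(m+1) \<otimes> E \<otimes> \<dots> \<otimes> \<Gamma>(m+1) \<otimes> E\<close> is the quotient of \<open>Gam (Zloc p) n m s\<close> by the
  \<open>\<eta>\<^sub>i(v\<^sub>k)\<close> with \<open>0 \<le> i \<le> s\<close> and \<open>k > n + m\<close>.  The ideal \<open>rel_ideal\<close> contains also \<open>J\<^sub>n\<close>, through the
  left unit \<open>\<eta>\<^sub>0\<close>, so that \<open>Gam (Zloc p) n m s / rel_ideal\<close> is \<open>E\<^sub>m(n)\<^sub>*/(J\<^sub>n) \<otimes> \<Sigma>(n,m+1)\<^bsup>\<otimes>s\<^esup>\<close>, and for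
  \<open>C = \<rat>\<close> it is \<open>p\<^sup>-\<^sup>1E\<^sub>m(n)\<^sub>*/(J\<^sub>n) \<otimes> \<Sigma>(n,m+1)\<^bsup>\<otimes>s\<^esup>\<close>.
\<close>

definition Gam :: "rat set \<Rightarrow> nat \<Rightarrow> nat \<Rightarrow> nat \<Rightarrow> lpoly ring" where
  "Gam C n m s = set_ring
     (lpolys C (V ` {1..} \<union> {T i k | i k. 1 \<le> i \<and> i \<le> s \<and> m < k}) {V n})"

definition rel_ideal :: "rat set \<Rightarrow> nat \<Rightarrow> nat \<Rightarrow> nat \<Rightarrow> nat \<Rightarrow> lpoly set" where
  "rel_ideal C p n m s = Idl\<^bsub>Gam C n m s\<^esub>
     ({eta_v p m i k | i k. i \<le> s \<and> n + m < k} \<union> (\<lambda>k. gvar (V k)) ` {1..<n})"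

text \<open>
  A cobar complex is given by subgroups \<open>B s \<subseteq> A s\<close>, standing for the group \<open>A s / B s\<close> in
  cohomological degree \<open>s\<close> with the differential induced by \<^const>\<open>cobar_d\<close>.  The three
  complexes have coefficients in \<open>E\<^sub>m(n)\<^sub>*/(J\<^sub>n)\<close>, \<open>p\<^sup>-\<^sup>1E\<^sub>m(n)\<^sub>*/(J\<^sub>n)\<close> and \<open>E\<^sub>m(n)\<^sub>*/(p\<^sup>\<infinity>,J\<^sub>n)\<close>; the last
  is the cokernel of the map from the first to the second.
\<close>

type_synonym cpx = "(nat \<Rightarrow> lpoly set) \<times> (nat \<Rightarrow> lpoly set)"

definition E_J :: "nat \<Rightarrow> nat \<Rightarrow> nat \<Rightarrow> cpx" where
  "E_J p n m = (\<lambda>s. carrier (Gam (Zloc p) n m s), \<lambda>s. rel_ideal (Zloc p) p n m s)"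

definition pinv_E_J :: "nat \<Rightarrow> nat \<Rightarrow> nat \<Rightarrow> cpx" where
  "pinv_E_J p n m = (\<lambda>s. carrier (Gam UNIV n m s), \<lambda>s. rel_ideal UNIV p n m s)"

definition E_pinf_J :: "nat \<Rightarrow> nat \<Rightarrow> nat \<Rightarrow> cpx" where
  "E_pinf_J p n m = (\<lambda>s. carrier (Gam UNIV n m s),
     \<lambda>s. {x + y | x y. x \<in> rel_ideal UNIV p n m s \<and> y \<in> carrier (Gam (Zloc p) n m s)})"

definition cocycles :: "nat \<Rightarrow> nat \<Rightarrow> cpx \<Rightarrow> nat \<Rightarrow> lpoly set" where
  "cocycles p m K s = {x \<in> fst K s. cobar_d p m s x \<in> snd K (Suc s)}"

definition coboundaries :: "nat \<Rightarrow> nat \<Rightarrow> cpx \<Rightarrow> nat \<Rightarrow> lpoly set" where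
  "coboundaries p m K s =
     (case s of 0 \<Rightarrow> snd K 0
      | Suc r \<Rightarrow> {b + cobar_d p m r x | b x. b \<in> snd K s \<and> x \<in> fst K r})"

definition ext_class :: "nat \<Rightarrow> nat \<Rightarrow> cpx \<Rightarrow> nat \<Rightarrow> lpoly \<Rightarrow> lpoly set" where
  "ext_class p m K s x = (\<lambda>b. b + x) ` coboundaries p m K s"

text \<open>
  \<open>Ext\<^sup>s\<close> is the cohomology of the cobar complex, here the quotient of the cocycles in \<open>A s\<close> by the
  subgroup generated by \<open>B s\<close> and the image of the differential.  It is a module by multiplication
  through the left unit; the fields \<open>mult\<close> and \<open>one\<close> of the module record are not used.
\<close>

definition Ext :: "nat \<Rightarrow> nat \<Rightarrow> cpx \<Rightarrow> nat \<Rightarrow> (lpoly, lpoly set) module" where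
  "Ext p m K s = \<lparr>carrier = ext_class p m K s ` cocycles p m K s,
     mult = undefined, one = undefined,
     zero = coboundaries p m K s,
     add = (\<lambda>Y Z. {y + z | y z. y \<in> Y \<and> z \<in> Z}),
     smult = (\<lambda>r Y. {b + r * y | b y. b \<in> coboundaries p m K s \<and> y \<in> Y})\<rparr>"

text \<open>
  The connecting homomorphism \<open>Ext\<^sup>s(E\<^sub>m(n)\<^sub>*/(p\<^sup>\<infinity>,J\<^sub>n)) \<rightarrow> Ext\<^bsup>s+1\<^esup>(E\<^sub>m(n)\<^sub>*/(J\<^sub>n))\<close>: apply the differential
  of the middle complex to a representative and pull the result back to the first complex.
\<close>

definition connecting :: "nat \<Rightarrow> nat \<Rightarrow> nat \<Rightarrow> nat \<Rightarrow> lpoly set \<Rightarrow> lpoly set" where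
  "connecting p n m s Y = {y \<in> fst (E_J p n m) (Suc s).
     \<exists>x\<in>Y. cobar_d p m s x - y \<in> snd (pinv_E_J p n m) (Suc s)}"


section \<open>Modules over \<open>\<int>\<^bsub>(p)\<^esub>[v\<^sub>n\<^sup>\<plusminus>\<^sup>1, v\<^bsub>n+1\<^esub>, \<dots>, v\<^sub>m]\<close>\<close>

definition Rnm :: "nat \<Rightarrow> nat \<Rightarrow> nat \<Rightarrow> lpoly ring" where
  "Rnm p n m = set_ring (lpolys (Zloc p) (V ` {n..m}) {V n})"

definition regular_module :: "('a, 'b) ring_scheme \<Rightarrow> ('a, 'a) module" where
  "regular_module R = \<lparr>carrier = carrier R, mult = mult R, one = one R, zero = zero R,
     add = add R, smult = mult R\<rparr>"

text \<open>\<open>\<Oplus>\<^bsub>i\<in>I\<^esub> R/(q i)\<close>, and its generator in the summand \<open>i\<close>.\<close>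

definition cyclic_sum :: "('a, 'b) ring_scheme \<Rightarrow> 'i set \<Rightarrow> ('i \<Rightarrow> 'a) \<Rightarrow> ('a, 'i \<Rightarrow> 'a set) module" where
  "cyclic_sum R I q =
     (let S = sum_group I (\<lambda>i. add_monoid (R Quot (PIdl\<^bsub>R\<^esub> (q i))))
      in \<lparr>carrier = carrier S, mult = undefined, one = undefined, zero = \<one>\<^bsub>S\<^esub>, add = mult S,
          smult = (\<lambda>r f. \<lambda>i\<in>I. ((PIdl\<^bsub>R\<^esub> (q i)) +>\<^bsub>R\<^esub> r) \<otimes>\<^bsub>R Quot (PIdl\<^bsub>R\<^esub> (q i))\<^esub> f i)\<rparr>)"

definition cyclic_gen :: "('a, 'b) ring_scheme \<Rightarrow> 'i set \<Rightarrow> ('i \<Rightarrow> 'a) \<Rightarrow> 'i \<Rightarrow> 'i \<Rightarrow> 'a set" where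
  "cyclic_gen R I q i = (\<lambda>j\<in>I. if j = i then \<one>\<^bsub>R Quot (PIdl\<^bsub>R\<^esub> (q j))\<^esub>
                                  else \<zero>\<^bsub>R Quot (PIdl\<^bsub>R\<^esub> (q j))\<^esub>)"

definition module_iso ::
  "('r, 'x) ring_scheme \<Rightarrow> ('r, 'a, 'y) module_scheme \<Rightarrow> ('r, 'b, 'z) module_scheme \<Rightarrow> ('a \<Rightarrow> 'b) set"
where
  "module_iso R M N = {h. bij_betw h (carrier M) (carrier N) \<and>
     (\<forall>x\<in>carrier M. \<forall>y\<in>carrier M. h (x \<oplus>\<^bsub>M\<^esub> y) = h x \<oplus>\<^bsub>N\<^esub> h y) \<and>
     (\<forall>r\<in>carrier R. \<forall>x\<in>carrier M. h (r \<odot>\<^bsub>M\<^esub> x) = r \<odot>\<^bsub>N\<^esub> h x)}"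


section \<open>The generators\<close>

text \<open>The library's \<^const>\<open>multiplicity\<close> is \<open>0\<close> at \<open>0\<close>, whereas \<open>\<nu>(0) = \<infinity>\<close>.\<close>

definition nu :: "nat \<Rightarrow> nat \<Rightarrow> enat" where
  "nu p l = (if l = 0 then \<infinity> else enat (multiplicity p l))"

text \<open>\<open>e i\<close> is \<open>e\<^sub>i\<close> for \<open>1 \<le> i \<le> n\<close>; other values are fixed to be \<open>0\<close>.\<close>

definition exps :: "nat \<Rightarrow> (nat \<Rightarrow> nat) set" where
  "exps n = {e. (\<forall>i. i \<notin> {1..n} \<longrightarrow> e i = 0) \<and> (\<exists>i\<in>{1..n}. e i \<noteq> 0)}"

text \<open>\<open>p^(1 + \<nu>(e\<^sub>k))\<close> where \<open>\<nu>(e\<^sub>k)\<close> is minimal; the minimum is finite on \<^const>\<open>exps\<close>.\<close>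

definition gen_order :: "nat \<Rightarrow> nat \<Rightarrow> (nat \<Rightarrow> nat) \<Rightarrow> nat" where
  "gen_order p n e = p ^ (1 + the_enat (Min ((\<lambda>i. nu p (e i)) ` {1..n})))"

definition fraction :: "nat \<Rightarrow> nat \<Rightarrow> nat \<Rightarrow> (nat \<Rightarrow> nat) \<Rightarrow> lpoly" where
  "fraction p n m e = const (1 / of_nat (gen_order p n e)) * (\<Prod>i\<in>{1..n}. gvar (V (m + i)) ^ e i)"

end

theory Submission
  imports Defs "HOL-Number_Theory.Residues" "HOL-Computational_Algebra.Polynomial"
begin

text \<open>
  Rationally the Hopf algebroid is \<open>E \<otimes>\<^sub>A E\<close> with \<open>A\<close> generated by \<open>v\<^sub>1, \<dots>, v\<^sub>m\<close>, and its cobar complex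
  contracts onto \<open>A\<close> by setting \<open>v\<^sub>k = 0\<close>, \<open>k > m\<close>, in the last factor \<open>E\<close>.  So an integral 1-cocycle is
  the coboundary of a rational polynomial \<open>w\<close> in the \<open>x\<^sub>i = v\<^bsub>m+i\<^esub>\<close>, and modulo \<open>J\<^sub>n\<close> this coboundary is
  \<open>w(x + p y) - w(x)\<close> with \<open>y\<^sub>i = t\<^bsub>m+i\<^esub>\<close>.

  The structure maps are integral by Hazewinkel's functional equation lemma.  Keeping track of the
  error terms in that lemma one finds that \<open>\<eta>\<^sub>R(v\<^bsub>n+m+r\<^esub>)\<close> is, modulo \<open>p\<close>, \<open>J\<^sub>n\<close> and the \<open>v\<^sub>k\<close> with \<open>k > n + m\<close>,
  equal to \<open>v\<^sub>n t\<^bsub>m+r\<^esub>^(p^n) - v\<^sub>n^(p^(m+r)) t\<^bsub>m+r\<^esub>\<close> plus terms in the \<open>t\<^sub>k\<close> with \<open>k < m + r\<close>.  These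
  elements are monic up to a unit, hence a regular sequence modulo \<open>p\<close>: the ring \<open>\<Sigma>(n,m+1)/J\<^sub>n\<close> is
  torsion-free, and modulo \<open>p\<close> the monomials with all exponents below \<open>p^n\<close> in the \<open>t\<^sub>k\<close> are independent
  in it.  The terms of least \<open>p\<close>-adic valuation in \<open>w(x + p y) - w(x)\<close> are linear in the \<open>y\<^sub>i\<close> (joined by
  squares if \<open>p = 2\<close>), so integrality of the coboundary bounds the denominator of the coefficient of
  \<open>x^e\<close> in \<open>w\<close> by \<open>p^(1 + min \<nu>(e\<^sub>i))\<close>.
\<close>

text \<open>The order \<open>p^(1 + min nu)\<close> comes from the linear terms: a monomial
  \<open>c x^e\<close> contributes \<open>p e_i c\<close> as coefficient of
  \<open>y_i x^e / x_i\<close>, and these numbers lie in Z_(p) for all i exactly when c has at most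
  that denominator. Terms of degree f in one \<open>y_i\<close> impose nothing more:
  \<open>p^f binom(e_i, f)\<close> is \<open>p e_i\<close> times
  \<open>binom(e_i - 1, f - 1) p^(f-1) / f\<close>, and \<open>p^(f-1) / f\<close> is p-integral,
  even divisible by p unless f = 1 or f = p = 2. The obstacle is that the \<open>y_i\<close> are not
  free: integrality is known only modulo the relations, which trade high powers of t_k for low ones.
  Torsion-freeness turns a rational combination of relations into an integral one, and modulo p
  degrees below \<open>p^n\<close> are untouched. For \<open>p^n = 2\<close> the squares are
  touched, and this case needs its own argument. Denominators are removed one factor p at a time, so
  that each comparison takes place modulo p. Tensor products and quotients are never formed:
  everything is phrased with ideals in one ring of Laurent polynomials.\<close>

abbreviation lookup :: "('a \<Rightarrow>\<^sub>0 'b::zero) \<Rightarrow> 'a \<Rightarrow> 'b" where "lookup \<equiv> Poly_Mapping.lookup"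
abbreviation keys :: "('a \<Rightarrow>\<^sub>0 'b::zero) \<Rightarrow> 'a set" where "keys \<equiv> Poly_Mapping.keys"
abbreviation single :: "'a \<Rightarrow> 'b::zero \<Rightarrow> 'a \<Rightarrow>\<^sub>0 'b" where "single \<equiv> Poly_Mapping.single"

section \<open>Multiplicative extension from monomials\<close>

lemma poly_mapping_sum_single: "P = (\<Sum>e\<in>keys P. single e (lookup P e))"
  by (rule poly_mapping_eqI) (auto simp: lookup_sum lookup_single when_def in_keys_iff)

text \<open>Common frame for \<open>lsubst\<close> and \<open>upoly\<close>: both are determined by
  their values on single terms and are additive in the coefficient.\<close>

definition mext :: "('a \<Rightarrow> 'b \<Rightarrow> 'c) \<Rightarrow> ('a \<Rightarrow>\<^sub>0 'b::zero) \<Rightarrow> 'c::comm_monoid_add" where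
  "mext g P = (\<Sum>e\<in>keys P. g e (lookup P e))"

lemma mext_superset:
  assumes "finite A" "keys P \<subseteq> A" "\<And>e. g e 0 = 0"
  shows "mext g P = (\<Sum>e\<in>A. g e (lookup P e))"
  unfolding mext_def by (rule sum.mono_neutral_left) (use assms in \<open>auto simp: in_keys_iff\<close>)

lemma mext_zero [simp]: "mext g 0 = 0"
  by (simp add: mext_def)

lemma mext_add:
  assumes "\<And>e. g e 0 = 0" "\<And>e a b. g e (a + b) = g e a + g e b"
  shows "mext g (P + Q) = mext g P + mext g Q"
proof -
  let ?A = "keys P \<union> keys Q"
  have "mext g (P + Q) = (\<Sum>e\<in>?A. g e (lookup (P + Q) e))"
    by (rule mext_superset) (use assms keys_add[of P Q] in auto)
  moreover have "mext g P = (\<Sum>e\<in>?A. g e (lookup P e))"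
    by (rule mext_superset) (use assms in auto)
  moreover have "mext g Q = (\<Sum>e\<in>?A. g e (lookup Q e))"
    by (rule mext_superset) (use assms in auto)
  ultimately show ?thesis by (simp add: lookup_add assms sum.distrib)
qed

lemma mext_sum:
  assumes "\<And>e. g e 0 = 0" "\<And>e a b. g e (a + b) = g e a + g e b"
  shows "mext g (\<Sum>i\<in>I. P i) = (\<Sum>i\<in>I. mext g (P i))"
  by (induction I rule: infinite_finite_induct) (simp_all add: mext_add[of g, OF assms])

lemma mext_single: "g e 0 = 0 \<Longrightarrow> mext g (single e c) = g e c"
  by (simp add: mext_def)

text \<open>Multiplicativity is asked only on a set \<open>M\<close> of exponents, because a
  substitution does not respect products in which a negative power of a moved generator
  cancels.\<close>

lemma mext_mult:
  fixes P Q :: "'a::monoid_add \<Rightarrow>\<^sub>0 'b::semiring_0" and g :: "'a \<Rightarrow> 'b \<Rightarrow> 'c::semiring_0"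
  assumes g: "\<And>e. g e 0 = 0" "\<And>e a b. g e (a + b) = g e a + g e b"
    and M: "keys P \<subseteq> M" "keys Q \<subseteq> M"
    and mult: "\<And>e e' a b. e \<in> M \<Longrightarrow> e' \<in> M \<Longrightarrow> g (e + e') (a * b) = g e a * g e' b"
  shows "mext g (P * Q) = mext g P * mext g Q"
proof -
  have "P * Q = (\<Sum>e\<in>keys P. single e (lookup P e)) * (\<Sum>e\<in>keys Q. single e (lookup Q e))"
    using poly_mapping_sum_single by metis
  also have "\<dots> = (\<Sum>e\<in>keys P. \<Sum>e'\<in>keys Q. single (e + e') (lookup P e * lookup Q e'))"
    by (simp add: sum_product mult_single)
  finally have "mext g (P * Q) = (\<Sum>e\<in>keys P. \<Sum>e'\<in>keys Q. g (e + e') (lookup P e * lookup Q e'))"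
    by (simp add: mext_sum[of g, OF g] mext_single[of g, OF g(1)])
  also have "\<dots> = (\<Sum>e\<in>keys P. \<Sum>e'\<in>keys Q. g e (lookup P e) * g e' (lookup Q e'))"
    by (intro sum.cong refl mult) (use M in auto)
  finally show ?thesis by (simp add: mext_def sum_product)
qed


section \<open>Rings of Laurent polynomials\<close>

lemma const_simps [simp]: "const 0 = 0" "const 1 = 1"
  and const_add: "const (a + b) = const a + const b"
  and const_mult: "const (a * b) = const a * const b"
  and const_minus: "const (- a) = - const a"
  and const_of_nat: "const (of_nat k) = of_nat k"
  by (simp_all add: const_def single_add mult_single single_uminus)

lemma const_power: "const (a ^ k) = const a ^ k"
  by (induction k) (simp_all add: const_mult)

lemma lookup_const_mult [simp]: "lookup (const c * P) e = c * lookup P e"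
proof -
  have "const c * P = Poly_Mapping.map ((*) c) P"
    by (simp add: const_def mult_map_scale_conv_mult)
  then show ?thesis by (simp add: map.rep_eq when_def)
qed

lemma const_mult_single [simp]: "const c * single e a = single e (c * a)"
  by (simp add: const_def mult_single)

lemma of_nat_mult_const_inverse [simp]:
  "k \<noteq> 0 \<Longrightarrow> of_nat k * const (1 / of_nat k) = 1"
  "k \<noteq> 0 \<Longrightarrow> const (1 / of_nat k) * of_nat k = 1"
  by (simp_all flip: const_of_nat const_mult)

lemma of_nat_mult_lpoly_cancel:
  fixes x y :: lpoly
  assumes "of_nat k * x = of_nat k * y" "k \<noteq> 0"
  shows "x = y"
proof -
  have "const (1 / of_nat k) * (of_nat k * x) = const (1 / of_nat k) * (of_nat k * y)"
    by (simp add: assms)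
  then show ?thesis using assms(2) by (simp flip: mult.assoc)
qed

lemma gvar_mult_inv [simp]: "gvar x * gvar_inv x = 1" "gvar_inv x * gvar x = 1"
  by (simp_all add: gvar_def gvar_inv_def mult_single flip: single_add)

lemma gvar_power_single: "gvar x ^ k = single (single x (int k)) 1"
  and gvar_inv_power_single: "gvar_inv x ^ k = single (single x (- int k)) 1"
  by (induction k) (auto simp: gvar_def gvar_inv_def mult_single add.commute simp flip: single_add)

definition subring_rat :: "rat set \<Rightarrow> bool" where
  "subring_rat C \<longleftrightarrow> 1 \<in> C \<and> (\<forall>a\<in>C. \<forall>b\<in>C. a + b \<in> C \<and> a * b \<in> C \<and> - a \<in> C)"

lemma subring_ratD:
  assumes "subring_rat C"
  shows "0 \<in> C" "1 \<in> C" "a \<in> C \<Longrightarrow> b \<in> C \<Longrightarrow> a + b \<in> C" "a \<in> C \<Longrightarrow> b \<in> C \<Longrightarrow> a * b \<in> C" "a \<in> C \<Longrightarrow> - a \<in> C"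
proof -
  show "1 \<in> C" "a \<in> C \<Longrightarrow> b \<in> C \<Longrightarrow> a + b \<in> C" "a \<in> C \<Longrightarrow> b \<in> C \<Longrightarrow> a * b \<in> C" "a \<in> C \<Longrightarrow> - a \<in> C"
    using assms by (auto simp: subring_rat_def)
  have "1 + - 1 \<in> C" using assms unfolding subring_rat_def by metis
  then show "0 \<in> C" by simp
qed

lemma subring_rat_UNIV [simp]: "subring_rat UNIV"
  by (simp add: subring_rat_def)

lemma subring_rat_of_nat: "subring_rat C \<Longrightarrow> of_nat k \<in> C"
  by (induction k) (auto intro: subring_ratD)

lemma subring_rat_Zloc: "prime p \<Longrightarrow> subring_rat (Zloc p)"
  unfolding subring_rat_def
proof (intro conjI ballI)
  assume p: "prime p"
  then have p1: "\<not> int p dvd 1" using prime_nat_int_transfer not_prime_unit by blast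
  show "1 \<in> Zloc p" unfolding Zloc_def using p1 by (intro CollectI exI[of _ 1]) auto
  fix a b assume "a \<in> Zloc p" "b \<in> Zloc p"
  then obtain r s t u where a: "a = of_int r / of_int s" "\<not> int p dvd s"
    and b: "b = of_int t / of_int u" "\<not> int p dvd u" by (auto simp: Zloc_def)
  have su: "\<not> int p dvd s * u" using a b p by (simp add: prime_dvd_mult_iff)
  have nz: "s \<noteq> 0" "u \<noteq> 0" using a b by auto
  have "a + b = of_int (r * u + t * s) / of_int (s * u)" using nz by (simp add: a b field_simps)
  then show "a + b \<in> Zloc p" using su unfolding Zloc_def by blast
  have "a * b = of_int (r * t) / of_int (s * u)" by (simp add: a b)
  then show "a * b \<in> Zloc p" using su unfolding Zloc_def by blast
  have "- a = of_int (- r) / of_int s" by (simp add: a)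
  then show "- a \<in> Zloc p" using a(2) unfolding Zloc_def by blast
qed

lemma lpolysI:
  assumes "\<And>e. e \<in> keys P \<Longrightarrow> lookup P e \<in> C"
    "\<And>e x. e \<in> keys P \<Longrightarrow> lookup e x \<noteq> 0 \<Longrightarrow> x \<in> S"
    "\<And>e x. e \<in> keys P \<Longrightarrow> lookup e x < 0 \<Longrightarrow> x \<in> U"
  shows "P \<in> lpolys C S U"
  using assms by (auto simp: lpolys_def in_keys_iff)

lemma lpolysD:
  assumes "P \<in> lpolys C S U" "lookup P e \<noteq> 0"
  shows "lookup P e \<in> C" "lookup e x \<noteq> 0 \<Longrightarrow> x \<in> S" "lookup e x < 0 \<Longrightarrow> x \<in> U"
  using assms by (auto simp: lpolys_def in_keys_iff subset_iff)

lemma lpolys_lookup: "subring_rat C \<Longrightarrow> P \<in> lpolys C S U \<Longrightarrow> lookup P e \<in> C"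
  by (cases "lookup P e = 0") (auto intro: subring_ratD lpolysD)

lemma lpolys_mono: "P \<in> lpolys C S U \<Longrightarrow> C \<subseteq> C' \<Longrightarrow> S \<subseteq> S' \<Longrightarrow> U \<subseteq> U' \<Longrightarrow> P \<in> lpolys C' S' U'"
  by (rule lpolysI) (auto simp: in_keys_iff dest: lpolysD)

lemma lpolys_UNIV: "P \<in> lpolys C S U \<Longrightarrow> P \<in> lpolys UNIV UNIV U"
  by (erule lpolys_mono) auto

lemma lpolys_Int: "P \<in> lpolys C S U \<Longrightarrow> P \<in> lpolys C' S' U' \<Longrightarrow> P \<in> lpolys (C \<inter> C') (S \<inter> S') (U \<inter> U')"
  by (rule lpolysI) (auto simp: in_keys_iff dest: lpolysD)

context
  fixes C assumes C: "subring_rat C"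
begin

lemma lpolys_const: "c \<in> C \<Longrightarrow> const c \<in> lpolys C S U"
  by (rule lpolysI) (auto simp: const_def split: if_splits)

lemma lpolys_0: "0 \<in> lpolys C S U"
  by (rule lpolysI) auto

lemma lpolys_1: "1 \<in> lpolys C S U"
  using lpolys_const[of 1] subring_ratD[OF C] by simp

lemma lpolys_of_nat: "of_nat k \<in> lpolys C S U"
  using lpolys_const[OF subring_rat_of_nat[OF C, of k]] by (simp add: const_of_nat)

lemma lpolys_gvar: "x \<in> S \<Longrightarrow> gvar x \<in> lpolys C S U"
  by (rule lpolysI) (auto simp: gvar_def lookup_single when_def subring_ratD[OF C] split: if_splits)

lemma lpolys_gvar_inv: "x \<in> S \<Longrightarrow> x \<in> U \<Longrightarrow> gvar_inv x \<in> lpolys C S U"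
  by (rule lpolysI) (auto simp: gvar_inv_def lookup_single when_def subring_ratD[OF C] split: if_splits)

lemma lpolys_add: "P \<in> lpolys C S U \<Longrightarrow> Q \<in> lpolys C S U \<Longrightarrow> P + Q \<in> lpolys C S U"
proof (rule lpolysI)
  assume PQ: "P \<in> lpolys C S U" "Q \<in> lpolys C S U"
  fix e assume "e \<in> keys (P + Q)"
  then have "lookup P e \<noteq> 0 \<or> lookup Q e \<noteq> 0" by (auto simp: in_keys_iff lookup_add)
  then show "lookup e x < 0 \<Longrightarrow> x \<in> U" "lookup e x \<noteq> 0 \<Longrightarrow> x \<in> S" for x
    using PQ by (auto dest: lpolysD)
  show "lookup (P + Q) e \<in> C"
    using PQ by (auto simp: lookup_add intro!: subring_ratD[OF C] lpolys_lookup[OF C])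
qed

lemma lpolys_uminus: "P \<in> lpolys C S U \<Longrightarrow> - P \<in> lpolys C S U"
  by (rule lpolysI) (auto simp: in_keys_iff dest: lpolysD intro: subring_ratD[OF C])

lemma lpolys_diff: "P \<in> lpolys C S U \<Longrightarrow> Q \<in> lpolys C S U \<Longrightarrow> P - Q \<in> lpolys C S U"
  using lpolys_add[OF _ lpolys_uminus, of P S U Q] by simp

lemma lpolys_sum: "(\<And>i. i \<in> I \<Longrightarrow> P i \<in> lpolys C S U) \<Longrightarrow> (\<Sum>i\<in>I. P i) \<in> lpolys C S U"
  by (induction I rule: infinite_finite_induct) (auto intro: lpolys_0 lpolys_add)

lemma lpolys_single:
  "c \<in> C \<Longrightarrow> (\<And>x. lookup e x \<noteq> 0 \<Longrightarrow> x \<in> S) \<Longrightarrow> (\<And>x. lookup e x < 0 \<Longrightarrow> x \<in> U) \<Longrightarrow> single e c \<in> lpolys C S U"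
  by (rule lpolysI) (auto split: if_splits)

lemma lpolys_mult:
  assumes PQ: "P \<in> lpolys C S U" "Q \<in> lpolys C S U"
  shows "P * Q \<in> lpolys C S U"
proof -
  have "P * Q = (\<Sum>e\<in>keys P. single e (lookup P e)) * (\<Sum>e\<in>keys Q. single e (lookup Q e))"
    using poly_mapping_sum_single by metis
  also have "\<dots> = (\<Sum>e\<in>keys P. \<Sum>e'\<in>keys Q. single (e + e') (lookup P e * lookup Q e'))"
    by (simp add: sum_product mult_single)
  also have "\<dots> \<in> lpolys C S U"
  proof (intro lpolys_sum lpolys_single)
    fix e e' assume e: "e \<in> keys P" "e' \<in> keys Q"
    then show "lookup P e * lookup Q e' \<in> C" using PQ
      by (auto simp: in_keys_iff intro!: subring_ratD[OF C] dest: lpolysD)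
    show "x \<in> S" if "lookup (e + e') x \<noteq> 0" for x
    proof -
      have "lookup e x \<noteq> 0 \<or> lookup e' x \<noteq> 0" using that by (auto simp: lookup_add)
      then show ?thesis using e PQ by (auto simp: in_keys_iff dest: lpolysD)
    qed
    show "x \<in> U" if "lookup (e + e') x < 0" for x
    proof -
      have "lookup e x < 0 \<or> lookup e' x < 0" using that by (auto simp: lookup_add)
      then show ?thesis using e PQ by (auto simp: in_keys_iff dest: lpolysD)
    qed
  qed
  finally show ?thesis .
qed

lemma lpolys_power: "P \<in> lpolys C S U \<Longrightarrow> P ^ k \<in> lpolys C S U"
  by (induction k) (auto intro: lpolys_1 lpolys_mult)

lemma lpolys_prod: "(\<And>i. i \<in> I \<Longrightarrow> P i \<in> lpolys C S U) \<Longrightarrow> (\<Prod>i\<in>I. P i) \<in> lpolys C S U"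
  by (induction I rule: infinite_finite_induct) (auto intro: lpolys_1 lpolys_mult)

lemma lpolys_const_mult: "c \<in> C \<Longrightarrow> P \<in> lpolys C S U \<Longrightarrow> const c * P \<in> lpolys C S U"
  by (intro lpolys_mult lpolys_const)

end

lemmas lpolys_intros = lpolys_0 lpolys_1 lpolys_of_nat lpolys_gvar lpolys_add lpolys_uminus lpolys_diff
  lpolys_sum lpolys_mult lpolys_power lpolys_prod


section \<open>Substitution\<close>

definition spow :: "(gen \<Rightarrow> lpoly) \<Rightarrow> gen \<Rightarrow> int \<Rightarrow> lpoly" where
  "spow f x k = (if 0 \<le> k then f x ^ nat k else gvar_inv x ^ nat (- k))"

definition smon :: "(gen \<Rightarrow> lpoly) \<Rightarrow> (gen \<Rightarrow>\<^sub>0 int) \<Rightarrow> lpoly" where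
  "smon f e = (\<Prod>x\<in>keys e. spow f x (lookup e x))"

lemma lsubst_mext: "lsubst f = mext (\<lambda>e c. const c * smon f e)"
  by (simp add: fun_eq_iff lsubst_def mext_def smon_def spow_def)

lemma smon_superset: "finite A \<Longrightarrow> keys e \<subseteq> A \<Longrightarrow> smon f e = (\<Prod>x\<in>A. spow f x (lookup e x))"
  unfolding smon_def by (rule prod.mono_neutral_left) (auto simp: in_keys_iff spow_def)

lemma gvar_power_inv_power:
  "j \<le> k \<Longrightarrow> gvar x ^ k * gvar_inv x ^ j = gvar x ^ (k - j)"
  "k \<le> j \<Longrightarrow> gvar x ^ k * gvar_inv x ^ j = gvar_inv x ^ (j - k)"
proof -
  have one: "gvar x ^ i * gvar_inv x ^ i = 1" for i by (simp flip: power_mult_distrib)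
  show "gvar x ^ k * gvar_inv x ^ j = gvar x ^ (k - j)" if "j \<le> k"
  proof -
    have "gvar x ^ k * gvar_inv x ^ j = gvar x ^ (k - j) * (gvar x ^ j * gvar_inv x ^ j)"
      using that by (simp flip: mult.assoc power_add)
    then show ?thesis by (simp add: one)
  qed
  show "gvar x ^ k * gvar_inv x ^ j = gvar_inv x ^ (j - k)" if "k \<le> j"
  proof -
    have "gvar x ^ k * gvar_inv x ^ j = (gvar x ^ k * gvar_inv x ^ k) * gvar_inv x ^ (j - k)"
      using that by (simp add: mult.assoc flip: power_add)
    then show ?thesis by (simp add: one)
  qed
qed

text \<open>If the signs differ, a cancellation of x against its inverse takes place, and it
  survives the substitution only when \<open>f\<close> fixes x.\<close>

lemma spow_add:
  assumes "0 \<le> a \<and> 0 \<le> b \<or> f x = gvar x"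
  shows "spow f x (a + b) = spow f x a * spow f x b"
proof (cases "0 \<le> a \<and> 0 \<le> b")
  case True then show ?thesis by (simp add: spow_def nat_add_distrib power_add)
next
  case False
  then have f: "f x = gvar x" using assms by auto
  consider "a \<ge> 0" "b < 0" | "a < 0" "b \<ge> 0" | "a < 0" "b < 0" using False by linarith
  then show ?thesis
  proof cases
    case 1
    show ?thesis
    proof (cases "a + b \<ge> 0")
      case True
      then show ?thesis using 1 gvar_power_inv_power(1)[of "nat (- b)" "nat a" x]
        by (simp add: spow_def f flip: nat_diff_distrib')
    next
      case False
      have "nat (- (a + b)) = nat (- b) - nat a" "nat a \<le> nat (- b)" using False 1 by linarith+
      then show ?thesis using 1 False gvar_power_inv_power(2)[of "nat a" "nat (- b)" x]
        by (simp add: spow_def f)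
    qed
  next
    case 2
    show ?thesis
    proof (cases "a + b \<ge> 0")
      case True
      then show ?thesis using 2 gvar_power_inv_power(1)[of "nat (- a)" "nat b" x]
        by (simp add: spow_def f mult.commute add.commute flip: nat_diff_distrib')
    next
      case False
      have "nat (- (a + b)) = nat (- a) - nat b" "nat b \<le> nat (- a)" using False 2 by linarith+
      then show ?thesis using 2 False gvar_power_inv_power(2)[of "nat b" "nat (- a)" x]
        by (simp add: spow_def f mult.commute)
    qed
  next
    case 3
    then have "nat (- (a + b)) = nat (- a) + nat (- b)" by linarith
    then show ?thesis using 3 by (simp add: spow_def power_add add.commute)
  qed
qed

definition mons :: "gen set \<Rightarrow> (gen \<Rightarrow>\<^sub>0 int) set" where
  "mons U = {e. \<forall>x. lookup e x < 0 \<longrightarrow> x \<in> U}"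

lemma lpolys_keys: "P \<in> lpolys C S U \<Longrightarrow> keys P \<subseteq> mons U"
  by (auto simp: lpolys_def mons_def)

text \<open>\<open>U\<close> holds the generators that may be inverted. On
  \<open>lpolys C S U\<close> the substitution is then a genuine ring homomorphism. The Frobenius
  lifts use the empty set, the cofaces and contractions use \<open>{V n}\<close>.\<close>

locale fixing =
  fixes f :: "gen \<Rightarrow> lpoly" and U :: "gen set"
  assumes fixed: "x \<in> U \<Longrightarrow> f x = gvar x"
begin

lemma smon_add:
  assumes "e \<in> mons U" "e' \<in> mons U"
  shows "smon f (e + e') = smon f e * smon f e'"
proof -
  let ?A = "keys e \<union> keys e'"
  have "smon f (e + e') = (\<Prod>x\<in>?A. spow f x (lookup e x + lookup e' x))"
    using keys_add[of e e'] by (subst smon_superset[of ?A]) (auto simp: lookup_add)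
  also have "\<dots> = (\<Prod>x\<in>?A. spow f x (lookup e x) * spow f x (lookup e' x))"
  proof (intro prod.cong refl spow_add)
    fix x
    show "0 \<le> lookup e x \<and> 0 \<le> lookup e' x \<or> f x = gvar x"
      using assms fixed[of x] by (force simp: mons_def not_le)
  qed
  also have "\<dots> = smon f e * smon f e'"
    by (simp add: prod.distrib smon_superset[of ?A])
  finally show ?thesis .
qed

lemma hom_add: "lsubst f (P + Q) = lsubst f P + lsubst f Q"
  unfolding lsubst_mext by (rule mext_add) (auto simp: const_add ring_distribs)

lemma hom_0 [simp]: "lsubst f 0 = 0"
  by (simp add: lsubst_mext)

lemma hom_uminus: "lsubst f (- P) = - lsubst f P"
  using hom_add[of P "- P"] by (simp add: add_eq_0_iff)

lemma hom_diff: "lsubst f (P - Q) = lsubst f P - lsubst f Q"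
  using hom_add[of P "- Q"] by (simp add: hom_uminus)

lemma hom_sum: "lsubst f (\<Sum>i\<in>I. P i) = (\<Sum>i\<in>I. lsubst f (P i))"
  by (induction I rule: infinite_finite_induct) (auto simp: hom_add)

lemma hom_single: "lsubst f (single e c) = const c * smon f e"
  unfolding lsubst_mext by (rule mext_single) auto

lemma hom_const [simp]: "lsubst f (const c) = const c"
  by (simp add: const_def hom_single smon_def)

lemma hom_1 [simp]: "lsubst f 1 = 1"
  using hom_const[of 1] by simp

lemma hom_of_nat [simp]: "lsubst f (of_nat k) = of_nat k"
  using hom_const[of "of_nat k"] by (simp only: const_of_nat)

lemma hom_gvar [simp]: "lsubst f (gvar x) = f x"
  by (simp add: gvar_def hom_single smon_def spow_def)

lemma hom_gvar_inv [simp]: "lsubst f (gvar_inv x) = gvar_inv x"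
  by (simp add: gvar_inv_def hom_single smon_def spow_def)

lemma hom_mult:
  assumes "P \<in> lpolys C S U" "Q \<in> lpolys C' S' U"
  shows "lsubst f (P * Q) = lsubst f P * lsubst f Q"
  unfolding lsubst_mext
  by (rule mext_mult[where M = "mons U"])
    (use assms in \<open>auto simp: const_add const_mult ring_distribs smon_add lpolys_keys\<close>)

lemma hom_const_mult: "lsubst f (const c * P) = const c * lsubst f P"
proof -
  have "const c * P = (\<Sum>e\<in>keys P. single e (c * lookup P e))"
    by (subst (1) poly_mapping_sum_single[of P]) (simp add: sum_distrib_left)
  then show ?thesis
    by (subst (2) poly_mapping_sum_single[of P]) (simp add: hom_sum hom_single const_mult sum_distrib_left mult.assoc)
qed

lemma hom_power:
  assumes "P \<in> lpolys C S U"
  shows "lsubst f (P ^ k) = lsubst f P ^ k"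
proof (induction k)
  case (Suc k)
  have "lsubst f (P * P ^ k) = lsubst f P * lsubst f (P ^ k)"
    by (rule hom_mult[OF assms, of "P ^ k" UNIV UNIV]) (intro lpolys_power subring_rat_UNIV lpolys_UNIV[OF assms])
  then show ?case by (simp add: Suc)
qed simp

lemma hom_prod:
  assumes "\<And>i. i \<in> I \<Longrightarrow> P i \<in> lpolys C S U"
  shows "lsubst f (\<Prod>i\<in>I. P i) = (\<Prod>i\<in>I. lsubst f (P i))"
  using assms
proof (induction I rule: infinite_finite_induct)
  case (insert i I)
  have "lsubst f (P i * prod P I) = lsubst f (P i) * lsubst f (prod P I)"
    by (rule hom_mult[OF insert.prems[of i], of _ UNIV UNIV])
      (use insert.prems in \<open>auto intro!: lpolys_prod intro: lpolys_UNIV\<close>)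
  then show ?case using insert by simp
qed auto

lemma smon_eq_gvar:
  assumes "\<And>x. lookup e x \<noteq> 0 \<Longrightarrow> f x = gvar x"
  shows "smon f e = single e 1"
proof -
  have "smon f e = (\<Prod>x\<in>keys e. single (single x (lookup e x)) 1)"
    unfolding smon_def by (intro prod.cong refl) (use assms in \<open>auto simp: spow_def gvar_power_single gvar_inv_power_single in_keys_iff\<close>)
  also have "\<dots> = single (\<Sum>x\<in>keys e. single x (lookup e x)) 1"
  proof -
    have "finite I \<Longrightarrow> (\<Prod>x\<in>I. single (h x) 1) = single (\<Sum>x\<in>I. h x) (1::rat)" for h :: "gen \<Rightarrow> gen \<Rightarrow>\<^sub>0 int" and I
      by (induction I rule: finite_induct) (auto simp: mult_single)
    then show ?thesis by simp
  qed
  also have "(\<Sum>x\<in>keys e. single x (lookup e x)) = e"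
    using poly_mapping_sum_single by metis
  finally show ?thesis .
qed

lemma hom_id:
  assumes "P \<in> lpolys C S U" "\<And>x. x \<in> S \<Longrightarrow> f x = gvar x"
  shows "lsubst f P = P"
proof -
  have "lsubst f P = (\<Sum>e\<in>keys P. single e (lookup P e))"
    unfolding lsubst_mext mext_def
    by (intro sum.cong refl, subst smon_eq_gvar)
      (use assms in \<open>auto simp: in_keys_iff dest: lpolysD\<close>)
  then show ?thesis using poly_mapping_sum_single by metis
qed

lemma hom_spow:
  assumes "fixing f' U'" "f' x \<in> lpolys UNIV UNIV U"
  shows "lsubst f (spow f' x k) = spow (\<lambda>x. lsubst f (f' x)) x k"
proof -
  interpret f': fixing f' U' by fact
  have "lsubst f (gvar_inv x ^ j) = gvar_inv x ^ j" for j
  proof -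
    have "smon f (single x (- int j)) = gvar_inv x ^ j"
      by (cases "j = 0") (auto simp: smon_def spow_def)
    then show ?thesis using hom_single[of "single x (- int j)" 1] by (simp add: gvar_inv_power_single)
  qed
  then show ?thesis using hom_power[OF assms(2)] by (simp add: spow_def)
qed

lemma hom_smon_mem:
  assumes S: "\<And>x. x \<in> S \<Longrightarrow> f x \<in> lpolys C S' U'" and "U \<inter> S \<subseteq> U' \<inter> S'" "subring_rat C"
    and e: "\<And>x. lookup e x \<noteq> 0 \<Longrightarrow> x \<in> S" "\<And>x. lookup e x < 0 \<Longrightarrow> x \<in> U"
  shows "smon f e \<in> lpolys C S' U'"
  unfolding smon_def
proof (intro lpolys_prod assms)
  fix x assume x: "x \<in> keys e"
  then have xS: "x \<in> S" using e(1)[of x] by (auto simp: in_keys_iff)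
  show "spow f x (lookup e x) \<in> lpolys C S' U'"
  proof (cases "lookup e x < 0")
    case True
    then have "x \<in> U" using e(2) by auto
    then have "gvar_inv x \<in> lpolys C S' U'" using assms xS by (intro lpolys_gvar_inv) auto
    then show ?thesis using True by (auto simp: spow_def intro: lpolys_power assms)
  qed (use S[OF xS] in \<open>auto simp: spow_def intro!: lpolys_power assms\<close>)
qed

lemma hom_mem:
  assumes P: "P \<in> lpolys C S U" and S: "\<And>x. x \<in> S \<Longrightarrow> f x \<in> lpolys C S' U'"
    and "U \<inter> S \<subseteq> U' \<inter> S'" "subring_rat C"
  shows "lsubst f P \<in> lpolys C S' U'"
  unfolding lsubst_mext mext_def
  by (intro lpolys_sum lpolys_const_mult lpolys_lookup[OF _ P] assms hom_smon_mem[OF S])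
    (use P assms(3) in \<open>auto simp: in_keys_iff dest: lpolysD\<close>)

end

lemma lsubst_lsubst:
  assumes f: "fixing f U" and g: "fixing g U" and P: "P \<in> lpolys C S U"
    and gS: "\<And>x. x \<in> S \<Longrightarrow> g x \<in> lpolys UNIV UNIV U"
    and h: "\<And>x. x \<in> S \<Longrightarrow> h x = lsubst f (g x)"
  shows "lsubst f (lsubst g P) = lsubst h P"
proof -
  interpret f: fixing f U by fact
  interpret g: fixing g U by fact
  have *: "lsubst f (smon g e) = smon h e" if e: "e \<in> keys P" for e
  proof -
    have S: "x \<in> S" if "x \<in> keys e" for x using that e P by (auto simp: lpolys_def)
    have U: "x \<in> U" if "lookup e x < 0" for x using that e P by (auto simp: lpolys_def)
    have "lsubst f (smon g e) = (\<Prod>x\<in>keys e. lsubst f (spow g x (lookup e x)))"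
      unfolding smon_def
    proof (rule f.hom_prod[of _ _ UNIV UNIV])
      fix x assume x: "x \<in> keys e"
      have "gvar_inv x \<in> lpolys UNIV UNIV U" if "lookup e x < 0"
        by (rule lpolys_gvar_inv) (use U that in auto)
      then show "spow g x (lookup e x) \<in> lpolys UNIV UNIV U"
        using gS[OF S[OF x]] by (auto simp: spow_def intro!: lpolys_power)
    qed
    also have "\<dots> = smon h e"
      unfolding smon_def
      by (intro prod.cong refl, subst f.hom_spow[OF g]) (auto simp: spow_def h gS S)
    finally show ?thesis .
  qed
  have "lsubst f (lsubst g P) = (\<Sum>e\<in>keys P. const (lookup P e) * lsubst f (smon g e))"
    unfolding lsubst_mext[of g] mext_def by (simp add: f.hom_sum f.hom_const_mult)
  also have "\<dots> = lsubst h P"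
    unfolding lsubst_mext[of h] mext_def by (intro sum.cong refl) (simp add: *)
  finally show ?thesis .
qed


section \<open>Subrings, ideals and congruences\<close>

definition subring :: "'a::comm_ring_1 set \<Rightarrow> bool" where
  "subring R \<longleftrightarrow> 1 \<in> R \<and> (\<forall>x\<in>R. \<forall>y\<in>R. x + y \<in> R \<and> x * y \<in> R \<and> - x \<in> R)"

lemma subringD:
  assumes "subring R"
  shows "0 \<in> R" "1 \<in> R" "x \<in> R \<Longrightarrow> y \<in> R \<Longrightarrow> x + y \<in> R" "x \<in> R \<Longrightarrow> y \<in> R \<Longrightarrow> x * y \<in> R"
    "x \<in> R \<Longrightarrow> - x \<in> R" "x \<in> R \<Longrightarrow> y \<in> R \<Longrightarrow> x - y \<in> R"
proof -
  show *: "1 \<in> R" "x \<in> R \<Longrightarrow> y \<in> R \<Longrightarrow> x + y \<in> R" "x \<in> R \<Longrightarrow> y \<in> R \<Longrightarrow> x * y \<in> R" "x \<in> R \<Longrightarrow> - x \<in> R" for x y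
    using assms by (auto simp: subring_def)
  show "0 \<in> R" using *(2)[OF *(1) *(4)[OF *(1)]] by simp
  show "x \<in> R \<Longrightarrow> y \<in> R \<Longrightarrow> x - y \<in> R" using *(2)[of x "- y"] *(4)[of y] by simp
qed

lemma subring_sum: "subring R \<Longrightarrow> (\<And>i. i \<in> I \<Longrightarrow> f i \<in> R) \<Longrightarrow> sum f I \<in> R"
  by (induction I rule: infinite_finite_induct) (auto intro: subringD)

lemma subring_power: "subring R \<Longrightarrow> x \<in> R \<Longrightarrow> x ^ k \<in> R"
  by (induction k) (auto intro: subringD)

lemma subring_of_nat: "subring R \<Longrightarrow> of_nat k \<in> R"
  by (induction k) (auto intro: subringD)

lemma subring_lpolys: "subring_rat C \<Longrightarrow> subring (lpolys C S U)"
  by (auto simp: subring_def intro: lpolys_intros)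

definition ring_ideal :: "'a::comm_ring_1 set \<Rightarrow> 'a set \<Rightarrow> bool" where
  "ring_ideal R I \<longleftrightarrow> I \<subseteq> R \<and> 0 \<in> I \<and> (\<forall>x\<in>I. \<forall>y\<in>I. x + y \<in> I) \<and> (\<forall>r\<in>R. \<forall>x\<in>I. r * x \<in> I)"

lemma ring_idealD:
  assumes "ring_ideal R I" "subring R"
  shows "x \<in> I \<Longrightarrow> x \<in> R" "0 \<in> I" "x \<in> I \<Longrightarrow> y \<in> I \<Longrightarrow> x + y \<in> I" "r \<in> R \<Longrightarrow> x \<in> I \<Longrightarrow> r * x \<in> I"
    "r \<in> R \<Longrightarrow> x \<in> I \<Longrightarrow> x * r \<in> I" "x \<in> I \<Longrightarrow> - x \<in> I" "x \<in> I \<Longrightarrow> y \<in> I \<Longrightarrow> x - y \<in> I"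
proof -
  show *: "x \<in> I \<Longrightarrow> x \<in> R" "0 \<in> I" "x \<in> I \<Longrightarrow> y \<in> I \<Longrightarrow> x + y \<in> I" "r \<in> R \<Longrightarrow> x \<in> I \<Longrightarrow> r * x \<in> I" for x y r
    using assms(1) by (auto simp: ring_ideal_def)
  show "r \<in> R \<Longrightarrow> x \<in> I \<Longrightarrow> x * r \<in> I" using *(4)[of r x] by (simp add: mult.commute)
  show m: "x \<in> I \<Longrightarrow> - x \<in> I" for x using *(4)[of "- 1" x] subringD[OF assms(2)] by simp
  show "x \<in> I \<Longrightarrow> y \<in> I \<Longrightarrow> x - y \<in> I" using *(3)[of x "- y"] m[of y] by simp
qed

lemma ring_ideal_sum: "ring_ideal R I \<Longrightarrow> (\<And>i. i \<in> A \<Longrightarrow> f i \<in> I) \<Longrightarrow> sum f A \<in> I"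
  by (induction A rule: infinite_finite_induct) (auto simp: ring_ideal_def)

lemma ring_ideal_power_diff:
  assumes I: "ring_ideal R I" "subring R" and xy: "x - y \<in> I" "x \<in> R" "y \<in> R"
  shows "x ^ k - y ^ k \<in> I"
proof -
  have "(\<Sum>i<k. y ^ (k - Suc i) * x ^ i) \<in> R"
    using xy I by (auto intro!: subring_sum subringD subring_power)
  then show ?thesis
    using ring_idealD(5)[OF I _ xy(1)] by (simp add: power_diff_sumr2)
qed

text \<open>Combinations are built one summand at a time, so that statements about elements of an
  ideal become inductions without explicit finite sums.\<close>

inductive_set ispan :: "'a::comm_ring_1 set \<Rightarrow> 'a set \<Rightarrow> 'a set" for R G where
  zero: "0 \<in> ispan R G"
| step: "x \<in> ispan R G \<Longrightarrow> a \<in> R \<Longrightarrow> g \<in> G \<Longrightarrow> x + a * g \<in> ispan R G"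

lemma ispan_add:
  assumes "x \<in> ispan R G" "y \<in> ispan R G"
  shows "x + y \<in> ispan R G"
  using assms(2) by induction (auto intro: ispan.intros assms simp flip: add.assoc)

lemma ispan_mult:
  assumes "subring R" "r \<in> R" "x \<in> ispan R G"
  shows "r * x \<in> ispan R G"
  using assms(3)
proof induction
  case (step x a g)
  then show ?case using ispan.step[of "r * x" R G "r * a" g] assms
    by (auto simp: ring_distribs mult.assoc intro: subringD)
qed (auto intro: ispan.intros)

lemma ispan_ideal: "subring R \<Longrightarrow> G \<subseteq> R \<Longrightarrow> ring_ideal R (ispan R G)"
  unfolding ring_ideal_def
proof (intro conjI ballI subsetI)
  assume R: "subring R" "G \<subseteq> R"
  fix x assume "x \<in> ispan R G"
  then show "x \<in> R" by induction (use R in \<open>auto intro: subringD\<close>)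
qed (auto intro: ispan.zero ispan_add ispan_mult)

lemma ispan_gen: "subring R \<Longrightarrow> g \<in> G \<Longrightarrow> g \<in> ispan R G"
  using ispan.step[OF ispan.zero, of 1 R g G] by (simp add: subringD)

lemma ispan_minimal:
  assumes "ring_ideal R I" "subring R" "G \<subseteq> I"
  shows "ispan R G \<subseteq> I"
proof
  fix x assume "x \<in> ispan R G"
  then show "x \<in> I" by induction (use assms in \<open>auto intro: ring_idealD\<close>)
qed

lemma ispan_mono: "G \<subseteq> H \<Longrightarrow> R \<subseteq> S \<Longrightarrow> ispan R G \<subseteq> ispan S H"
proof
  fix x assume GH: "G \<subseteq> H" "R \<subseteq> S" and "x \<in> ispan R G"
  from this(3) show "x \<in> ispan S H" by induction (use GH in \<open>auto intro: ispan.intros\<close>)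
qed

definition pmult :: "nat \<Rightarrow> nat \<Rightarrow> 'a::comm_ring_1 set \<Rightarrow> 'a set" where
  "pmult p k R = (*) (of_nat p ^ k) ` R"

lemma pmultI: "z \<in> R \<Longrightarrow> x = of_nat p ^ k * z \<Longrightarrow> x \<in> pmult p k R"
  by (auto simp: pmult_def)

lemma pmultE:
  assumes "x \<in> pmult p k R"
  obtains z where "z \<in> R" "x = of_nat p ^ k * z"
  using assms unfolding pmult_def by blast

lemma pmult_ideal: "subring R \<Longrightarrow> ring_ideal R (pmult p k R)"
  unfolding ring_ideal_def
proof (intro conjI ballI subsetI)
  assume R: "subring R"
  show "x \<in> R" if "x \<in> pmult p k R" for x
    using that R by (auto simp: pmult_def intro: subringD subring_of_nat subring_power)
  show "0 \<in> pmult p k R" by (rule pmultI[of 0]) (auto intro: subringD R)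
  show "x + y \<in> pmult p k R" if "x \<in> pmult p k R" "y \<in> pmult p k R" for x y
    using that R by (auto simp: pmult_def image_iff simp flip: ring_distribs intro: subringD)
  show "r * x \<in> pmult p k R" if "r \<in> R" and x: "x \<in> pmult p k R" for r x
  proof -
    obtain z where "x = of_nat p ^ k * z" "z \<in> R" using x by (auto elim: pmultE)
    then show ?thesis using that R by (intro pmultI[of "r * z"]) (auto intro: subringD simp: mult_ac)
  qed
qed

text \<open>In \<open>x^p - y^p = (x - y) (sum of y^(p-1-i) x^i)\<close> the second factor is
  congruent to \<open>p y^(p-1)\<close> modulo p, which supplies one more factor p.\<close>

lemma pmult_power_diff:
  assumes R: "subring R" and xy: "x - y \<in> pmult p (Suc k) R" "x \<in> R" "y \<in> R"
  shows "x ^ p - y ^ p \<in> pmult p (Suc (Suc k)) R"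
proof -
  note I = pmult_ideal[OF R, of p 1]
  obtain z where z: "z \<in> R" "x - y = of_nat p ^ Suc k * z" using xy by (auto elim: pmultE)
  have "x - y \<in> pmult p 1 R"
    using z R by (intro pmultI[of "of_nat p ^ k * z"]) (auto intro: subringD subring_power subring_of_nat simp: mult_ac)
  then have "y ^ (p - Suc i) * (x ^ i - y ^ i) \<in> pmult p 1 R" for i
    by (intro ring_idealD(4)[OF I R] subring_power[OF R] ring_ideal_power_diff[OF I R] xy)
  then have "(\<Sum>i<p. y ^ (p - Suc i) * (x ^ i - y ^ i)) \<in> pmult p 1 R"
    by (intro ring_ideal_sum[OF I])
  moreover have "(\<Sum>i<p. y ^ (p - Suc i) * y ^ i) = of_nat p * y ^ (p - 1)"
  proof -
    have "(\<Sum>i<p. y ^ (p - Suc i) * y ^ i) = (\<Sum>i<p. y ^ (p - 1))"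
      by (intro sum.cong refl) (auto simp flip: power_add)
    then show ?thesis by simp
  qed
  moreover have "of_nat p * y ^ (p - 1) \<in> pmult p 1 R"
    by (rule pmultI[of "y ^ (p - 1)"]) (auto intro: subring_power R xy)
  ultimately have "(\<Sum>i<p. y ^ (p - Suc i) * x ^ i) \<in> pmult p 1 R"
    using ring_idealD(3)[OF I R] by (fastforce simp: ring_distribs sum_subtractf)
  then obtain w where w: "w \<in> R" "(\<Sum>i<p. y ^ (p - Suc i) * x ^ i) = of_nat p * w"
    by (auto simp: pmult_def)
  have "x ^ p - y ^ p = of_nat p ^ Suc (Suc k) * (z * w)"
    unfolding power_diff_sumr2 w(2) z(2) by (simp add: mult_ac)
  then show ?thesis using w z R by (intro pmultI[of "z * w"]) (auto intro: subringD)
qed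

lemma pmult_power_power_diff:
  assumes R: "subring R" and xy: "x - y \<in> pmult p 1 R" "x \<in> R" "y \<in> R"
  shows "x ^ (p ^ k) - y ^ (p ^ k) \<in> pmult p (Suc k) R"
proof (induction k)
  case (Suc k)
  have "(x ^ (p ^ k)) ^ p - (y ^ (p ^ k)) ^ p \<in> pmult p (Suc (Suc k)) R"
    by (rule pmult_power_diff[OF R Suc]) (intro subring_power R xy)+
  then show ?case by (simp add: mult.commute flip: power_mult)
qed (use xy in simp)

lemma freshman:
  assumes R: "subring R" and p: "prime p" and xy: "x \<in> R" "y \<in> R"
  shows "(x + y) ^ p - (x ^ p + y ^ p) \<in> pmult p 1 R"
proof -
  let ?f = "\<lambda>k. of_nat (p choose k) * x ^ k * y ^ (p - k)"
  have p2: "p > 1" using p prime_gt_1_nat by blast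
  have "(x + y) ^ p = (\<Sum>k\<le>p. ?f k)" by (rule binomial_ring)
  also have "\<dots> = (\<Sum>k\<in>{0<..<p}. ?f k) + (x ^ p + y ^ p)"
  proof -
    have "{..p} = insert 0 (insert p {0<..<p})" using p2 by auto
    then show ?thesis using p2 by simp
  qed
  finally have "(x + y) ^ p - (x ^ p + y ^ p) = (\<Sum>k\<in>{0<..<p}. ?f k)" by simp
  also have "\<dots> \<in> pmult p 1 R"
  proof (rule ring_ideal_sum[OF pmult_ideal[OF R]])
    fix k assume k: "k \<in> {0<..<p}"
    then have "p dvd p choose k" using p by (intro dvd_choose_prime) auto
    then obtain d where "p choose k = p * d" by auto
    then show "?f k \<in> pmult p 1 R"
      by (intro pmultI[of "of_nat d * x ^ k * y ^ (p - k)"])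
        (auto intro!: subringD subring_power subring_of_nat R xy simp: mult_ac)
  qed
  finally show ?thesis .
qed

text \<open>For c = r/s apply Fermat to r and s separately:
  \<open>r^p s - r s^p = (r^p - r) s - r (s^p - s)\<close>, and s is prime to p.\<close>

lemma Zloc_fermat:
  assumes p: "prime p" and c: "c \<in> Zloc p"
  shows "c ^ p - c \<in> pmult p 1 (Zloc p)"
proof -
  note R = subring_rat_Zloc[OF p]
  have sub: "subring (UNIV :: int set)" by (simp add: subring_def)
  have nat: "int k ^ p - int k \<in> pmult p 1 UNIV" for k
  proof (induction k)
    case (Suc k)
    have "(int k + 1) ^ p - (int k ^ p + 1 ^ p) \<in> pmult p 1 UNIV"
      by (rule freshman[OF sub p]) auto
    from ring_idealD(3)[OF pmult_ideal[OF sub] sub this Suc] show ?case by (simp add: algebra_simps)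
  qed (use p in \<open>auto simp: pmult_def image_iff zero_power prime_gt_0_nat\<close>)
  have int: "int p dvd r ^ p - r" for r
  proof -
    have "[r ^ p = int (nat (r mod p)) ^ p] (mod p)"
      by (intro cong_pow) (use p in \<open>auto simp: cong_def prime_gt_0_nat\<close>)
    also have "[int (nat (r mod p)) ^ p = int (nat (r mod p))] (mod p)"
      using nat[of "nat (r mod p)"] by (auto simp: cong_iff_dvd_diff pmult_def)
    also have "[int (nat (r mod p)) = r] (mod p)"
      using p by (auto simp: cong_def prime_gt_0_nat)
    finally show ?thesis by (simp add: cong_iff_dvd_diff)
  qed
  obtain r s where rs: "c = of_int r / of_int s" "\<not> int p dvd s" using c by (auto simp: Zloc_def)
  have "r ^ p * s - r * s ^ p = (r ^ p - r) * s - r * (s ^ p - s)" by (simp add: algebra_simps)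
  then have "int p dvd r ^ p * s - r * s ^ p" using int by simp
  then obtain d where d: "r ^ p * s - r * s ^ p = int p * d" by auto
  have s: "s \<noteq> 0" using rs by auto
  have nd: "\<not> int p dvd s ^ Suc p" using p rs(2) prime_dvd_power[of "int p" s "Suc p"] by auto
  have "c ^ p - c = of_int (r ^ p * s - r * s ^ p) / of_int (s ^ Suc p)"
    using s by (simp add: rs(1) field_simps)
  also have "\<dots> = of_nat p ^ 1 * (of_int d / of_int (s ^ Suc p))" by (simp add: d)
  finally show ?thesis using nd by (intro pmultI) (auto simp: Zloc_def)
qed


section \<open>The functional equation\<close>

abbreviation Qpol :: "lpoly set" where "Qpol \<equiv> lpolys UNIV UNIV {}"
abbreviation Zpol :: "nat \<Rightarrow> lpoly set" where "Zpol p \<equiv> lpolys (Zloc p) UNIV {}"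
abbreviation v :: "nat \<Rightarrow> lpoly" where "v k \<equiv> gvar (V k)"

lemma Zpol_Qpol: "x \<in> Zpol p \<Longrightarrow> x \<in> Qpol"
  by (rule lpolys_UNIV)

lemmas Qpol_intros = lpolys_intros[OF subring_rat_UNIV] lpolys_const[OF subring_rat_UNIV]

text \<open>The i-th iterate of the Frobenius lift of Hazewinkel's lemma: coefficients are fixed,
  and all generators, the t's included, are raised to powers.\<close>

definition Frob :: "nat \<Rightarrow> nat \<Rightarrow> lpoly \<Rightarrow> lpoly" where
  "Frob p i = lsubst (\<lambda>x. gvar x ^ (p ^ i))"

interpretation Frob: fixing "\<lambda>x. gvar x ^ (p ^ i)" "{}"
  rewrites "lsubst (\<lambda>x. gvar x ^ (p ^ i)) \<equiv> Frob p i" for p i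
  by unfold_locales (auto simp: Frob_def)

lemma Frob_mem: "subring_rat C \<Longrightarrow> P \<in> lpolys C S {} \<Longrightarrow> Frob p i P \<in> lpolys C S {}"
  by (erule Frob.hom_mem) (auto intro!: lpolys_power lpolys_gvar)

lemma Frob_Frob:
  assumes "P \<in> Qpol"
  shows "Frob p i (Frob p j P) = Frob p (i + j) P"
  unfolding Frob_def
proof (rule lsubst_lsubst[OF _ _ assms])
  fix x
  show "gvar x ^ (p ^ j) \<in> Qpol" by (intro Qpol_intros) auto
  have "Frob p i (gvar x ^ (p ^ j)) = (gvar x ^ (p ^ i)) ^ (p ^ j)"
    by (subst Frob.hom_power[where C = UNIV and S = UNIV]) (auto intro!: Qpol_intros)
  then show "gvar x ^ (p ^ (i + j)) = lsubst (\<lambda>x. gvar x ^ (p ^ i)) (gvar x ^ (p ^ j))"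
    by (simp add: Frob_def power_add flip: power_mult)
qed (auto intro: fixing.intro)

lemma Frob_0: "P \<in> Qpol \<Longrightarrow> Frob p 0 P = P"
  unfolding Frob_def by (rule fixing.hom_id) (auto intro: fixing.intro)


context
  fixes p :: nat assumes p: "prime p"
begin

lemma subring_Zpol: "subring (Zpol p)"
  by (intro subring_lpolys subring_rat_Zloc p)

lemmas Zpol_intros = lpolys_intros[OF subring_rat_Zloc[OF p]] lpolys_const[OF subring_rat_Zloc[OF p]]
lemmas pmult_Zpol = pmult_ideal[OF subring_Zpol, of p 1]

text \<open>On one term this is Fermat for the coefficient; the passage to sums is the additivity of
  the p-th power modulo p.\<close>

lemma Frob_cong1:
  assumes "a \<in> Zpol p"
  shows "Frob p 1 a - a ^ p \<in> pmult p 1 (Zpol p)"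
proof -
  have single: "Frob p 1 (single e c) - single e c ^ p \<in> pmult p 1 (Zpol p)" if e: "single e c \<in> Zpol p" for e c
  proof (cases "c = 0")
    case True
    then show ?thesis using p ring_idealD(2)[OF pmult_Zpol subring_Zpol] by (simp add: zero_power prime_gt_0_nat)
  next
    case False
    have c: "c \<in> Zloc p" using lpolysD(1)[OF e, of e] False by simp
    have e0: "lookup e x \<ge> 0" for x using lpolysD(3)[OF e, of e x] False by force
    have "smon (\<lambda>x. gvar x ^ (p ^ 1)) e = (\<Prod>x\<in>keys e. (gvar x ^ nat (lookup e x)) ^ p)"
      unfolding smon_def by (intro prod.cong refl) (simp add: e0 spow_def mult.commute flip: power_mult)
    also have "\<dots> = smon gvar e ^ p"
      unfolding smon_def by (simp add: e0 spow_def prod_power_distrib)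
    also have "smon gvar e = single e 1"
      by (rule fixing.smon_eq_gvar[where U = UNIV]) (auto intro: fixing.intro)
    finally have "Frob p 1 (single e c) = const c * single e 1 ^ p"
      by (simp add: Frob.hom_single)
    moreover have "single e c ^ p = const (c ^ p) * single e 1 ^ p"
      by (simp add: const_power flip: power_mult_distrib)
    moreover obtain d where d: "d \<in> Zloc p" "c ^ p - c = of_nat p * d"
      using Zloc_fermat[OF p c] by (auto simp: pmult_def)
    moreover have "const (c ^ p) = const c + const (of_nat p * d)"
      by (simp flip: const_add d(2))
    ultimately have "Frob p 1 (single e c) - single e c ^ p = of_nat p ^ 1 * (const (- d) * single e 1 ^ p)"
      by (simp add: algebra_simps const_mult const_of_nat const_minus)
    moreover have "single e 1 \<in> Zpol p"
      by (rule lpolys_single[OF subring_rat_Zloc[OF p]])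
        (use e0 subring_ratD(2)[OF subring_rat_Zloc[OF p]] in \<open>auto simp: not_less[symmetric]\<close>)
    ultimately show ?thesis
      using d(1) by (intro pmultI) (auto intro!: Zpol_intros subring_ratD[OF subring_rat_Zloc[OF p]])
  qed
  have "(\<Sum>e\<in>A. single e (lookup a e)) \<in> Zpol p \<and>
     Frob p 1 (\<Sum>e\<in>A. single e (lookup a e)) - (\<Sum>e\<in>A. single e (lookup a e)) ^ p \<in> pmult p 1 (Zpol p)"
    if "finite A" for A
    using that
  proof (induction A)
    case empty
    show ?case using p ring_idealD(2)[OF pmult_Zpol subring_Zpol]
      by (auto simp: zero_power prime_gt_0_nat intro: Zpol_intros)
  next
    case (insert e A)
    let ?x = "single e (lookup a e)" and ?y = "\<Sum>e\<in>A. single e (lookup a e)"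
    have x: "?x \<in> Zpol p"
      by (rule lpolysI) (use assms in \<open>auto split: if_splits dest: lpolysD\<close>)
    have y: "?y \<in> Zpol p" using insert by auto
    have "Frob p 1 (?x + ?y) - (?x + ?y) ^ p =
      (Frob p 1 ?x - ?x ^ p) + (Frob p 1 ?y - ?y ^ p) - ((?x + ?y) ^ p - (?x ^ p + ?y ^ p))"
      by (simp add: Frob.hom_add)
    moreover have "\<dots> \<in> pmult p 1 (Zpol p)"
      by (rule ring_idealD(7)[OF pmult_Zpol subring_Zpol ring_idealD(3)[OF pmult_Zpol subring_Zpol]
          freshman[OF subring_Zpol p x y]]) (use single[OF x] insert in auto)
    ultimately have "Frob p 1 (?x + ?y) - (?x + ?y) ^ p \<in> pmult p 1 (Zpol p)" by (rule ssubst)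
    then show ?case using insert lpolys_add[OF subring_rat_Zloc[OF p] x y] by simp
  qed
  from this[of "keys a"] show ?thesis by (simp flip: poly_mapping_sum_single)
qed

lemma Frob_cong:
  assumes "a \<in> Zpol p"
  shows "Frob p i a - a ^ (p ^ i) \<in> pmult p 1 (Zpol p)"
proof (induction i)
  case 0
  then show ?case using ring_idealD(2)[OF pmult_Zpol subring_Zpol] by (simp add: Frob_0 Zpol_Qpol[OF assms])
next
  case (Suc i)
  have m: "a ^ p ^ i \<in> Zpol p" "Frob p i a \<in> Zpol p"
    using assms by (auto intro: Zpol_intros Frob_mem subring_rat_Zloc p)
  have "Frob p 1 (Frob p i a) - (Frob p i a) ^ p \<in> pmult p 1 (Zpol p)"
    by (rule Frob_cong1[OF m(2)])
  moreover have "(Frob p i a) ^ p - (a ^ (p ^ i)) ^ p \<in> pmult p 1 (Zpol p)"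
    by (rule ring_ideal_power_diff[OF pmult_Zpol subring_Zpol Suc m(2,1)])
  ultimately have "Frob p 1 (Frob p i a) - (Frob p i a) ^ p + ((Frob p i a) ^ p - (a ^ (p ^ i)) ^ p) \<in> pmult p 1 (Zpol p)"
    by (rule ring_idealD(3)[OF pmult_Zpol subring_Zpol])
  then show ?case by (simp add: Frob_Frob Zpol_Qpol[OF assms] mult.commute flip: power_mult)
qed

text \<open>The exponent \<open>Suc j\<close> is exactly what \<open>fdefect\<close> needs:
  \<open>p^j\<close> clears the denominator of \<open>c j\<close>, and one more p cancels the factor
  1/p.\<close>

lemma Frob_power_cong:
  assumes "a \<in> Zpol p"
  shows "Frob p i a ^ (p ^ j) - a ^ (p ^ (i + j)) \<in> pmult p (Suc j) (Zpol p)"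
proof -
  have "Frob p i a ^ (p ^ j) - (a ^ (p ^ i)) ^ (p ^ j) \<in> pmult p (Suc j) (Zpol p)"
    using assms by (intro pmult_power_power_diff subring_Zpol Frob_cong)
      (auto intro: Zpol_intros Frob_mem subring_rat_Zloc p)
  then show ?thesis by (simp add: power_add flip: power_mult)
qed

end

text \<open>For the series f with coefficients \<open>c k\<close> at x^(p^k), Hazewinkel's
  functional equation says that f(x) minus the sum of (v_i/p) (Frob^i f)(x^(p^i)) is integral; this
  is the subtracted part at x^(p^k).\<close>

definition ftail :: "nat \<Rightarrow> (nat \<Rightarrow> lpoly) \<Rightarrow> nat \<Rightarrow> lpoly" where
  "ftail p c k = (\<Sum>i\<in>{1..k}. const (1 / of_nat p) * v i * Frob p i (c (k - i)))"

text \<open>The coefficient of x^(p^k) in the sum of the f(a_i x^(p^i)), where f has coefficients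
  \<open>c\<close>. When f is a logarithm this is the logarithm of the formal sum of the a_i
  x^(p^i).\<close>

definition conv :: "nat \<Rightarrow> (nat \<Rightarrow> lpoly) \<Rightarrow> (nat \<Rightarrow> lpoly) \<Rightarrow> nat \<Rightarrow> lpoly" where
  "conv p c a k = (\<Sum>j\<le>k. c j * a (k - j) ^ (p ^ j))"

text \<open>The error made because a_i need not be sent to its p-th power by the Frobenius
  lift.\<close>

definition fdefect :: "nat \<Rightarrow> (nat \<Rightarrow> lpoly) \<Rightarrow> (nat \<Rightarrow> lpoly) \<Rightarrow> nat \<Rightarrow> lpoly" where
  "fdefect p c a k = (\<Sum>i\<in>{1..k}. \<Sum>j\<le>k - i. const (1 / of_nat p) * v i * Frob p i (c j) *
     (Frob p i (a (k - i - j)) ^ (p ^ j) - a (k - i - j) ^ (p ^ (i + j))))"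

lemma sum_triangle:
  fixes G :: "nat \<Rightarrow> nat \<Rightarrow> 'a::comm_monoid_add"
  shows "(\<Sum>s\<le>k. \<Sum>i\<in>{1..s}. G i (s - i)) = (\<Sum>i\<in>{1..k}. \<Sum>j\<le>k - i. G i j)"
proof -
  have "(\<Sum>s\<le>k. \<Sum>i\<in>{1..s}. G i (s - i)) = (\<Sum>(s, i)\<in>Sigma {..k} (\<lambda>s. {1..s}). G i (s - i))"
    by (rule sum.Sigma) auto
  also have "\<dots> = (\<Sum>(i, j)\<in>Sigma {1..k} (\<lambda>i. {..k - i}). G i j)"
    by (rule sum.reindex_bij_witness[where i = "\<lambda>(i, j). (i + j, i)" and j = "\<lambda>(s, i). (i, s - i)"]) auto
  also have "\<dots> = (\<Sum>i\<in>{1..k}. \<Sum>j\<le>k - i. G i j)"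
    by (rule sum.Sigma[symmetric]) auto
  finally show ?thesis .
qed

text \<open>Expanding each \<open>c s\<close> inside \<open>conv\<close> by its own equation
  produces \<open>a^(p^(i+j))\<close>, where the tail of \<open>conv\<close> would require
  \<open>(Frob a)^(p^j)\<close>. The discrepancy is \<open>fdefect\<close>, and the remainder
  \<open>h\<close> is passed on to \<open>conv p h a\<close>.\<close>

lemma conv_functional_equation:
  assumes c: "\<And>k. c k = h k + ftail p c k" "\<And>k. c k \<in> Qpol" and a: "\<And>k. a k \<in> Qpol"
  shows "conv p c a k = conv p h a k - fdefect p c a k + ftail p (conv p c a) k"
proof -
  let ?w = "\<lambda>i. const (1 / of_nat p) * v i"
  have F: "Frob p i (conv p c a k') = (\<Sum>j\<le>k'. Frob p i (c j) * Frob p i (a (k' - j)) ^ (p ^ j))" for i k'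
  proof -
    have "Frob p i (conv p c a k') = (\<Sum>j\<le>k'. Frob p i (c j * a (k' - j) ^ (p ^ j)))"
      unfolding conv_def by (rule Frob.hom_sum)
    also have "\<dots> = (\<Sum>j\<le>k'. Frob p i (c j) * Frob p i (a (k' - j)) ^ (p ^ j))"
      by (intro sum.cong refl, subst Frob.hom_mult[OF c(2)])
        (auto intro!: Qpol_intros a simp: Frob.hom_power[OF a])
    finally show ?thesis .
  qed
  have "conv p c a k = conv p h a k + (\<Sum>s\<le>k. ftail p c s * a (k - s) ^ (p ^ s))"
    unfolding conv_def by (subst c(1)) (simp add: ring_distribs sum.distrib)
  also have "(\<Sum>s\<le>k. ftail p c s * a (k - s) ^ (p ^ s)) =
      (\<Sum>s\<le>k. \<Sum>i\<in>{1..s}. (\<lambda>i j. ?w i * Frob p i (c j) * a (k - i - j) ^ (p ^ (i + j))) i (s - i))"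
    unfolding ftail_def sum_distrib_right by (intro sum.cong refl) auto
  also have "\<dots> = (\<Sum>i\<in>{1..k}. \<Sum>j\<le>k - i. ?w i * Frob p i (c j) * a (k - i - j) ^ (p ^ (i + j)))"
    by (subst sum_triangle) simp
  also have "\<dots> = ftail p (conv p c a) k - fdefect p c a k"
    unfolding fdefect_def ftail_def sum_subtractf[symmetric] F sum_distrib_left
    by (intro sum.cong refl) (simp add: algebra_simps)
  finally show ?thesis by simp
qed

context
  fixes p :: nat assumes p: "prime p"
begin

text \<open>Each use of the equation costs one factor 1/p and lowers the index by at least
  one.\<close>

lemma functional_equation_denominator:
  assumes c: "\<And>k. c k = h k + ftail p c k" "\<And>k. c k \<in> Qpol" and h: "\<And>k. h k \<in> Zpol p"
  shows "of_nat p ^ k * c k \<in> Zpol p"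
proof (induction k rule: less_induct)
  case (less k)
  note Zi = Zpol_intros[OF p]
  have "of_nat p ^ k * c k = of_nat p ^ k * h k + (\<Sum>i\<in>{1..k}. of_nat p ^ (i - 1) * v i * Frob p i (of_nat p ^ (k - i) * c (k - i)))"
  proof -
    have "of_nat p ^ k * (const (1 / of_nat p) * v i * Frob p i (c (k - i))) =
      of_nat p ^ (i - 1) * v i * Frob p i (of_nat p ^ (k - i) * c (k - i))" if i: "i \<in> {1..k}" for i
    proof -
      have "Frob p i (of_nat p ^ (k - i) * c (k - i)) = of_nat p ^ (k - i) * Frob p i (c (k - i))"
        by (subst Frob.hom_mult[OF _ c(2), of _ UNIV UNIV], force intro: Qpol_intros,
            subst Frob.hom_power[where C = UNIV and S = UNIV]) (auto intro: Qpol_intros)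
      moreover have "(of_nat p :: lpoly) ^ k * const (1 / of_nat p) = of_nat p ^ (i - 1) * of_nat p ^ (k - i)"
      proof -
        have "k = (i - 1) + (k - i) + 1" using i by auto
        then have "(of_nat p :: lpoly) ^ k = of_nat p ^ (i - 1) * of_nat p ^ (k - i) * of_nat p"
          by (metis power_add power_one_right)
        then show ?thesis using p by (simp add: mult.assoc prime_gt_0_nat)
      qed
      ultimately show ?thesis
        by (simp only: mult.assoc[symmetric]) (simp only: mult_ac)
    qed
    then show ?thesis by (subst c(1)) (simp add: ftail_def ring_distribs sum_distrib_left)
  qed
  also have "\<dots> \<in> Zpol p"
  proof (intro lpolys_add lpolys_sum subring_rat_Zloc p)
    fix i assume "i \<in> {1..k}"
    then have "Frob p i (of_nat p ^ (k - i) * c (k - i)) \<in> Zpol p"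
      using less[of "k - i"] by (intro Frob_mem subring_rat_Zloc p) auto
    then show "of_nat p ^ (i - 1) * v i * Frob p i (of_nat p ^ (k - i) * c (k - i)) \<in> Zpol p"
      by (rule lpolys_mult[OF subring_rat_Zloc[OF p], rotated]) (intro Zi UNIV_I)
  qed (intro Zi h)
  finally show ?case .
qed

lemma fdefect_term:
  assumes c: "\<And>k. c k = h k + ftail p c k" "\<And>k. c k \<in> Qpol" and h: "\<And>k. h k \<in> Zpol p" and a: "a \<in> Zpol p"
  shows "const (1 / of_nat p) * (Frob p i (c j) * (Frob p i a ^ (p ^ j) - a ^ (p ^ (i + j)))) \<in> Zpol p"
proof -
  obtain z where z: "z \<in> Zpol p" "Frob p i a ^ (p ^ j) - a ^ (p ^ (i + j)) = of_nat p ^ Suc j * z"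
    using Frob_power_cong[OF p a, of i j] by (rule pmultE)
  have "Frob p i (of_nat p ^ j * c j) = of_nat p ^ j * Frob p i (c j)"
    by (subst Frob.hom_mult[OF _ c(2), of _ UNIV UNIV], force intro: Qpol_intros,
        subst Frob.hom_power[where C = UNIV and S = UNIV]) (auto intro: Qpol_intros)
  then have "const (1 / of_nat p) * (Frob p i (c j) * (of_nat p ^ Suc j * z)) =
      (const (1 / of_nat p) * of_nat p) * (Frob p i (of_nat p ^ j * c j) * z)"
    by (simp add: mult_ac)
  moreover have "Frob p i (of_nat p ^ j * c j) * z \<in> Zpol p"
    by (rule lpolys_mult[OF subring_rat_Zloc[OF p] Frob_mem[OF subring_rat_Zloc[OF p]] z(1)])
      (rule functional_equation_denominator[OF c h])
  ultimately show ?thesis using p z(2) by (auto simp: prime_gt_0_nat)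
qed

lemma fdefect_integral:
  assumes c: "\<And>k. c k = h k + ftail p c k" "\<And>k. c k \<in> Qpol" and h: "\<And>k. h k \<in> Zpol p"
    and a: "\<And>j. j < k \<Longrightarrow> a j \<in> Zpol p"
  shows "fdefect p c a k \<in> Zpol p"
  unfolding fdefect_def
proof (intro lpolys_sum subring_rat_Zloc p)
  fix i j assume ij: "i \<in> {1..k}" "j \<in> {..k - i}"
  then have "a (k - i - j) \<in> Zpol p" by (intro a) auto
  from lpolys_mult[OF subring_rat_Zloc[OF p] _ fdefect_term[OF c h this, of i j], of "v i"]
  show "const (1 / of_nat p) * v i * Frob p i (c j) *
      (Frob p i (a (k - i - j)) ^ (p ^ j) - a (k - i - j) ^ (p ^ (i + j))) \<in> Zpol p"
    by (simp add: lpolys_gvar subring_rat_Zloc p mult_ac)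
qed

text \<open>Since \<open>h 0 = 1\<close>, the element \<open>a k\<close> occurs in
  \<open>conv p h a k\<close> with coefficient 1. All other terms, the defect included, involve only
  \<open>a j\<close> with j < k.\<close>

lemma functional_equation_integral:
  assumes c: "\<And>k. c k = h k + ftail p c k" "\<And>k. c k \<in> Qpol" and h: "\<And>k. h k \<in> Zpol p" "h 0 = 1"
    and a: "\<And>k. a k \<in> Qpol"
    and g: "\<And>k. conv p c a k - ftail p (conv p c a) k \<in> Zpol p"
  shows "a k \<in> Zpol p"
proof (induction k rule: less_induct)
  case (less k)
  have "conv p h a k = a k + (\<Sum>s\<in>{1..k}. h s * a (k - s) ^ (p ^ s))"
    by (simp add: conv_def atMost_atLeast0 sum.atLeast_Suc_atMost h)
  then have "a k = (conv p c a k - ftail p (conv p c a) k) + fdefect p c a k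
      - (\<Sum>s\<in>{1..k}. h s * a (k - s) ^ (p ^ s))"
    using conv_functional_equation[OF c a, where k = k] by simp
  also have "\<dots> \<in> Zpol p"
    using less by (intro Zpol_intros[OF p] g h fdefect_integral[OF c h(1)]) auto
  finally show ?case .
qed

end


section \<open>Logarithms and units\<close>

text \<open>Hazewinkel's recursion with arbitrary parameters \<open>w\<close> in place of the v_k.
  This covers the logarithm itself, its image under a right unit, and its truncation
  \<open>lam\<close>. The function \<open>vsolve\<close> below recovers the parameters in positive
  degrees.\<close>

fun lgen :: "nat \<Rightarrow> (nat \<Rightarrow> lpoly) \<Rightarrow> nat \<Rightarrow> lpoly" where
  "lgen p w k = (if k = 0 then 1 else const (1 / of_nat p) * (\<Sum>i<k. lgen p w i * w (k - i) ^ (p ^ i)))"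

fun vsolve :: "nat \<Rightarrow> (nat \<Rightarrow> lpoly) \<Rightarrow> nat \<Rightarrow> lpoly" where
  "vsolve p c k = of_nat p * c k - (\<Sum>j\<in>{1..<k}. c j * vsolve p c (k - j) ^ (p ^ j))"

text \<open>When \<open>c 0 = 1\<close>, the unique \<open>s\<close> with
  \<open>conv p c s = d\<close>: the t's of a strict isomorphism between the group laws with
  logarithms \<open>c\<close> and \<open>d\<close>.\<close>

fun tsolve :: "nat \<Rightarrow> (nat \<Rightarrow> lpoly) \<Rightarrow> (nat \<Rightarrow> lpoly) \<Rightarrow> nat \<Rightarrow> lpoly" where
  "tsolve p c d k = d k - (\<Sum>a\<in>{1..k}. c a * tsolve p c d (k - a) ^ (p ^ a))"

declare eta_log.simps(2) [simp del] lgen.simps [simp del] vsolve.simps [simp del] tsolve.simps [simp del]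

lemma lgen_0 [simp]: "lgen p w 0 = 1"
  by (simp add: lgen.simps)

lemma lgen_cong: "(\<And>j. 1 \<le> j \<Longrightarrow> j \<le> k \<Longrightarrow> w j = w' j) \<Longrightarrow> lgen p w k = lgen p w' k"
proof (induction k rule: less_induct)
  case (less k)
  then show ?case
    by (subst (1 2) lgen.simps) (auto intro!: arg_cong2[where f = "(*)"] sum.cong)
qed

lemma hlog_eq: "hlog p k = lgen p v k"
proof (induction k rule: less_induct)
  case (less k)
  then show ?case
    by (subst hlog.simps, subst lgen.simps) (auto intro!: arg_cong2[where f = "(*)"] sum.cong)
qed

lemma vsolve_cong: "(\<And>j. 1 \<le> j \<Longrightarrow> j \<le> k \<Longrightarrow> c j = c' j) \<Longrightarrow> 1 \<le> k \<Longrightarrow> vsolve p c k = vsolve p c' k"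
proof (induction k rule: less_induct)
  case (less k)
  then show ?case
    by (subst (1 2) vsolve.simps) (auto intro!: arg_cong2[where f = "(-)"] sum.cong)
qed

lemma eta_v_eq: "eta_v p m i k = vsolve p (eta_log p m i) k"
proof (induction k rule: less_induct)
  case (less k)
  then show ?case
    by (subst eta_v.simps, subst vsolve.simps) (auto intro!: arg_cong2[where f = "(-)"] sum.cong)
qed

lemma lessThan_eq_insert: "0 < k \<Longrightarrow> {..<k} = insert 0 {1..<k}" for k :: nat
  by auto

lemma atMost_eq_insert: "{..k} = insert 0 {1..k}" for k :: nat
  by auto

lemma vsolve_lgen:
  assumes "0 < p" "1 \<le> k"
  shows "vsolve p (lgen p w) k = w k"
  using assms(2)
proof (induction k rule: less_induct)
  case (less k)
  have "of_nat p * lgen p w k = (\<Sum>i<k. lgen p w i * w (k - i) ^ (p ^ i))"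
    using less assms(1) by (subst lgen.simps) (simp flip: mult.assoc)
  also have "\<dots> = w k + (\<Sum>i\<in>{1..<k}. lgen p w i * w (k - i) ^ (p ^ i))"
    using less.prems by (subst lessThan_eq_insert) auto
  finally show ?case
    using less by (subst vsolve.simps) (auto simp: algebra_simps intro!: sum.cong)
qed

lemma vsolve_relation:
  assumes "c 0 = 1" "1 \<le> k"
  shows "(\<Sum>j<k. c j * vsolve p c (k - j) ^ (p ^ j)) = of_nat p * c k"
  using assms by (subst lessThan_eq_insert) (auto simp: vsolve.simps[of p c k])

lemma lgen_vsolve:
  assumes "0 < p" "c 0 = 1"
  shows "lgen p (vsolve p c) k = c k"
proof (induction k rule: less_induct)
  case (less k)
  show ?case
  proof (cases "k = 0")
    case False
    have "lgen p (vsolve p c) k = const (1 / of_nat p) * (\<Sum>i<k. c i * vsolve p c (k - i) ^ (p ^ i))"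
      using False less by (subst lgen.simps) (auto intro!: sum.cong)
    also have "\<dots> = c k"
      using False assms by (subst vsolve_relation) (auto simp flip: mult.assoc)
    finally show ?thesis .
  qed (use assms in simp)
qed

lemma conv_tsolve: "c 0 = 1 \<Longrightarrow> conv p c (tsolve p c d) k = d k"
  unfolding conv_def by (subst atMost_eq_insert) (auto simp: tsolve.simps[of p c d k])

lemma tsolve_unique:
  assumes "c 0 = 1" "\<And>j. j \<le> k \<Longrightarrow> conv p c s j = d j"
  shows "s k = tsolve p c d k"
  using assms(2)
proof (induction k rule: less_induct)
  case (less k)
  have "s k = d k - (\<Sum>a\<in>{1..k}. c a * s (k - a) ^ (p ^ a))"
    using less.prems[of k] assms(1) by (auto simp: conv_def atMost_eq_insert algebra_simps)
  also have "(\<Sum>a\<in>{1..k}. c a * s (k - a) ^ (p ^ a)) = (\<Sum>a\<in>{1..k}. c a * tsolve p c d (k - a) ^ (p ^ a))"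
  proof (intro sum.cong refl)
    fix a assume "a \<in> {1..k}"
    then show "c a * s (k - a) ^ (p ^ a) = c a * tsolve p c d (k - a) ^ (p ^ a)"
      using less by (subst less.IH) auto
  qed
  finally show ?case by (simp add: tsolve.simps[of p c d k])
qed

text \<open>Logarithms that agree up to index m are linked by t's that vanish up to m, which is what
  membership in Gamma(m+1) demands.\<close>

lemma tsolve_eq_unit:
  assumes "c 0 = 1" "\<And>k. k \<le> m \<Longrightarrow> c k = d k" "0 < p" "k \<le> m"
  shows "tsolve p c d k = (if k = 0 then 1 else 0)"
proof (rule tsolve_unique[symmetric, of _ _ p "\<lambda>k. if k = 0 then 1 else 0"])
  fix j assume j: "j \<le> k"
  have "conv p c (\<lambda>k. if k = 0 then 1 else 0) j = (\<Sum>i\<le>j. if i = j then c j else 0)"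
    unfolding conv_def by (intro sum.cong) (use assms in \<open>auto simp: zero_power\<close>)
  then show "conv p c (\<lambda>k. if k = 0 then 1 else 0) j = d j" using assms j by simp
qed (use assms in auto)

lemma lgen_mem:
  assumes "\<And>j. 1 \<le> j \<Longrightarrow> j \<le> k \<Longrightarrow> w j \<in> lpolys UNIV S {}"
  shows "lgen p w k \<in> lpolys UNIV S {}"
  using assms
proof (induction k rule: less_induct)
  case (less k)
  note I = lpolys_intros[OF subring_rat_UNIV] lpolys_const[OF subring_rat_UNIV]
  show ?case
  proof (cases "k = 0")
    case False
    then show ?thesis
      by (subst lgen.simps, simp, intro lpolys_mult lpolys_sum lpolys_power I(2-) UNIV_I subring_rat_UNIV less)
        (use less.prems in auto)
  qed (auto intro: I)
qed

lemma vsolve_mem: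
  assumes "\<And>j. 1 \<le> j \<Longrightarrow> j \<le> k \<Longrightarrow> c j \<in> lpolys UNIV S {}" "1 \<le> k"
  shows "vsolve p c k \<in> lpolys UNIV S {}"
  using assms
proof (induction k rule: less_induct)
  case (less k)
  note I = lpolys_intros[OF subring_rat_UNIV] lpolys_const[OF subring_rat_UNIV]
  show ?case
    by (subst vsolve.simps, intro lpolys_diff lpolys_mult lpolys_sum lpolys_power I(3) subring_rat_UNIV less)
      (use less.prems in auto)
qed

lemma tsolve_mem:
  assumes "\<And>j. j \<le> k \<Longrightarrow> c j \<in> lpolys UNIV S {}" "\<And>j. j \<le> k \<Longrightarrow> d j \<in> lpolys UNIV S {}"
  shows "tsolve p c d k \<in> lpolys UNIV S {}"
  using assms
proof (induction k rule: less_induct)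
  case (less k)
  show ?case
    by (subst tsolve.simps, intro lpolys_diff lpolys_mult lpolys_sum lpolys_power subring_rat_UNIV less)
      (use less.prems in auto)
qed

lemma vsolve_0: "vsolve p c 0 = of_nat p * c 0"
  by (subst vsolve.simps) simp

lemma vsolve_Qpol: "(\<And>j. c j \<in> Qpol) \<Longrightarrow> vsolve p c k \<in> Qpol"
  by (cases "k = 0") (simp_all add: vsolve_0 lpolys_mult lpolys_of_nat vsolve_mem)

section \<open>Substitutions commute with the recursive solutions\<close>

context fixing
begin

lemma hom_Qpol_mult: "P \<in> Qpol \<Longrightarrow> Q \<in> Qpol \<Longrightarrow> lsubst f (P * Q) = lsubst f P * lsubst f Q"
  by (rule hom_mult[of P UNIV UNIV Q UNIV UNIV]) (auto elim: lpolys_mono)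

lemma hom_Qpol_power: "P \<in> Qpol \<Longrightarrow> lsubst f (P ^ k) = lsubst f P ^ k"
  by (rule hom_power[of P UNIV UNIV]) (auto elim: lpolys_mono)

lemma hom_conv:
  assumes "\<And>k. c k \<in> Qpol" "\<And>k. a k \<in> Qpol"
  shows "lsubst f (conv p c a k) = conv p (\<lambda>k. lsubst f (c k)) (\<lambda>k. lsubst f (a k)) k"
  unfolding conv_def by (simp add: hom_sum hom_Qpol_mult hom_Qpol_power Qpol_intros assms)

lemma hom_vsolve:
  assumes "\<And>k. c k \<in> Qpol"
  shows "lsubst f (vsolve p c k) = vsolve p (\<lambda>k. lsubst f (c k)) k"
proof (induction k rule: less_induct)
  case (less k)
  have "lsubst f (vsolve p c k) = of_nat p * lsubst f (c k) - (\<Sum>j\<in>{1..<k}. lsubst f (c j) * lsubst f (vsolve p c (k - j)) ^ (p ^ j))"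
    by (subst vsolve.simps) (simp add: hom_sum hom_diff hom_Qpol_mult hom_Qpol_power Qpol_intros assms vsolve_Qpol)
  also have "\<dots> = vsolve p (\<lambda>k. lsubst f (c k)) k"
    by (subst (2) vsolve.simps) (use less in \<open>auto intro!: sum.cong\<close>)
  finally show ?case .
qed

lemma hom_lgen:
  assumes "\<And>k. w k \<in> Qpol"
  shows "lsubst f (lgen p w k) = lgen p (\<lambda>k. lsubst f (w k)) k"
proof (induction k rule: less_induct)
  case (less k)
  show ?case
  proof (cases "k = 0")
    case False
    have "lgen p w i \<in> Qpol" for i using assms by (intro lgen_mem)
    then have "lsubst f (lgen p w k) = const (1 / of_nat p) * (\<Sum>i<k. lsubst f (lgen p w i) * lsubst f (w (k - i)) ^ (p ^ i))"
      using False by (subst lgen.simps) (simp add: hom_sum hom_const_mult hom_Qpol_mult hom_Qpol_power Qpol_intros assms)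
    also have "\<dots> = lgen p (\<lambda>k. lsubst f (w k)) k"
      using False by (subst (2) lgen.simps) (use less in \<open>auto intro!: sum.cong arg_cong2[where f = "(*)"]\<close>)
    finally show ?thesis .
  qed simp
qed

lemma hom_tsolve:
  assumes "\<And>k. c k \<in> Qpol" "\<And>k. d k \<in> Qpol"
  shows "lsubst f (tsolve p c d k) = tsolve p (\<lambda>k. lsubst f (c k)) (\<lambda>k. lsubst f (d k)) k"
proof (induction k rule: less_induct)
  case (less k)
  have "tsolve p c d i \<in> Qpol" for i using assms by (intro tsolve_mem)
  then have "lsubst f (tsolve p c d k) = lsubst f (d k) - (\<Sum>a\<in>{1..k}. lsubst f (c a) * lsubst f (tsolve p c d (k - a)) ^ (p ^ a))"
    by (subst tsolve.simps) (simp add: hom_sum hom_diff hom_Qpol_mult hom_Qpol_power Qpol_intros assms)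
  also have "\<dots> = tsolve p (\<lambda>k. lsubst f (c k)) (\<lambda>k. lsubst f (d k)) k"
    by (subst (2) tsolve.simps) (use less in \<open>auto intro!: sum.cong\<close>)
  finally show ?case .
qed

end

text \<open>The bound \<open>K\<close> on the indices is recorded because later arguments must know
  which t's a term cannot involve.\<close>

definition gens :: "nat \<Rightarrow> nat \<Rightarrow> nat \<Rightarrow> gen set" where
  "gens m s K = V ` {1..K} \<union> {T i k | i k. 1 \<le> i \<and> i \<le> s \<and> m < k \<and> k \<le> K}"

lemma gens_mono: "s \<le> s' \<Longrightarrow> K \<le> K' \<Longrightarrow> gens m s K \<subseteq> gens m s' K'"
  by (auto simp: gens_def)

lemma lpolys_gens_mono: "P \<in> lpolys C (gens m s K) U \<Longrightarrow> s \<le> s' \<Longrightarrow> K \<le> K' \<Longrightarrow> P \<in> lpolys C (gens m s' K') U"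
  using gens_mono[of s s' K K' m] by (blast intro: lpolys_mono)

lemma hlog_mem: "hlog p k \<in> lpolys UNIV (gens m 0 k) {}"
  unfolding hlog_eq by (rule lgen_mem) (auto intro!: lpolys_gvar simp: gens_def)

lemma tgen_mem: "subring_rat C \<Longrightarrow> 1 \<le> i \<Longrightarrow> tgen m i k \<in> lpolys C (gens m i k) {}"
  by (auto simp: tgen_def gens_def intro: lpolys_0 lpolys_1 lpolys_gvar)

lemma eta_log_Suc: "eta_log p m (Suc i) k = conv p (eta_log p m i) (tgen m (Suc i)) k"
  by (simp add: conv_def eta_log.simps)

lemma eta_log_mem: "eta_log p m i k \<in> lpolys UNIV (gens m i k) {}"
proof (induction i arbitrary: k)
  case (Suc i)
  show ?case unfolding eta_log_Suc conv_def
  proof (intro lpolys_sum lpolys_mult lpolys_power subring_rat_UNIV)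
    fix j assume "j \<in> {..k}"
    then show "eta_log p m i j \<in> lpolys UNIV (gens m (Suc i) k) {}"
      "tgen m (Suc i) (k - j) \<in> lpolys UNIV (gens m (Suc i) k) {}"
      by (auto intro: lpolys_gens_mono[OF Suc] lpolys_gens_mono[OF tgen_mem])
  qed
qed (use hlog_mem in simp)

lemma eta_log_Qpol [simp]: "eta_log p m i k \<in> Qpol"
  using eta_log_mem lpolys_UNIV by blast

lemma hlog_Qpol [simp]: "hlog p k \<in> Qpol"
  using hlog_mem lpolys_UNIV by blast

lemma tgen_Qpol [simp]: "tgen m i k \<in> Qpol"
  by (auto simp: tgen_def intro: Qpol_intros)

lemma tgen_Zpol: "prime p \<Longrightarrow> tgen m i k \<in> Zpol p"
  by (auto simp: tgen_def intro: Zpol_intros)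

lemma hlog_0 [simp]: "hlog p 0 = 1"
  by (simp add: hlog.simps)

lemma eta_log_0 [simp]: "eta_log p m i 0 = 1"
  by (induction i) (simp_all add: tgen_def eta_log.simps)

lemma eta_log_low:
  assumes "k \<le> m" "0 < p"
  shows "eta_log p m i k = hlog p k"
proof (induction i)
  case (Suc i)
  have "eta_log p m (Suc i) k = (\<Sum>j\<le>k. if j = k then eta_log p m i k else 0)"
    unfolding eta_log.simps by (intro sum.cong refl) (use assms in \<open>auto simp: tgen_def zero_power\<close>)
  then show ?case using Suc by simp
qed simp

lemma eta_v_low: "1 \<le> k \<Longrightarrow> k \<le> m \<Longrightarrow> 0 < p \<Longrightarrow> eta_v p m i k = v k"
  unfolding eta_v_eq
  by (subst vsolve_cong[of k _ "lgen p v"]) (auto simp: eta_log_low hlog_eq vsolve_lgen)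

lemma eta_v_zero: "1 \<le> k \<Longrightarrow> 0 < p \<Longrightarrow> eta_v p m 0 k = v k"
  unfolding eta_v_eq
  by (subst vsolve_cong[of k _ "lgen p v"]) (auto simp: hlog_eq vsolve_lgen)

lemma eta_v_mem: "1 \<le> k \<Longrightarrow> eta_v p m i k \<in> lpolys UNIV (gens m i k) {}"
  unfolding eta_v_eq by (rule vsolve_mem) (auto intro: lpolys_gens_mono[OF eta_log_mem])

lemma eta_v_Qpol [simp]: "eta_v p m i k \<in> Qpol"
  by (simp add: eta_v_eq vsolve_Qpol)

text \<open>Grouping the double sum of \<open>Delta\<close> by a + b turns it into
  \<open>eta_log\<close> two units further. The coproduct therefore solves for the t's of the
  composite of two adjacent factors.\<close>

lemma Delta_eq:
  assumes "1 \<le> i"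
  shows "Delta p m i k = tsolve p (eta_log p m (i - 1)) (eta_log p m (Suc i)) k"
proof (induction k rule: less_induct)
  case (less k)
  have "(\<Sum>a\<le>k. \<Sum>b\<le>k - a. eta_log p m (i - 1) a * tgen m i b ^ (p ^ a) * tgen m (Suc i) (k - a - b) ^ (p ^ (a + b)))
     = (\<Sum>(a, b)\<in>Sigma {..k} (\<lambda>a. {..k - a}). eta_log p m (i - 1) a * tgen m i b ^ (p ^ a) * tgen m (Suc i) (k - a - b) ^ (p ^ (a + b)))"
    by (rule sum.Sigma) auto
  also have "\<dots> = (\<Sum>(s, a)\<in>Sigma {..k} (\<lambda>s. {..s}). eta_log p m (i - 1) a * tgen m i (s - a) ^ (p ^ a) * tgen m (Suc i) (k - s) ^ (p ^ s))"
    by (rule sum.reindex_bij_witness[where i = "\<lambda>(s, a). (a, s - a)" and j = "\<lambda>(a, b). (a + b, a)"]) auto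
  also have "\<dots> = (\<Sum>s\<le>k. \<Sum>a\<le>s. eta_log p m (i - 1) a * tgen m i (s - a) ^ (p ^ a) * tgen m (Suc i) (k - s) ^ (p ^ s))"
    by (rule sum.Sigma[symmetric]) auto
  also have "\<dots> = eta_log p m (Suc i) k"
  proof -
    obtain j where "i = Suc j" using assms by (cases i) auto
    then show ?thesis by (simp add: sum_distrib_right eta_log.simps)
  qed
  finally show ?case
    by (subst Delta.simps, subst tsolve.simps) (use less in \<open>auto intro!: sum.cong\<close>)
qed

lemma Delta_Qpol [simp]: "1 \<le> i \<Longrightarrow> Delta p m i k \<in> Qpol"
  by (simp add: Delta_eq tsolve_mem)

lemma Delta_mem: "Delta p m 1 k \<in> lpolys UNIV (gens m 2 k) {}"
  unfolding Delta_eq[OF order_refl]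
  by (rule tsolve_mem) (auto simp: numeral_2_eq_2
      intro: lpolys_gens_mono[OF eta_log_mem] lpolys_gens_mono[OF hlog_mem])


section \<open>Integrality of the structure maps\<close>

context
  fixes p m :: nat assumes p: "prime p"
begin

lemma p_pos: "0 < p" using p prime_gt_0_nat by blast

lemma Frob_v_power: "Frob p i (v j ^ k) = v j ^ (p ^ i * k)"
  by (subst Frob.hom_Qpol_power) (auto intro: Qpol_intros simp: power_mult)

lemma Frob_tgen: "Frob p i (tgen m s k) = tgen m s k ^ (p ^ i)"
  using p_pos by (simp add: tgen_def zero_power)

text \<open>The defining recursion splits off the last v of each monomial of the logarithm, the
  functional equation the first. By induction the inner coefficients are expanded by the functional
  equation; after regrouping by the first v_a, the inner sum is again the recursion, seen through
  Frobenius.\<close>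

lemma hlog_functional_equation: "hlog p k = (if k = 0 then 1 else 0) + ftail p (hlog p) k"
proof (induction k rule: less_induct)
  case (less k)
  show ?case
  proof (cases "k = 0")
    case False
    let ?w = "\<lambda>i. const (1 / of_nat p) * v i"
    have rel: "of_nat p * hlog p j = (\<Sum>i<j. hlog p i * v (j - i) ^ (p ^ i))" if "0 < j" for j
      using that p_pos by (subst hlog.simps) (simp flip: mult.assoc)
    have "(\<Sum>i\<in>{1..<k}. hlog p i * v (k - i) ^ (p ^ i)) =
        (\<Sum>i\<in>{1..<k}. \<Sum>a\<in>{1..i}. ?w a * Frob p a (hlog p (i - a) * v (k - i) ^ (p ^ (i - a))))"
    proof (intro sum.cong refl)
      fix i assume i: "i \<in> {1..<k}"
      have "hlog p i * v (k - i) ^ (p ^ i) = ftail p (hlog p) i * v (k - i) ^ (p ^ i)"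
        using less[of i] i by auto
      also have "\<dots> = (\<Sum>a\<in>{1..i}. ?w a * Frob p a (hlog p (i - a) * v (k - i) ^ (p ^ (i - a))))"
        unfolding ftail_def sum_distrib_right
        by (intro sum.cong refl, subst Frob.hom_Qpol_mult)
          (auto simp: Frob_v_power mult.assoc intro: Qpol_intros simp flip: power_add)
      finally show "hlog p i * v (k - i) ^ (p ^ i) =
        (\<Sum>a\<in>{1..i}. ?w a * Frob p a (hlog p (i - a) * v (k - i) ^ (p ^ (i - a))))" .
    qed
    also have "\<dots> = (\<Sum>(i, a)\<in>Sigma {1..<k} (\<lambda>i. {1..i}). ?w a * Frob p a (hlog p (i - a) * v (k - i) ^ (p ^ (i - a))))"
      by (rule sum.Sigma) auto
    also have "\<dots> = (\<Sum>(a, j)\<in>Sigma {1..<k} (\<lambda>a. {..<k - a}). ?w a * Frob p a (hlog p j * v (k - a - j) ^ (p ^ j)))"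
      by (rule sum.reindex_bij_witness[where i = "\<lambda>(a, j). (a + j, a)" and j = "\<lambda>(i, a). (a, i - a)"]) auto
    also have "\<dots> = (\<Sum>a\<in>{1..<k}. \<Sum>j<k - a. ?w a * Frob p a (hlog p j * v (k - a - j) ^ (p ^ j)))"
      by (rule sum.Sigma[symmetric]) auto
    also have "\<dots> = (\<Sum>a\<in>{1..<k}. ?w a * (of_nat p * Frob p a (hlog p (k - a))))"
    proof (intro sum.cong refl)
      fix a assume a: "a \<in> {1..<k}"
      have "(\<Sum>j<k - a. ?w a * Frob p a (hlog p j * v (k - a - j) ^ (p ^ j))) =
         ?w a * Frob p a (\<Sum>j<k - a. hlog p j * v (k - a - j) ^ (p ^ j))"
        by (simp only: Frob.hom_sum sum_distrib_left)
      also have "(\<Sum>j<k - a. hlog p j * v (k - a - j) ^ (p ^ j)) = of_nat p * hlog p (k - a)"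
        using rel[of "k - a"] a by simp
      also have "Frob p a (of_nat p * hlog p (k - a)) = of_nat p * Frob p a (hlog p (k - a))"
        by (subst Frob.hom_Qpol_mult) (auto intro: Qpol_intros)
      finally show "(\<Sum>j<k - a. ?w a * Frob p a (hlog p j * v (k - a - j) ^ (p ^ j))) =
        ?w a * (of_nat p * Frob p a (hlog p (k - a)))" .
    qed
    finally have tail: "(\<Sum>i\<in>{1..<k}. hlog p i * v (k - i) ^ (p ^ i)) =
      (\<Sum>a\<in>{1..<k}. ?w a * (of_nat p * Frob p a (hlog p (k - a))))" .
    have "of_nat p * hlog p k = v k + (\<Sum>i\<in>{1..<k}. hlog p i * v (k - i) ^ (p ^ i))"
      using False by (subst rel, simp, subst lessThan_eq_insert) auto
    also have "\<dots> = of_nat p * ftail p (hlog p) k"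
    proof -
      have "{1..k} = insert k {1..<k}" using False by auto
      then have "of_nat p * ftail p (hlog p) k = of_nat p * (?w k * Frob p k (hlog p 0)) +
          (\<Sum>a\<in>{1..<k}. of_nat p * (?w a * Frob p a (hlog p (k - a))))"
        by (simp add: ftail_def ring_distribs sum_distrib_left)
      moreover have "of_nat p * (?w k * Frob p k (hlog p 0)) = v k"
        using p_pos by (simp flip: mult.assoc)
      ultimately show ?thesis unfolding tail by (simp add: mult_ac)
    qed
    finally have "of_nat p * hlog p k = of_nat p * ftail p (hlog p) k" .
    from of_nat_mult_lpoly_cancel[OF this] show ?thesis using p_pos False by simp
  qed (simp add: ftail_def)
qed

text \<open>\<open>eta_log p m i\<close> differs from the logarithm by a twisted product with the \<open>t\<^sub>k\<close>, on which the
  Frobenius lift is the \<open>p\<close>-th power, so that no defect arises.\<close>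

fun heta :: "nat \<Rightarrow> nat \<Rightarrow> lpoly" where
  "heta 0 k = (if k = 0 then 1 else 0)"
| "heta (Suc i) k = conv p (heta i) (tgen m (Suc i)) k"

lemma eta_log_functional_equation: "eta_log p m i k = heta i k + ftail p (eta_log p m i) k"
proof (induction i arbitrary: k)
  case 0
  have "eta_log p m 0 = hlog p" by (simp add: fun_eq_iff)
  then show ?case using hlog_functional_equation[of k] by simp
next
  case (Suc i)
  have "fdefect p (eta_log p m i) (tgen m (Suc i)) k = 0"
    unfolding fdefect_def by (intro sum.neutral ballI) (simp add: Frob_tgen power_add flip: power_mult)
  moreover have "eta_log p m (Suc i) = conv p (eta_log p m i) (tgen m (Suc i))"
    by (rule ext) (rule eta_log_Suc)
  ultimately show ?case
    using conv_functional_equation[OF Suc, of "tgen m (Suc i)" k] by (simp)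
qed

lemma heta_Zpol: "heta i k \<in> Zpol p"
proof (induction i arbitrary: k)
  case (Suc i)
  then show ?case using p by (auto simp: conv_def intro!: Zpol_intros tgen_Zpol)
qed (auto intro: Zpol_intros p)

lemma heta_0 [simp]: "heta i 0 = 1"
  by (induction i) (simp_all add: conv_def tgen_def)

lemma heta_1: "heta 1 k = tgen m 1 k"
proof -
  have "heta 1 k = (\<Sum>j\<le>k. if j = 0 then tgen m 1 k else 0)"
    unfolding One_nat_def heta.simps conv_def by (intro sum.cong refl) auto
  then show ?thesis by simp
qed

text \<open>\<open>eta_v\<close> takes the value p at index 0. The value 0 is needed there so that
  the sum of \<open>conv\<close> up to k reduces to Hazewinkel's relation, which stops before
  k.\<close>

definition eta_v0 :: "nat \<Rightarrow> nat \<Rightarrow> lpoly" where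
  "eta_v0 i k = (if k = 0 then 0 else eta_v p m i k)"

lemma conv_eta_v0: "conv p (eta_log p m i) (eta_v0 i) k = (if k = 0 then 0 else of_nat p * eta_log p m i k)"
proof (cases "k = 0")
  case False
  have "{..k} = insert k {..<k}" using False by auto
  then have "conv p (eta_log p m i) (eta_v0 i) k = (\<Sum>j<k. eta_log p m i j * vsolve p (eta_log p m i) (k - j) ^ (p ^ j))"
    using p_pos by (simp add: conv_def eta_v0_def eta_v_eq zero_power)
  then show ?thesis using False vsolve_relation[of "eta_log p m i" k p] by simp
qed (use p_pos in \<open>simp add: conv_def eta_v0_def\<close>)

text \<open>\<open>conv\<close> equals p times \<open>eta_log\<close> except at index 0, where it is
  0 instead of p. The summand thereby missing from the tail is v_k, which is why v_k appears in the
  remainder.\<close>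

lemma conv_eta_v0_tail:
  "conv p (eta_log p m i) (eta_v0 i) k - ftail p (conv p (eta_log p m i) (eta_v0 i)) k =
     (if k = 0 then 0 else of_nat p * heta i k + v k)"
proof (cases "k = 0")
  case False
  let ?c = "eta_log p m i"
  have "{1..k} = insert k {1..<k}" using False by auto
  then have t: "ftail p (\<lambda>k. of_nat p * ?c k) k = v k + (\<Sum>j\<in>{1..<k}. const (1 / of_nat p) * v j * Frob p j (of_nat p * ?c (k - j)))"
    using p_pos by (simp add: ftail_def) (simp add: mult.assoc mult.left_commute[of _ "v k"])
  have "ftail p (conv p ?c (eta_v0 i)) k = (\<Sum>j\<in>{1..<k}. const (1 / of_nat p) * v j * Frob p j (of_nat p * ?c (k - j)))"
    using \<open>{1..k} = insert k {1..<k}\<close> by (simp add: ftail_def conv_eta_v0)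
  also have "\<dots> = ftail p (\<lambda>k. of_nat p * ?c k) k - v k" using t by simp
  also have "ftail p (\<lambda>k. of_nat p * ?c k) k = of_nat p * ftail p ?c k"
    unfolding ftail_def sum_distrib_left
    by (intro sum.cong refl, subst Frob.hom_Qpol_mult) (auto intro: Qpol_intros simp: mult_ac)
  also have "of_nat p * ftail p ?c k = of_nat p * ?c k - of_nat p * heta i k"
    using eta_log_functional_equation[of i k] by (simp add: algebra_simps)
  finally show ?thesis using False conv_eta_v0[of i k] by simp
qed (simp add: conv_eta_v0 ftail_def)

lemma eta_v0_Qpol: "eta_v0 i k \<in> Qpol"
  by (simp add: eta_v0_def Qpol_intros)

lemma eta_v0_Zpol: "eta_v0 i k \<in> Zpol p"
proof (rule functional_equation_integral[OF p eta_log_functional_equation[of i] eta_log_Qpol heta_Zpol heta_0 eta_v0_Qpol])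
  show "conv p (eta_log p m i) (eta_v0 i) k - ftail p (conv p (eta_log p m i) (eta_v0 i)) k \<in> Zpol p" for k
    unfolding conv_eta_v0_tail using p by (auto intro!: Zpol_intros heta_Zpol)
qed

lemma eta_v_integral:
  assumes "1 \<le> k"
  shows "eta_v p m i k \<in> lpolys (Zloc p) (gens m i k) {}"
  using lpolys_Int[OF _ eta_v_mem[OF assms], of p m i "Zloc p" UNIV "{}"] eta_v0_Zpol[of i k] assms
  by (simp add: eta_v0_def)

text \<open>Composing \<open>eta_log p m 0\<close> with the coproduct gives
  \<open>eta_log p m 2\<close>, whose functional equation has the integral remainder
  \<open>heta 2\<close>.\<close>

lemma Delta_integral: "Delta p m 1 k \<in> lpolys (Zloc p) (gens m 2 k) {}"
proof -
  have "(\<lambda>k. Delta p m 1 k) k \<in> Zpol p"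
  proof (rule functional_equation_integral[OF p eta_log_functional_equation[of 0] eta_log_Qpol heta_Zpol heta_0])
    fix k
    have "conv p (eta_log p m 0) (Delta p m 1) = eta_log p m 2"
    proof (rule ext)
      have "Delta p m 1 = tsolve p (eta_log p m 0) (eta_log p m 2)"
        by (rule ext) (simp add: Delta_eq numeral_2_eq_2)
      then show "conv p (eta_log p m 0) (Delta p m 1) k = eta_log p m 2 k" for k
        using conv_tsolve[of "eta_log p m 0" p "eta_log p m 2" k] by simp
    qed
    then have "conv p (eta_log p m 0) (Delta p m 1) k - ftail p (conv p (eta_log p m 0) (Delta p m 1)) k = heta 2 k"
      using eta_log_functional_equation[of 2 k] by (simp)
    then show "conv p (eta_log p m 0) (\<lambda>k. Delta p m 1 k) k - ftail p (conv p (eta_log p m 0) (\<lambda>k. Delta p m 1 k)) k \<in> Zpol p"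
      by (simp add: heta_Zpol)
  qed simp
  from lpolys_Int[OF this Delta_mem[of p m k]] show ?thesis by simp
qed

text \<open>Obtained by comparing two expressions for the same remainder; for one factor
  \<open>heta 1\<close> is just the sequence of the t's. The congruences for the right unit in
  degrees above m are read off from this formula.\<close>

lemma eta_v_formula:
  assumes "1 \<le> k"
  shows "eta_v p m 1 k = v k + of_nat p * tgen m 1 k
     - (\<Sum>s\<in>{1..<k}. tgen m 1 s * eta_v p m 1 (k - s) ^ (p ^ s)) + fdefect p (eta_log p m 1) (eta_v0 1) k"
proof -
  have "conv p (heta 1) (eta_v0 1) k = eta_v p m 1 k + (\<Sum>s\<in>{1..<k}. tgen m 1 s * eta_v p m 1 (k - s) ^ (p ^ s))"
  proof -
    have "{..k} = insert 0 (insert k {1..<k})" using assms by auto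
    then have "conv p (heta 1) (eta_v0 1) k = heta 1 0 * eta_v0 1 k + heta 1 k * eta_v0 1 0 ^ (p ^ k)
        + (\<Sum>s\<in>{1..<k}. heta 1 s * eta_v0 1 (k - s) ^ (p ^ s))"
      using assms by (simp add: conv_def add.assoc del: heta.simps One_nat_def)
    moreover have "(\<Sum>s\<in>{1..<k}. heta 1 s * eta_v0 1 (k - s) ^ (p ^ s)) = (\<Sum>s\<in>{1..<k}. tgen m 1 s * eta_v p m 1 (k - s) ^ (p ^ s))"
      by (intro sum.cong refl) (auto simp: heta_1 eta_v0_def simp del: One_nat_def)
    moreover have "eta_v0 1 k = eta_v p m 1 k" "eta_v0 1 0 = 0" using assms by (auto simp: eta_v0_def)
    ultimately show ?thesis using p_pos by (simp add: zero_power del: One_nat_def)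
  qed
  moreover have "conv p (heta 1) (eta_v0 1) k - fdefect p (eta_log p m 1) (eta_v0 1) k = of_nat p * tgen m 1 k + v k"
    using conv_functional_equation[OF eta_log_functional_equation[of 1] eta_log_Qpol, where a = "eta_v0 1" and k = k, OF eta_v0_Qpol]
      conv_eta_v0_tail[of 1 k] heta_1[of k] assms by (simp add: algebra_simps del: One_nat_def heta.simps)
  ultimately show ?thesis by (simp add: algebra_simps del: One_nat_def)
qed

end


declare One_nat_def [simp del, symmetric, simp]

lemma eta_log_zero [simp]: "eta_log p m 0 = hlog p"
  by (rule ext) simp

section \<open>Ideals generated by variables\<close>

definition kill :: "gen set \<Rightarrow> lpoly \<Rightarrow> lpoly" where
  "kill K = lsubst (\<lambda>x. if x \<in> K then 0 else gvar x)"

lemma fixing_kill: "K \<inter> U = {} \<Longrightarrow> fixing (\<lambda>x. if x \<in> K then 0 else gvar x) U"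
  by (auto intro!: fixing.intro)

lemma kill_eq:
  assumes "P \<in> lpolys C S U" "K \<inter> U = {}"
  shows "kill K P = (\<Sum>e\<in>keys P. if \<forall>x\<in>K. lookup e x = 0 then single e (lookup P e) else 0)"
proof -
  interpret fixing "\<lambda>x. if x \<in> K then 0 else gvar x" U by (rule fixing_kill[OF assms(2)])
  have *: "smon (\<lambda>x. if x \<in> K then 0 else gvar x) e = (if \<forall>x\<in>K. lookup e x = 0 then single e 1 else 0)"
    if e: "e \<in> keys P" for e
  proof (cases "\<forall>x\<in>K. lookup e x = 0")
    case True
    then show ?thesis by (subst smon_eq_gvar) auto
  next
    case False
    then obtain x where x: "x \<in> K" "lookup e x \<noteq> 0" by auto
    have "lookup e x \<ge> 0"
    proof (rule ccontr)
      assume "\<not> 0 \<le> lookup e x"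
      then have "x \<in> U" using lpolysD(3)[OF assms(1), of e x] e by (auto simp: in_keys_iff)
      then show False using x assms(2) by auto
    qed
    then have "spow (\<lambda>x. if x \<in> K then 0 else gvar x) x (lookup e x) = 0" "x \<in> keys e"
      using x by (auto simp: spow_def in_keys_iff zero_power)
    then have "smon (\<lambda>x. if x \<in> K then 0 else gvar x) e = 0"
      unfolding smon_def by (intro prod_zero) auto
    then show ?thesis using False by auto
  qed
  show ?thesis
    unfolding kill_def lsubst_mext mext_def by (intro sum.cong refl) (auto simp: *)
qed

lemma lookup_kill:
  assumes "P \<in> lpolys C S U" "K \<inter> U = {}"
  shows "lookup (kill K P) e = (if \<forall>x\<in>K. lookup e x = 0 then lookup P e else 0)"
proof -
  have "lookup (kill K P) e = (\<Sum>e'\<in>keys P. if e' = e then (if \<forall>x\<in>K. lookup e x = 0 then lookup P e else 0) else 0)"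
    unfolding kill_eq[OF assms] lookup_sum
    by (intro sum.cong refl) (auto simp: lookup_single)
  then show ?thesis by (auto simp: in_keys_iff)
qed

lemma kill_mem:
  assumes "P \<in> lpolys C S U" "K \<inter> U = {}"
  shows "kill K P \<in> lpolys C (S - K) U"
  by (rule lpolysI) (use assms in \<open>auto simp: in_keys_iff lookup_kill[OF assms] dest: lpolysD split: if_splits\<close>)

text \<open>Every monomial removed by \<open>kill K\<close> has a positive power of a generator in
  \<open>K\<close>, since none of those is inverted.\<close>

lemma diff_kill_mem_ispan:
  assumes C: "subring_rat C" and P: "P \<in> lpolys C S U" "K \<inter> U = {}"
  shows "P - kill K P \<in> ispan (lpolys C S U) (gvar ` (K \<inter> S))"
proof -
  note I = ispan_ideal[OF subring_lpolys[OF C], of "gvar ` (K \<inter> S)" S U]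
  have G: "gvar ` (K \<inter> S) \<subseteq> lpolys C S U" by (auto intro: lpolys_gvar C)
  have "P - kill K P = (\<Sum>e\<in>keys P. single e (lookup P e)) -
      (\<Sum>e\<in>keys P. if \<forall>x\<in>K. lookup e x = 0 then single e (lookup P e) else 0)"
    using kill_eq[OF P] poly_mapping_sum_single[of P] by simp
  also have "\<dots> = (\<Sum>e\<in>keys P. if \<forall>x\<in>K. lookup e x = 0 then 0 else single e (lookup P e))"
    unfolding sum_subtractf[symmetric] by (intro sum.cong) auto
  also have "\<dots> \<in> ispan (lpolys C S U) (gvar ` (K \<inter> S))"
  proof (rule ring_ideal_sum[OF I[OF G]])
    fix e assume e: "e \<in> keys P"
    show "(if \<forall>x\<in>K. lookup e x = 0 then 0 else single e (lookup P e)) \<in> ispan (lpolys C S U) (gvar ` (K \<inter> S))"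
    proof (cases "\<forall>x\<in>K. lookup e x = 0")
      case False
      then obtain x where x: "x \<in> K" "lookup e x \<noteq> 0" by auto
      have xS: "x \<in> S" using lpolysD(2)[OF P(1), of e x] e x by (auto simp: in_keys_iff)
      have pos: "lookup e x > 0" using lpolysD(3)[OF P(1), of e x] e x assms(3) by (auto simp: in_keys_iff)
      have "single (e - single x 1) (lookup P e) \<in> lpolys C S U"
      proof (rule lpolys_single[OF C])
        show "lookup P e \<in> C" using lpolys_lookup[OF C P(1)] .
        show "y \<in> S" if "lookup (e - single x 1) y \<noteq> 0" for y
        proof (cases "y = x")
          case False
          then show ?thesis using that e lpolysD(2)[OF P(1), of e y] by (auto simp: lookup_minus lookup_single when_def in_keys_iff)
        qed (use xS in simp)
        show "y \<in> U" if "lookup (e - single x 1) y < 0" for y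
        proof (cases "y = x")
          case True
          then show ?thesis using that pos by (simp add: lookup_minus)
        next
          case False
          then show ?thesis using that e lpolysD(3)[OF P(1), of e y] by (auto simp: lookup_minus lookup_single when_def in_keys_iff)
        qed
      qed
      then have "single (e - single x 1) (lookup P e) * gvar x \<in> ispan (lpolys C S U) (gvar ` (K \<inter> S))"
        using ispan.step[OF ispan.zero, of _ "lpolys C S U" "gvar x" "gvar ` (K \<inter> S)"] x xS by auto
      moreover have "single (e - single x 1) (lookup P e) * gvar x = single e (lookup P e)"
        by (simp add: gvar_def mult_single)
      ultimately show ?thesis using False by auto
    qed (auto intro: ispan.zero)
  qed
  finally show ?thesis .
qed

lemma (in fixing) hom_ispan:
  assumes x: "x \<in> ispan (lpolys C S U) G" and G: "G \<subseteq> lpolys C S U"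
    and f: "\<And>r. r \<in> lpolys C S U \<Longrightarrow> lsubst f r \<in> R"
    and I: "ring_ideal R I" "subring R" and g: "\<And>g. g \<in> G \<Longrightarrow> lsubst f g \<in> I"
  shows "lsubst f x \<in> I"
  using x
proof induction
  case (step x a g)
  have "lsubst f (a * g) = lsubst f a * lsubst f g"
    by (rule hom_mult[of _ C S _ C S]) (use step G in auto)
  then show ?case using step f assms ring_idealD[OF I] by (auto simp: hom_add)
qed (use ring_idealD[OF I] in simp)

lemma kill_ispan:
  assumes x: "x \<in> ispan (lpolys C S U) (gvar ` (K \<inter> S))" and "K \<inter> U = {}" and C: "subring_rat C"
  shows "kill K x = 0"
proof -
  interpret fixing "\<lambda>x. if x \<in> K then 0 else gvar x" U by (rule fixing_kill[OF assms(2)])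
  have "kill K x \<in> {0}"
    unfolding kill_def
    by (rule hom_ispan[OF x, of UNIV]) (auto intro: lpolys_gvar C simp: ring_ideal_def subring_def)
  then show ?thesis by simp
qed

text \<open>An ideal generated by variables is the kernel of \<open>kill K\<close>, and this
  description does not see the coefficient ring.\<close>

lemma ispan_gvar_integral:
  assumes x: "x \<in> ispan (lpolys UNIV S U) (gvar ` (K \<inter> S))" "K \<inter> U = {}"
    and C: "subring_rat C" and xC: "x \<in> lpolys C S U"
  shows "x \<in> ispan (lpolys C S U) (gvar ` (K \<inter> S))"
  using diff_kill_mem_ispan[OF C xC assms(2)] kill_ispan[OF x] by simp


section \<open>Ideals in the sense of the algebra library\<close>

lemma ring_set_ring: "subring R \<Longrightarrow> ring (set_ring R)"
  by unfold_locales
    (auto simp: set_ring_def subringD algebra_simps Units_def intro!: bexI[of _ "- x" for x])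

lemma ideal_set_ring:
  assumes R: "subring R"
  shows "ideal I (set_ring R) \<longleftrightarrow> ring_ideal R I"
proof
  assume "ideal I (set_ring R)"
  then interpret ideal I "set_ring R" .
  show "ring_ideal R I"
    unfolding ring_ideal_def
  proof (intro conjI ballI)
    show "I \<subseteq> R" using a_subset by (simp add: set_ring_def)
    show "0 \<in> I" using additive_subgroup.zero_closed[OF is_additive_subgroup] by (simp add: set_ring_def)
    show "x + y \<in> I" if "x \<in> I" "y \<in> I" for x y
      using additive_subgroup.a_closed[OF is_additive_subgroup that] by (simp add: set_ring_def)
    show "r * x \<in> I" if "r \<in> R" "x \<in> I" for r x
      using I_l_closed[OF that(2), of r] that(1) by (simp add: set_ring_def)
  qed
next
  assume I: "ring_ideal R I"
  interpret ring "set_ring R" by (rule ring_set_ring[OF R])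
  have inv: "\<ominus>\<^bsub>set_ring R\<^esub> x = - x" if "x \<in> R" for x
    by (rule minus_equality) (use that R in \<open>auto simp: set_ring_def subringD\<close>)
  have "subgroup I (add_monoid (set_ring R))"
  proof
    show "I \<subseteq> carrier (add_monoid (set_ring R))" using ring_idealD[OF I R] by (auto simp: set_ring_def)
    show "x \<otimes>\<^bsub>add_monoid (set_ring R)\<^esub> y \<in> I" if "x \<in> I" "y \<in> I" for x y
      using ring_idealD[OF I R] that by (auto simp: set_ring_def)
    show "\<one>\<^bsub>add_monoid (set_ring R)\<^esub> \<in> I" using ring_idealD[OF I R] by (auto simp: set_ring_def)
    show "inv\<^bsub>add_monoid (set_ring R)\<^esub> x \<in> I" if "x \<in> I" for x
      using ring_idealD[OF I R] that inv[of x] by (auto simp: a_inv_def)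
  qed
  then show "ideal I (set_ring R)"
    by (rule idealI[OF ring_set_ring[OF R]])
      (use ring_idealD[OF I R] in \<open>auto simp: set_ring_def\<close>)
qed

lemma genideal_set_ring:
  assumes R: "subring R" and G: "G \<subseteq> R"
  shows "Idl\<^bsub>set_ring R\<^esub> G = ispan R G"
proof
  have *: "ideal (ispan R G) (set_ring R)" "G \<subseteq> ispan R G"
    using ideal_set_ring[OF R] ispan_ideal[OF R G] ispan_gen[OF R] by auto
  then show "Idl\<^bsub>set_ring R\<^esub> G \<subseteq> ispan R G" by (auto simp: genideal_def)
  show "ispan R G \<subseteq> Idl\<^bsub>set_ring R\<^esub> G"
    unfolding genideal_def using ispan_minimal[OF _ R] ideal_set_ring[OF R] by blast
qed


section \<open>Cofaces and the rational contraction\<close>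

definition cofun :: "nat \<Rightarrow> nat \<Rightarrow> nat \<Rightarrow> gen \<Rightarrow> lpoly" where
  "cofun p m j = (\<lambda>x. case x of
       V k \<Rightarrow> if j = 0 then eta_v p m 1 k else gvar (V k)
     | T i k \<Rightarrow> if i < j then gvar (T i k) else if i = j then Delta p m i k else gvar (T (Suc i) k))"

text \<open>The logarithm of the point \<open>v\<^sub>k = 0\<close>, \<open>k > m\<close>.\<close>

definition lam :: "nat \<Rightarrow> nat \<Rightarrow> nat \<Rightarrow> lpoly" where
  "lam p m = lgen p (\<lambda>k. if k \<le> m then v k else 0)"

text \<open>\<open>aug\<close> solves \<open>\<eta>\<^sub>1(v\<^sub>k) = 0\<close>, \<open>k > m\<close>, for the \<open>t\<^sub>k\<close>, and \<open>contr\<close> solves \<open>\<eta>\<^sub>2(v\<^sub>k) = 0\<close>, \<open>k > m\<close>,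
  for the \<open>t\<^sub>k\<close> of the second factor.\<close>

definition augfun :: "nat \<Rightarrow> nat \<Rightarrow> gen \<Rightarrow> lpoly" where
  "augfun p m = (\<lambda>x. case x of V k \<Rightarrow> v k | T i k \<Rightarrow> tsolve p (hlog p) (lam p m) k)"

definition contrfun :: "nat \<Rightarrow> nat \<Rightarrow> gen \<Rightarrow> lpoly" where
  "contrfun p m = (\<lambda>x. case x of V k \<Rightarrow> v k
     | T i k \<Rightarrow> if i = 1 then gvar (T i k) else tsolve p (eta_log p m 1) (lam p m) k)"

definition aug :: "nat \<Rightarrow> nat \<Rightarrow> lpoly \<Rightarrow> lpoly" where "aug p m = lsubst (augfun p m)"
definition contr :: "nat \<Rightarrow> nat \<Rightarrow> lpoly \<Rightarrow> lpoly" where "contr p m = lsubst (contrfun p m)"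

definition allgens :: "nat \<Rightarrow> nat \<Rightarrow> gen set" where
  "allgens m s = V ` {1..} \<union> {T i k | i k. 1 \<le> i \<and> i \<le> s \<and> m < k}"

lemma gens_subset_allgens: "s \<le> s' \<Longrightarrow> gens m s K \<subseteq> allgens m s'"
  by (auto simp: gens_def allgens_def)

lemma allgens_mono: "s \<le> s' \<Longrightarrow> allgens m s \<subseteq> allgens m s'"
  by (auto simp: allgens_def)

locale hopf_data =
  fixes p n m :: nat
  assumes p: "prime p" and n1: "1 \<le> n" and nm: "n \<le> m"
begin

abbreviation ZZ :: "rat set" where "ZZ \<equiv> Zloc p"
abbreviation RR :: "rat set \<Rightarrow> nat \<Rightarrow> lpoly set" where "RR C s \<equiv> lpolys C (allgens m s) {V n}"

lemma p0: "0 < p" using p prime_gt_0_nat by blast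

lemma ZZ [simp]: "subring_rat ZZ" by (rule subring_rat_Zloc[OF p])

definition rels :: "nat \<Rightarrow> lpoly set" where
  "rels s = {eta_v p m i k | i k. i \<le> s \<and> n + m < k} \<union> v ` {1..<n}"

definition II :: "rat set \<Rightarrow> nat \<Rightarrow> lpoly set" where
  "II C s = ispan (RR C s) (rels s)"

text \<open>Kept apart from \<open>II\<close> because the coboundaries of the fractions are computed
  modulo \<open>JJ\<close> alone. As \<open>JJ\<close> is generated by variables, integrality modulo
  it is elementary in every degree.\<close>

definition JJ :: "rat set \<Rightarrow> nat \<Rightarrow> lpoly set" where
  "JJ C s = ispan (RR C s) (v ` {1..<n})"

lemma RR_subring: "subring_rat C \<Longrightarrow> subring (RR C s)"
  by (rule subring_lpolys)

lemma RR_mono: "x \<in> RR C s \<Longrightarrow> C \<subseteq> C' \<Longrightarrow> s \<le> s' \<Longrightarrow> x \<in> RR C' s'"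
  using allgens_mono by (blast intro: lpolys_mono)

lemma RR_UNIV: "x \<in> RR C s \<Longrightarrow> x \<in> RR UNIV s"
  by (rule RR_mono) auto

lemma v_RR: "subring_rat C \<Longrightarrow> 1 \<le> k \<Longrightarrow> v k \<in> RR C s"
  by (rule lpolys_gvar) (auto simp: allgens_def)

lemma gens_RR: "x \<in> lpolys C (gens m s K) {} \<Longrightarrow> s \<le> s' \<Longrightarrow> x \<in> RR C s'"
  using gens_subset_allgens by (blast intro: lpolys_mono)

lemma eta_v_RR:
  assumes "ZZ \<subseteq> C" "1 \<le> k" "i \<le> s"
  shows "eta_v p m i k \<in> RR C s"
proof -
  have "eta_v p m i k \<in> lpolys C (gens m i k) {}"
    using eta_v_integral[OF p assms(2)] assms(1) by (blast intro: lpolys_mono)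
  then show ?thesis using assms(3) by (rule gens_RR)
qed

lemma rels_RR: "ZZ \<subseteq> C \<Longrightarrow> subring_rat C \<Longrightarrow> rels s \<subseteq> RR C s"
  by (auto simp: rels_def intro!: eta_v_RR v_RR)

lemma II_ideal: "ZZ \<subseteq> C \<Longrightarrow> subring_rat C \<Longrightarrow> ring_ideal (RR C s) (II C s)"
  unfolding II_def by (intro ispan_ideal RR_subring rels_RR)

lemma JJ_ideal: "subring_rat C \<Longrightarrow> ring_ideal (RR C s) (JJ C s)"
  unfolding JJ_def by (intro ispan_ideal RR_subring) (auto intro: v_RR)

lemma JJ_subset_II: "JJ C s \<subseteq> II C s"
  unfolding II_def JJ_def by (intro ispan_mono) (auto simp: rels_def)

lemma II_mono: "C \<subseteq> C' \<Longrightarrow> s \<le> s' \<Longrightarrow> II C s \<subseteq> II C' s'"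
  unfolding II_def
proof (rule ispan_mono)
  assume "C \<subseteq> C'" "s \<le> s'"
  then show "RR C s \<subseteq> RR C' s'" using RR_mono by blast
  show "rels s \<subseteq> rels s'" using \<open>s \<le> s'\<close> by (force simp: rels_def)
qed

lemma carrier_Gam: "carrier (Gam C n m s) = RR C s"
  by (simp add: Gam_def set_ring_def allgens_def)

lemma rel_ideal_eq: "ZZ \<subseteq> C \<Longrightarrow> subring_rat C \<Longrightarrow> rel_ideal C p n m s = II C s"
  using genideal_set_ring[OF RR_subring rels_RR, of C s]
  by (simp add: rel_ideal_def Gam_def II_def rels_def allgens_def)

lemma fixing_cofun: "fixing (cofun p m j) {V n}"
  using n1 nm p0 by (auto intro!: fixing.intro simp: cofun_def eta_v_low)

lemma coface_eq: "coface p m j = lsubst (cofun p m j)"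
  by (simp add: coface_def cofun_def)

sublocale cf: fixing "cofun p m j" "{V n}"
  rewrites "lsubst (cofun p m j) \<equiv> coface p m j" for j
  by (simp_all add: fixing_cofun coface_eq)

sublocale aug: fixing "augfun p m" "{V n}"
  rewrites "lsubst (augfun p m) \<equiv> aug p m"
  by unfold_locales (auto simp: augfun_def aug_def)

sublocale contr: fixing "contrfun p m" "{V n}"
  rewrites "lsubst (contrfun p m) \<equiv> contr p m"
  by unfold_locales (auto simp: contrfun_def contr_def)

text \<open>The right unit on the v's was obtained from the one on the logarithm by
  \<open>vsolve\<close>, and \<open>lgen\<close> undoes this.\<close>

lemma cf0_hlog: "coface p m 0 (hlog p k) = eta_log p m 1 k"
proof -
  have "coface p m 0 (hlog p k) = lgen p (\<lambda>k. eta_v p m 1 k) k"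
    unfolding hlog_eq by (subst cf.hom_lgen) (auto intro: Qpol_intros simp: cofun_def)
  also have "\<dots> = lgen p (vsolve p (eta_log p m 1)) k"
    by (simp add: eta_v_eq)
  finally show ?thesis using p0 by (simp add: lgen_vsolve)
qed

lemma cf_id: "1 \<le> j \<Longrightarrow> s < j \<Longrightarrow> x \<in> RR C s \<Longrightarrow> coface p m j x = x"
  by (erule cf.hom_id) (auto simp: cofun_def allgens_def split: if_splits)

lemma hlog_RR: "hlog p k \<in> RR UNIV s"
  by (rule gens_RR[OF hlog_mem[of p k m]]) simp

lemma eta_log_RR: "i \<le> s \<Longrightarrow> eta_log p m i k \<in> RR UNIV s"
  by (rule gens_RR[OF eta_log_mem])

lemma Delta_low: "k \<le> m \<Longrightarrow> Delta p m 1 k = (if k = 0 then 1 else 0)"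
  unfolding Delta_eq[OF order_refl] using p0
  by (subst tsolve_eq_unit[where m = m]) (auto simp: eta_log_low)

lemma cf0_tgen: "coface p m 0 (tgen m 1 k) = tgen m 2 k"
  by (simp add: tgen_def cofun_def)

lemma cf1_tgen: "coface p m 1 (tgen m 1 k) = Delta p m 1 k"
  using Delta_low[of k] Delta_low[of 0] by (simp add: tgen_def cofun_def)

lemma conv_hom_eta_log:
  assumes "fixing f U"
  shows "lsubst f (eta_log p m (Suc i) k) = conv p (\<lambda>k. lsubst f (eta_log p m i k)) (\<lambda>k. lsubst f (tgen m (Suc i) k)) k"
  unfolding eta_log_Suc by (rule fixing.hom_conv[OF assms]) auto

lemma cf0_eta_log: "coface p m 0 (eta_log p m 1 k) = eta_log p m 2 k"
  using conv_hom_eta_log[OF fixing_cofun[of 0], of 0 k] eta_log_Suc[of p m 1 k] cf0_tgen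
  by (simp add: cf0_hlog flip: coface_eq)

text \<open>Together with \<open>cf0_eta_log\<close>: both composites of right units equal the last
  unit of two factors. This yields the vanishing of d d and the stability of the relations.\<close>

lemma cf1_eta_log: "coface p m 1 (eta_log p m 1 k) = eta_log p m 2 k"
proof -
  have "coface p m 1 (eta_log p m 1 k) = conv p (hlog p) (Delta p m 1) k"
    using conv_hom_eta_log[OF fixing_cofun[of 1], of 0 k] cf1_tgen cf_id[of 1 0, OF _ _ hlog_RR]
    by (simp flip: coface_eq)
  also have "Delta p m 1 = tsolve p (hlog p) (eta_log p m 2)"
    by (rule ext) (simp add: Delta_eq)
  finally show ?thesis by (simp add: conv_tsolve)
qed

lemma cf0_eta_v: "coface p m 0 (eta_v p m 1 k) = eta_v p m 2 k"
  unfolding eta_v_eq by (subst cf.hom_vsolve) (auto simp: cf0_eta_log)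

lemma cf1_eta_v: "coface p m 1 (eta_v p m 1 k) = eta_v p m 2 k"
  unfolding eta_v_eq by (subst cf.hom_vsolve) (auto simp: cf1_eta_log)

text \<open>The bound \<open>s <= 1\<close> suffices, as degrees 0 and 1 of Ext involve the cobar
  complex only up to degree 2; then the coproduct occurs only on the first factor.\<close>

lemma cofun_RR:
  assumes "ZZ \<subseteq> C" "subring_rat C" "s \<le> 1" "j \<le> Suc s" "x \<in> allgens m s"
  shows "cofun p m j x \<in> RR C (Suc s)"
proof (cases x)
  case (V k)
  then show ?thesis using assms eta_v_RR[of C k 1 "Suc s"] v_RR[of C k] by (auto simp: cofun_def allgens_def)
next
  case (T i k)
  then have i: "i = 1" "s = 1" "m < k" using assms by (auto simp: allgens_def)
  have "Delta p m 1 k \<in> lpolys C (gens m 2 k) {}"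
    using Delta_integral[OF p, of m k] assms(1) by (blast intro: lpolys_mono)
  then have "Delta p m 1 k \<in> RR C (Suc s)" by (rule gens_RR) (use i in auto)
  moreover have "gvar (T i k) \<in> RR C (Suc s)" "gvar (T (Suc i) k) \<in> RR C (Suc s)"
    using i assms by (auto intro!: lpolys_gvar simp: allgens_def)
  ultimately show ?thesis using T i by (auto simp: cofun_def)
qed

lemma cf_RR:
  assumes "ZZ \<subseteq> C" "subring_rat C" "s \<le> 1" "j \<le> Suc s" "x \<in> RR C s"
  shows "coface p m j x \<in> RR C (Suc s)"
  using assms n1 by (intro cf.hom_mem[OF assms(5)] cofun_RR) (auto simp: allgens_def)

lemma cobar_d_0: "x \<in> RR C 0 \<Longrightarrow> cobar_d p m 0 x = coface p m 0 x - x"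
proof -
  assume "x \<in> RR C 0"
  moreover have "{..Suc 0} = {0, 1}" by auto
  ultimately show ?thesis using cf_id[of 1 0 x C] unfolding cobar_d_def by (simp del: One_nat_def[symmetric])
qed

lemma cobar_d_1: "cobar_d p m 1 x = coface p m 0 x - coface p m 1 x + coface p m 2 x"
proof -
  have "{..Suc 1} = {0, 1, 2}" by auto
  then show ?thesis unfolding cobar_d_def by simp
qed

lemma cobar_d_add: "cobar_d p m s (x + y) = cobar_d p m s x + cobar_d p m s y"
  unfolding cobar_d_def cf.hom_add ring_distribs sum.distrib ..

lemma cobar_d_uminus: "cobar_d p m s (- x) = - cobar_d p m s x"
  unfolding cobar_d_def cf.hom_uminus mult_minus_right sum_negf ..

lemma cobar_d_diff: "cobar_d p m s (x - y) = cobar_d p m s x - cobar_d p m s y"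
  using cobar_d_add[of s x "- y"] by (simp add: cobar_d_uminus)

lemma cobar_d_sum: "cobar_d p m s (\<Sum>i\<in>A. x i) = (\<Sum>i\<in>A. cobar_d p m s (x i))"
  unfolding cobar_d_def cf.hom_sum sum_distrib_left by (rule sum.swap)

lemma cobar_d_RR:
  assumes "ZZ \<subseteq> C" "subring_rat C" "s \<le> 1" "x \<in> RR C s"
  shows "cobar_d p m s x \<in> RR C (Suc s)"
proof -
  have "(- 1) ^ j * y \<in> RR C (Suc s)" if "y \<in> RR C (Suc s)" for j and y :: lpoly
    using that by (cases "even j") (auto intro: lpolys_uminus assms)
  then show ?thesis
    unfolding cobar_d_def using cf_RR[OF assms(1-3) _ assms(4)] by (intro lpolys_sum assms(2)) auto
qed

text \<open>The elements v_1, ..., v_m are invariant, because t_1, ..., t_m vanish.\<close>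

lemma cobar_d_linear:
  assumes r: "r \<in> lpolys C (V ` {1..m}) {V n}" and x: "x \<in> lpolys UNIV UNIV {V n}"
  shows "cobar_d p m s (r * x) = r * cobar_d p m s x"
proof -
  have "coface p m j (r * x) = r * coface p m j x" for j
  proof -
    have "coface p m j r = r"
      by (rule cf.hom_id[OF r]) (use p0 in \<open>auto simp: cofun_def eta_v_low\<close>)
    then show ?thesis using cf.hom_mult[OF r x] by simp
  qed
  then show ?thesis unfolding cobar_d_def sum_distrib_left by (intro sum.cong refl) (simp add: mult.left_commute)
qed

text \<open>A coface carries each unit map to another unit map, so it sends defining relations to
  defining relations.\<close>

lemma cf_II:
  assumes C: "ZZ \<subseteq> C" "subring_rat C" and s: "s \<le> 1" "j \<le> Suc s" and x: "x \<in> II C s"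
  shows "coface p m j x \<in> II C (Suc s)"
proof (rule cf.hom_ispan[OF x[unfolded II_def] rels_RR[OF C] cf_RR[OF C s] II_ideal[OF C] RR_subring[OF C(2)]])
  fix g assume "g \<in> rels s"
  then consider i k where "g = eta_v p m i k" "i \<le> s" "n + m < k" | k where "g = v k" "1 \<le> k" "k < n"
    by (auto simp: rels_def)
  then have "coface p m j g \<in> rels (Suc s)"
  proof cases
    case 1
    have "\<exists>i'\<le>Suc s. coface p m j (eta_v p m i k) = eta_v p m i' k"
    proof (cases "i = 0")
      case True
      then show ?thesis
        using 1 p0 by (cases "j = 0") (auto simp: eta_v_zero cofun_def intro: exI[of _ 0] exI[of _ "1::nat"])
    next
      case False
      then have i: "i = 1" "s = 1" using 1 s by auto
      consider "j = 0" | "j = 1" | "j = 2" using s i by linarith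
      then show ?thesis
      proof cases
        case 3
        then have "coface p m j (eta_v p m 1 k) = eta_v p m 1 k"
          using 1 by (intro cf_id[of _ 1 _ UNIV] eta_v_RR) auto
        then show ?thesis using i by (auto intro!: exI[of _ 1])
      qed (use i cf0_eta_v cf1_eta_v in \<open>force intro!: exI[of _ 2]\<close>)+
    qed
    then show ?thesis using 1 by (auto simp: rels_def)
  next
    case 2
    then show ?thesis using nm p0 by (auto simp: cofun_def rels_def eta_v_low)
  qed
  then show "coface p m j g \<in> II C (Suc s)"
    unfolding II_def by (rule ispan_gen[OF RR_subring[OF C(2)]])
qed

lemma cf_JJ:
  assumes C: "ZZ \<subseteq> C" "subring_rat C" and s: "s \<le> 1" "j \<le> Suc s" and x: "x \<in> JJ C s"
  shows "coface p m j x \<in> JJ C (Suc s)"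
proof (rule cf.hom_ispan[OF x[unfolded JJ_def] _ cf_RR[OF C s] JJ_ideal[OF C(2)] RR_subring[OF C(2)]])
  show "v ` {1..<n} \<subseteq> RR C s" using v_RR[OF C(2)] by auto
  fix g assume "g \<in> v ` {1..<n}"
  then have "coface p m j g \<in> v ` {1..<n}" using nm p0 by (auto simp: cofun_def eta_v_low)
  then show "coface p m j g \<in> JJ C (Suc s)"
    unfolding JJ_def by (rule ispan_gen[OF RR_subring[OF C(2)]])
qed

lemma cobar_d_ideal:
  assumes I: "ring_ideal (RR C (Suc s)) I" "subring_rat C" and x: "\<And>j. j \<le> Suc s \<Longrightarrow> coface p m j x \<in> I"
  shows "cobar_d p m s x \<in> I"
proof -
  have "(- 1) ^ j * y \<in> I" if "y \<in> I" for j y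
    using that ring_idealD[OF I(1) RR_subring[OF I(2)]] by (cases "even j") auto
  then show ?thesis unfolding cobar_d_def using x by (intro ring_ideal_sum[OF I(1)]) auto
qed

lemma cobar_d_II: "ZZ \<subseteq> C \<Longrightarrow> subring_rat C \<Longrightarrow> s \<le> 1 \<Longrightarrow> x \<in> II C s \<Longrightarrow> cobar_d p m s x \<in> II C (Suc s)"
  by (rule cobar_d_ideal[OF II_ideal]) (auto intro: cf_II)

lemma cobar_d_JJ: "ZZ \<subseteq> C \<Longrightarrow> subring_rat C \<Longrightarrow> s \<le> 1 \<Longrightarrow> x \<in> JJ C s \<Longrightarrow> cobar_d p m s x \<in> JJ C (Suc s)"
  by (rule cobar_d_ideal[OF JJ_ideal]) (auto intro: cf_JJ)

section \<open>Moving the last factor to the point with v_k = 0 for k > m\<close>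

lemma lam_low: "k \<le> m \<Longrightarrow> lam p m k = hlog p k"
  unfolding lam_def hlog_eq by (rule lgen_cong) auto

lemma lam_mem: "lam p m k \<in> lpolys UNIV (V ` {1..m}) {}"
  unfolding lam_def by (rule lgen_mem) (auto intro: lpolys_gvar lpolys_0)

lemma lam_Qpol [simp]: "lam p m k \<in> Qpol"
  using lam_mem lpolys_UNIV by blast

lemma vsolve_lam: "1 \<le> k \<Longrightarrow> vsolve p (lam p m) k = (if k \<le> m then v k else 0)"
  unfolding lam_def using p0 by (simp add: vsolve_lgen)

lemma tsolve_lam_mem: "tsolve p (hlog p) (lam p m) k \<in> lpolys UNIV (allgens m 0) {}"
proof (rule tsolve_mem)
  fix j
  show "hlog p j \<in> lpolys UNIV (allgens m 0) {}"
    by (rule lpolys_mono[OF hlog_mem[of p j m]]) (auto simp: gens_def allgens_def)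
  show "lam p m j \<in> lpolys UNIV (allgens m 0) {}"
    by (rule lpolys_mono[OF lam_mem]) (auto simp: allgens_def)
qed

lemma tsolve_lam_mem1: "tsolve p (eta_log p m 1) (lam p m) k \<in> lpolys UNIV (allgens m 1) {}"
proof (rule tsolve_mem)
  fix j
  show "eta_log p m 1 j \<in> lpolys UNIV (allgens m 1) {}"
    by (rule lpolys_mono[OF eta_log_mem]) (auto simp: gens_def allgens_def)
  show "lam p m j \<in> lpolys UNIV (allgens m 1) {}"
    by (rule lpolys_mono[OF lam_mem]) (auto simp: allgens_def)
qed

lemma aug_tgen: "aug p m (tgen m 1 k) = tsolve p (hlog p) (lam p m) k"
proof (cases "k \<le> m")
  case True
  then show ?thesis using p0 tsolve_eq_unit[of "hlog p" m "lam p m" p k] by (simp add: tgen_def lam_low)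
qed (simp add: tgen_def augfun_def)

lemma contr_tgen: "contr p m (tgen m 2 k) = tsolve p (eta_log p m 1) (lam p m) k"
proof (cases "k \<le> m")
  case True
  then show ?thesis
    using p0 tsolve_eq_unit[of "eta_log p m 1" m "lam p m" p k] by (simp add: tgen_def lam_low eta_log_low)
qed (simp add: tgen_def contrfun_def)

lemma aug_id: "x \<in> RR C 0 \<Longrightarrow> aug p m x = x"
  by (erule aug.hom_id) (auto simp: augfun_def allgens_def)

lemma contr_id: "x \<in> RR C 1 \<Longrightarrow> contr p m x = x"
  by (erule contr.hom_id) (auto simp: contrfun_def allgens_def)

lemma aug_eta_log: "aug p m (eta_log p m 1 k) = lam p m k"
  using conv_hom_eta_log[OF aug.fixing_axioms, of 0 k] aug_id[OF hlog_RR] aug_tgen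
  by (simp add: conv_tsolve flip: aug_def)

lemma contr_eta_log: "contr p m (eta_log p m 2 k) = lam p m k"
  using conv_hom_eta_log[OF contr.fixing_axioms, of 1 k] contr_id[OF eta_log_RR[of 1 1]] contr_tgen
  by (simp add: conv_tsolve flip: contr_def)

lemma aug_eta_v: "1 \<le> k \<Longrightarrow> aug p m (eta_v p m 1 k) = (if k \<le> m then v k else 0)"
  unfolding eta_v_eq by (subst aug.hom_vsolve) (auto simp: aug_eta_log vsolve_lam)

lemma contr_eta_v: "1 \<le> k \<Longrightarrow> contr p m (eta_v p m 2 k) = (if k \<le> m then v k else 0)"
  unfolding eta_v_eq by (subst contr.hom_vsolve) (auto simp: contr_eta_log vsolve_lam)

lemma aug_RR: "x \<in> RR UNIV 1 \<Longrightarrow> aug p m x \<in> RR UNIV 0"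
  using n1 by (erule_tac aug.hom_mem)
    (auto simp: allgens_def augfun_def intro!: lpolys_gvar lpolys_mono[OF tsolve_lam_mem])

lemma contr_RR: "x \<in> RR UNIV 2 \<Longrightarrow> contr p m x \<in> RR UNIV 1"
  using n1 by (erule_tac contr.hom_mem)
    (auto simp: allgens_def contrfun_def intro!: lpolys_gvar lpolys_mono[OF tsolve_lam_mem1])

lemma II_UNIV: "ring_ideal (RR UNIV s) (II UNIV s)"
  by (rule II_ideal) auto

lemma aug_II: "x \<in> II UNIV 1 \<Longrightarrow> aug p m x \<in> II UNIV 0"
proof (unfold II_def[of _ 1], erule aug.hom_ispan[OF _ rels_RR aug_RR II_UNIV RR_subring])
  fix g assume g: "g \<in> rels 1"
  have "g \<in> rels 0 \<or> (\<exists>k>n + m. g = eta_v p m 1 k)"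
  proof -
    have "i \<le> 1 \<longleftrightarrow> i \<le> 0 \<or> i = 1" for i :: nat by auto
    then show ?thesis using g unfolding rels_def by blast
  qed
  then show "aug p m g \<in> II UNIV 0"
  proof
    assume g: "g \<in> rels 0"
    then have "g \<in> RR UNIV 0" using rels_RR[of UNIV 0] by auto
    then show ?thesis using ispan_gen[OF RR_subring g] aug_id by (auto simp: II_def)
  next
    assume "\<exists>k>n + m. g = eta_v p m 1 k"
    then show ?thesis using ring_idealD(2)[OF II_UNIV RR_subring] by (auto simp: aug_eta_v)
  qed
qed auto

lemma contr_II: "x \<in> II UNIV 2 \<Longrightarrow> contr p m x \<in> II UNIV 1"
proof (unfold II_def[of _ 2], erule contr.hom_ispan[OF _ rels_RR contr_RR II_UNIV RR_subring])
  fix g assume g: "g \<in> rels 2"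
  have "g \<in> rels 1 \<or> (\<exists>k>n + m. g = eta_v p m 2 k)"
  proof -
    have "i \<le> 2 \<longleftrightarrow> i \<le> 1 \<or> i = 2" for i :: nat by auto
    then show ?thesis using g unfolding rels_def by blast
  qed
  then show "contr p m g \<in> II UNIV 1"
  proof
    assume g: "g \<in> rels 1"
    then have "g \<in> RR UNIV 1" using rels_RR[of UNIV 1] by auto
    then show ?thesis using ispan_gen[OF RR_subring g] contr_id by (auto simp: II_def)
  next
    assume "\<exists>k>n + m. g = eta_v p m 2 k"
    then show ?thesis using ring_idealD(2)[OF II_UNIV RR_subring] by (auto simp: contr_eta_v)
  qed
qed auto

lemma aug_cf0:
  assumes x: "x \<in> RR C 0"
  shows "aug p m (coface p m 0 x) = kill {V k | k. m < k} x"
  unfolding aug_def coface_eq kill_def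
  by (rule lsubst_lsubst[OF aug.fixing_axioms fixing_cofun x])
    (auto simp: allgens_def cofun_def aug_eta_v simp flip: aug_def intro: lpolys_mono[OF eta_v_Qpol])

text \<open>Coface 0 acts at the beginning and the contraction at the end. They commute, because the
  truncated logarithm \<open>lam\<close> involves only the invariant v_1, ..., v_m.\<close>

lemma contr_cf0:
  assumes x: "x \<in> RR C 1"
  shows "contr p m (coface p m 0 x) = coface p m 0 (aug p m x)"
proof -
  let ?h = "\<lambda>x. coface p m 0 (augfun p m x)"
  have "lsubst (contrfun p m) (lsubst (cofun p m 0) x) = lsubst ?h x"
  proof (rule lsubst_lsubst[OF contr.fixing_axioms fixing_cofun x])
    fix y assume y: "y \<in> allgens m 1"
    show "cofun p m 0 y \<in> lpolys UNIV UNIV {V n}"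
      using cofun_RR[of UNIV 1 0 y] y by (auto intro: lpolys_UNIV)
    show "?h y = lsubst (contrfun p m) (cofun p m 0 y)"
    proof (cases y)
      case (V k)
      then have "eta_v p m 1 k \<in> RR UNIV 1" using y by (intro eta_v_RR) (auto simp: allgens_def)
      then show ?thesis using V by (simp add: augfun_def cofun_def contr_id flip: contr_def)
    next
      case (T i k)
      then have "i = 1" using y by (auto simp: allgens_def)
      have "coface p m 0 (tsolve p (hlog p) (lam p m) k) = tsolve p (eta_log p m 1) (lam p m) k"
      proof -
        have "coface p m 0 (lam p m k) = lam p m k" for k
          by (rule cf.hom_id[OF lpolys_mono[OF lam_mem, where C' = UNIV and S' = "V ` {1..m}" and U' = "{V n}"]]) (use p0 in \<open>auto simp: cofun_def eta_v_low\<close>)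
        then show ?thesis by (subst cf.hom_tsolve) (auto simp: cf0_hlog)
      qed
      then show ?thesis using T \<open>i = 1\<close>
        by (simp add: augfun_def cofun_def flip: contr_def) (simp add: contrfun_def)
    qed
  qed
  moreover have "lsubst (cofun p m 0) (lsubst (augfun p m) x) = lsubst ?h x"
  proof (rule lsubst_lsubst[OF fixing_cofun aug.fixing_axioms x])
    fix y assume y: "y \<in> allgens m 1"
    show "augfun p m y \<in> lpolys UNIV UNIV {V n}"
      by (auto simp: augfun_def split: gen.split intro: lpolys_gvar lpolys_mono[OF tsolve_lam_mem])
  qed (simp add: coface_eq)
  ultimately show ?thesis by (simp add: aug_def contr_def coface_eq)
qed

text \<open>The coproduct composes two factors. Contracting the second ends at the truncated
  logarithm, so the composite t's solve the equation that defines \<open>aug\<close>.\<close>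

lemma contr_cf1:
  assumes x: "x \<in> RR C 1"
  shows "contr p m (coface p m 1 x) = aug p m x"
  unfolding contr_def coface_eq aug_def
proof (rule lsubst_lsubst[OF contr.fixing_axioms fixing_cofun x])
  fix y assume y: "y \<in> allgens m 1"
  show "cofun p m 1 y \<in> lpolys UNIV UNIV {V n}"
    using cofun_RR[of UNIV 1 1 y] y by (auto intro: lpolys_UNIV)
  show "augfun p m y = lsubst (contrfun p m) (cofun p m 1 y)"
  proof (cases y)
    case (V k)
    then show ?thesis by (simp add: augfun_def cofun_def flip: contr_def) (simp add: contrfun_def)
  next
    case (T i k)
    then have i: "i = 1" using y by (auto simp: allgens_def)
    have "contr p m (tsolve p (hlog p) (eta_log p m 2) k) = tsolve p (hlog p) (lam p m) k"
      by (subst contr.hom_tsolve) (auto simp: contr_eta_log contr_id[OF hlog_RR])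
    moreover have "Delta p m 1 k = tsolve p (hlog p) (eta_log p m 2) k"
      by (simp add: Delta_eq)
    ultimately show ?thesis using T i by (simp add: augfun_def cofun_def flip: contr_def)
  qed
qed

theorem rational_H0:
  assumes x: "x \<in> RR UNIV 0" and d: "cobar_d p m 0 x \<in> II UNIV 1"
  shows "kill {V k | k. m < k} x - x \<in> II UNIV 0"
  using aug_II[OF d] unfolding cobar_d_0[OF x] by (simp add: aug.hom_diff aug_cf0[OF x] aug_id[OF x])

text \<open>Contracting the coboundary of x gives x plus the coboundary of \<open>aug p m x\<close>,
  so \<open>- aug p m x\<close> is a primitive of x. Denominators enter here, since solving for a t
  divides by p.\<close>

theorem rational_H1:
  assumes x: "x \<in> RR UNIV 1" and d: "cobar_d p m 1 x \<in> II UNIV 2"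
  shows "x + cobar_d p m 0 (aug p m x) \<in> II UNIV 1"
proof -
  have "contr p m (cobar_d p m 1 x) = coface p m 0 (aug p m x) - aug p m x + x"
    using contr_cf0[OF x] contr_cf1[OF x] contr_id[OF x] cf_id[of 2 1 x, OF _ _ x]
    by (simp add: cobar_d_1 contr.hom_add contr.hom_diff)
  then show ?thesis using contr_II[OF d] cobar_d_0[OF aug_RR[OF x]] by (simp add: add.commute)
qed

theorem cobar_d_d:
  assumes x: "x \<in> RR UNIV 0"
  shows "cobar_d p m 1 (cobar_d p m 0 x) = 0"
proof -
  have x0: "coface p m 0 x \<in> RR UNIV 1" using cf_RR[of UNIV 0 0 x] x by simp
  have "coface p m 1 (coface p m 0 x) = coface p m 0 (coface p m 0 x)"
  proof -
    have "lsubst (cofun p m j) (lsubst (cofun p m 0) x) = lsubst (\<lambda>y. coface p m 0 (cofun p m 0 y)) x" if "j \<le> 1" for j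
    proof (rule lsubst_lsubst[OF fixing_cofun fixing_cofun x])
      fix y assume y: "y \<in> allgens m 0"
      show "cofun p m 0 y \<in> lpolys UNIV UNIV {V n}"
        using cofun_RR[of UNIV 0 0 y] y by (auto intro: lpolys_UNIV)
      obtain k where "y = V k" using y by (auto simp: allgens_def)
      then have "cofun p m 0 y = eta_v p m 1 k" by (simp add: cofun_def)
      moreover have "j = 0 \<or> j = 1" using that by auto
      ultimately show "coface p m 0 (cofun p m 0 y) = lsubst (cofun p m j) (cofun p m 0 y)"
        using cf0_eta_v cf1_eta_v by (auto simp flip: coface_eq)
    qed
    from this[of 0] this[of 1] show ?thesis by (simp add: coface_eq)
  qed
  then show ?thesis
    using cf_id[of 2 1, OF _ _ x0] cf_id[of 1 0, OF _ _ x] cf_id[of 2 0, OF _ _ x]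
    by (simp add: cobar_d_0[OF x] cobar_d_1 cf.hom_diff)
qed

end


section \<open>Laurent polynomials as polynomials in one generator\<close>

text \<open>The coefficients stay in the same type but no longer contain y. As exponents pass
  through \<open>nat\<close>, this is multiplicative only where y is not inverted.\<close>

definition upoly :: "gen \<Rightarrow> lpoly \<Rightarrow> lpoly poly" where
  "upoly y = mext (\<lambda>e c. monom (single (e - single y (lookup e y)) c) (nat (lookup e y)))"

lemma upoly_add: "upoly y (P + Q) = upoly y P + upoly y Q"
  unfolding upoly_def by (rule mext_add) (auto simp: single_add add_monom)

lemma upoly_0 [simp]: "upoly y 0 = 0"
  by (simp add: upoly_def)

lemma upoly_uminus: "upoly y (- P) = - upoly y P"
  using upoly_add[of y P "- P"] by (simp add: add_eq_0_iff)

lemma upoly_diff: "upoly y (P - Q) = upoly y P - upoly y Q"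
  using upoly_add[of y P "- Q"] by (simp add: upoly_uminus)

lemma upoly_mult:
  assumes "P \<in> lpolys C S U" "Q \<in> lpolys C' S' U" "y \<notin> U"
  shows "upoly y (P * Q) = upoly y P * upoly y Q"
  unfolding upoly_def
proof (rule mext_mult[where M = "mons U"])
  fix e e' :: "gen \<Rightarrow>\<^sub>0 int" and a b :: rat
  assume "e \<in> mons U" "e' \<in> mons U"
  then have "lookup e y \<ge> 0" "lookup e' y \<ge> 0" using assms(3) by (auto simp: mons_def not_less[symmetric])
  then show "monom (single (e + e' - single y (lookup (e + e') y)) (a * b)) (nat (lookup (e + e') y)) =
    monom (single (e - single y (lookup e y)) a) (nat (lookup e y)) *
    monom (single (e' - single y (lookup e' y)) b) (nat (lookup e' y))"
    by (simp add: mult_monom mult_single lookup_add nat_add_distrib single_add algebra_simps)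
qed (use assms in \<open>auto simp: single_add add_monom lpolys_keys\<close>)

lemma upoly_const:
  assumes "P \<in> lpolys C S U" "y \<notin> S"
  shows "upoly y P = [:P:]"
proof -
  have "upoly y P = (\<Sum>e\<in>keys P. monom (single e (lookup P e)) 0)"
    unfolding upoly_def mext_def
  proof (intro sum.cong refl)
    fix e assume "e \<in> keys P"
    then have "lookup e y = 0" using assms lpolysD(2)[OF assms(1), of e y] by (auto simp: in_keys_iff)
    then show "monom (single (e - single y (lookup e y)) (lookup P e)) (nat (lookup e y)) = monom (single e (lookup P e)) 0"
      by simp
  qed
  also have "\<dots> = monom (\<Sum>e\<in>keys P. single e (lookup P e)) 0"
    by (simp add: monom_sum)
  finally show ?thesis by (simp add: monom_0 flip: poly_mapping_sum_single)
qed

lemma upoly_gvar_power: "upoly y (gvar y ^ k) = monom 1 k"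
  by (simp add: gvar_power_single upoly_def mext_single)

lemma coeff_upoly_mem:
  assumes C: "subring_rat C" and P: "P \<in> lpolys C S U"
  shows "coeff (upoly y P) d \<in> lpolys C (S - {y}) U"
  unfolding upoly_def mext_def coeff_sum
proof (intro lpolys_sum C)
  fix e assume e: "e \<in> keys P"
  have "single (e - single y (lookup e y)) (lookup P e) \<in> lpolys C (S - {y}) U"
  proof (rule lpolys_single[OF C lpolys_lookup[OF C P]])
    fix x
    show "x \<in> S - {y}" if "lookup (e - single y (lookup e y)) x \<noteq> 0"
      using that e lpolysD(2)[OF P, of e x] by (auto simp: lookup_minus lookup_single when_def in_keys_iff split: if_splits)
    show "x \<in> U" if "lookup (e - single y (lookup e y)) x < 0"
      using that e lpolysD(3)[OF P, of e x] by (auto simp: lookup_minus lookup_single when_def in_keys_iff split: if_splits)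
  qed
  then show "coeff (monom (single (e - single y (lookup e y)) (lookup P e)) (nat (lookup e y))) d \<in> lpolys C (S - {y}) U"
    by (auto simp: coeff_monom intro: lpolys_0 C)
qed

lemma poly_upoly:
  assumes P: "P \<in> lpolys C S U" and "y \<notin> U"
  shows "poly (upoly y P) (gvar y) = P"
proof -
  have "poly (upoly y P) (gvar y) = (\<Sum>e\<in>keys P. single e (lookup P e))"
    unfolding upoly_def mext_def poly_sum
  proof (intro sum.cong refl)
    fix e assume e: "e \<in> keys P"
    then have "lookup e y \<ge> 0" using lpolysD(3)[OF P, of e y] assms(2) by (auto simp: in_keys_iff not_less[symmetric])
    then show "poly (monom (single (e - single y (lookup e y)) (lookup P e)) (nat (lookup e y))) (gvar y) = single e (lookup P e)"
      by (simp add: poly_monom gvar_power_single mult_single)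
  qed
  then show ?thesis by (simp flip: poly_mapping_sum_single)
qed

text \<open>If the generators do not contain y, membership in the ideal can be tested
  coefficientwise in y.\<close>

lemma coeff_upoly_ispan:
  assumes C: "subring_rat C" and x: "x \<in> ispan (lpolys C S U) G" and G: "G \<subseteq> lpolys C (S - {y}) U" and y: "y \<notin> U"
  shows "coeff (upoly y x) d \<in> ispan (lpolys C S U) G"
  using x
proof induction
  case (step x a g)
  have "upoly y (a * g) = upoly y a * [:g:]"
    using upoly_mult[OF step(2) _ y, of g C "S - {y}"] upoly_const[of g C "S - {y}" U y] G step by auto
  then have "coeff (upoly y (x + a * g)) d = coeff (upoly y x) d + coeff (upoly y a) d * g"
    by (simp add: upoly_add mult.commute[of "coeff _ _"])
  moreover have "coeff (upoly y a) d \<in> lpolys C S U"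
    using coeff_upoly_mem[OF C step(2), of y d] by (auto elim: lpolys_mono)
  ultimately show ?case using step by (auto intro: ispan.step)
qed (auto intro: ispan.zero)

lemma upoly_coeff_ideal:
  assumes I: "ring_ideal R I" "subring R" and P: "P \<in> lpolys C S U" "y \<notin> U" and "gvar y \<in> R"
    and c: "\<And>d. coeff (upoly y P) d \<in> I"
  shows "P \<in> I"
proof -
  have "poly (upoly y P) (gvar y) \<in> I"
    unfolding poly_altdef
    using assms by (intro ring_ideal_sum[OF I(1)] ring_idealD(5)[OF I] subring_power[OF I(2)])
  then show ?thesis by (simp add: poly_upoly[OF P])
qed

text \<open>Division by a polynomial whose top coefficient is a unit: going down from the degree of
  \<open>A\<close>, each coefficient of \<open>A\<close> is isolated, modulo those already treated,
  in a coefficient of \<open>A * B\<close>. The offset \<open>s\<close> is 0 for regularity and 1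
  where the low product coefficients are not under control.\<close>

lemma coeff_mult_unit_lead:
  fixes A B :: "'a::comm_ring_1 poly"
  assumes I: "ring_ideal R I" "subring R" and A: "\<And>d. coeff A d \<in> R" and B: "\<And>d. coeff B d \<in> R" "\<And>d. N < d \<Longrightarrow> coeff B d = 0"
    and u: "u \<in> R" "u * coeff B N = 1"
    and AB: "\<And>d. N + s \<le> d \<Longrightarrow> coeff (A * B) d \<in> I" and d: "s \<le> d"
  shows "coeff A d \<in> I"
proof -
  have "\<forall>d\<ge>s. degree A - d < k \<longrightarrow> coeff A d \<in> I \<or> d > degree A" for k
  proof (induction k)
    case (Suc k)
    show ?case
    proof (intro allI impI)
      fix d assume ds: "s \<le> d" and d: "degree A - d < Suc k"
      show "coeff A d \<in> I \<or> d > degree A"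
      proof (cases "d > degree A")
        case False
        have hi: "coeff A i \<in> I" if "i > d" for i
        proof (cases "i > degree A")
          case True
          then show ?thesis using ring_idealD(2)[OF I] by (simp add: coeff_eq_0)
        next
          case nf: False
          then have "degree A - i < k" "s \<le> i" using that d ds False by linarith+
          then show ?thesis using Suc nf by blast
        qed
        have "coeff (A * B) (d + N) = (\<Sum>i\<le>d + N. coeff A i * coeff B (d + N - i))"
          by (rule coeff_mult)
        also have "{..d + N} = insert d ({..d + N} - {d})" by auto
        also have "(\<Sum>i\<in>insert d ({..d + N} - {d}). coeff A i * coeff B (d + N - i)) =
            coeff A d * coeff B N + (\<Sum>i\<in>{..d + N} - {d}. coeff A i * coeff B (d + N - i))"
          by (subst sum.insert) auto
        finally have "coeff A d * coeff B N = coeff (A * B) (d + N) - (\<Sum>i\<in>{..d + N} - {d}. coeff A i * coeff B (d + N - i))"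
          by simp
        moreover have "(\<Sum>i\<in>{..d + N} - {d}. coeff A i * coeff B (d + N - i)) \<in> I"
        proof (rule ring_ideal_sum[OF I(1)])
          fix i assume "i \<in> {..d + N} - {d}"
          then consider "i < d" | "i > d" by force
          then show "coeff A i * coeff B (d + N - i) \<in> I"
            using ring_idealD(2)[OF I] ring_idealD(5)[OF I B(1) hi] by cases (auto simp: B(2))
        qed
        ultimately have "coeff A d * coeff B N \<in> I" using AB[of "d + N"] ds ring_idealD(7)[OF I] by simp
        then have "u * (coeff A d * coeff B N) \<in> I" by (rule ring_idealD(4)[OF I u(1)])
        moreover have "u * (coeff A d * coeff B N) = coeff A d" using u(2) by (subst mult.left_commute) simp
        ultimately show ?thesis by simp
      qed simp
    qed
  qed simp
  from this[of "Suc (degree A)"] show ?thesis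
    using ring_idealD(2)[OF I] d by (auto simp: coeff_eq_0 less_Suc_eq_le)
qed

lemma ispan_insert:
  assumes "x \<in> ispan R (insert g G)" "subring R"
  obtains y a where "y \<in> ispan R G" "a \<in> R" "x = y + a * g"
proof -
  from assms(1) have "\<exists>y\<in>ispan R G. \<exists>a\<in>R. x = y + a * g"
  proof induction
    case zero
    then show ?case using subringD(1)[OF assms(2)] by (intro bexI[of _ 0]) (auto intro: ispan.zero)
  next
    case (step x b h)
    then obtain y a where ya: "y \<in> ispan R G" "a \<in> R" "x = y + a * g" by auto
    show ?case
    proof (cases "h = g")
      case True
      then show ?thesis using ya step(2) subringD(3)[OF assms(2)] by (intro bexI[of _ y] bexI[of _ "a + b"]) (auto simp: algebra_simps)
    next
      case False
      then have "h \<in> G" using step by auto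
      then show ?thesis using ya step(2) by (intro bexI[of _ "y + b * h"] bexI[of _ a]) (auto simp: algebra_simps intro: ispan.step)
    qed
  qed
  then show ?thesis using that by blast
qed

lemma ispan_subset_ispan:
  assumes "subring R" "G \<subseteq> ispan R H"
  shows "ispan R G \<subseteq> ispan R H"
proof
  fix x assume "x \<in> ispan R G"
  then show "x \<in> ispan R H"
    by induction (use assms in \<open>auto intro: ispan.zero ispan_add ispan_mult\<close>)
qed


section \<open>The right unit modulo \<open>p\<close>\<close>

context hopf_data
begin

text \<open>The generators set to zero through the left unit.\<close>

definition KV :: "gen set" where "KV = V ` ({1..<n} \<union> {n + m<..})"

text \<open>The residue ring is the Laurent polynomial ring over F_p in v_n, ..., v_(n+m), with v_n
  inverted, and all t_k for k > m. Leading terms of the relations are computed there.\<close>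

definition KB :: "lpoly set" where "KB = ispan (RR ZZ 1) (insert (of_nat p) (gvar ` KV))"

abbreviation tv :: "nat \<Rightarrow> lpoly" where "tv k \<equiv> gvar (T 1 k)"

lemma KV_RR: "subring_rat C \<Longrightarrow> gvar ` KV \<subseteq> RR C s"
proof (rule image_subsetI)
  fix g assume C: "subring_rat C" and "g \<in> KV"
  then obtain k where k: "g = V k" "k \<in> {1..<n} \<union> {n + m<..}" unfolding KV_def by blast
  then have "1 \<le> k" using n1 by fastforce
  then show "gvar g \<in> RR C s" unfolding k(1) by (rule v_RR[OF C])
qed

lemma KG_RR: "insert (of_nat p) (gvar ` KV) \<subseteq> RR ZZ 1"
  by (intro insert_subsetI lpolys_of_nat ZZ KV_RR)

lemmas RRs = RR_subring[OF ZZ, of 1]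

lemma KB_ideal: "ring_ideal (RR ZZ 1) KB"
  unfolding KB_def by (intro ispan_ideal RRs KG_RR)

lemmas KB_simps = ring_idealD[OF KB_ideal RRs]

lemma KB_gen: "x \<in> RR ZZ 1 \<Longrightarrow> of_nat p * x \<in> KB" "x \<in> RR ZZ 1 \<Longrightarrow> g \<in> KV \<Longrightarrow> gvar g * x \<in> KB"
proof -
  have "of_nat p \<in> KB" "g \<in> KV \<Longrightarrow> gvar g \<in> KB" unfolding KB_def by (auto intro: ispan_gen RRs)
  then show "x \<in> RR ZZ 1 \<Longrightarrow> of_nat p * x \<in> KB" "x \<in> RR ZZ 1 \<Longrightarrow> g \<in> KV \<Longrightarrow> gvar g * x \<in> KB"
    by (auto intro: KB_simps(5))
qed

text \<open>A summand of the defect without its factor v_i. It is integral by itself, so that v_i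
  can place the whole summand into an ideal when i < n.\<close>

definition fterm :: "nat \<Rightarrow> nat \<Rightarrow> nat \<Rightarrow> lpoly" where
  "fterm i j q = const (1 / of_nat p) * (Frob p i (eta_log p m 1 j) *
     (Frob p i (eta_v0 p m 1 q) ^ (p ^ j) - eta_v0 p m 1 q ^ (p ^ (i + j))))"

lemma fdefect_eq: "fdefect p (eta_log p m 1) (eta_v0 p m 1) k = (\<Sum>i\<in>{1..k}. \<Sum>j\<le>k - i. v i * fterm i j (k - i - j))"
  unfolding fdefect_def fterm_def by (intro sum.cong refl) (simp add: mult_ac)

lemma eta_v0_mem: "q \<le> K \<Longrightarrow> eta_v0 p m 1 q \<in> lpolys ZZ (gens m 1 K) {}"
  using lpolys_gens_mono[OF eta_v_integral[OF p, of q m 1], of 1 K] by (auto simp: eta_v0_def[OF p] intro: lpolys_0)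

lemma fterm_mem:
  assumes "j \<le> K" "q \<le> K"
  shows "fterm i j q \<in> lpolys ZZ (gens m 1 K) {}"
proof -
  have "fterm i j q \<in> Zpol p"
    unfolding fterm_def
    by (rule fdefect_term[OF p eta_log_functional_equation[OF p, of m 1] eta_log_Qpol heta_Zpol[OF p] eta_v0_Zpol[OF p]])
  moreover have "fterm i j q \<in> lpolys UNIV (gens m 1 K) {}"
    unfolding fterm_def
    by (intro lpolys_const_mult lpolys_mult lpolys_diff lpolys_power Frob_mem subring_rat_UNIV UNIV_I
        lpolys_gens_mono[OF eta_log_mem] lpolys_mono[OF eta_v0_mem[of q K]] assms) auto
  ultimately show ?thesis using lpolys_Int by fastforce
qed

lemma fterm_0: "fterm i j 0 = 0"
  using p0 by (simp add: fterm_def eta_v0_def[OF p] zero_power)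

text \<open>For q up to m the right unit fixes the variable v_q, on which the Frobenius lift is
  exactly the p-th power.\<close>

lemma fterm_low:
  assumes "q \<le> m"
  shows "fterm i j q = 0"
proof (cases "q = 0")
  case False
  then have "eta_v0 p m 1 q = v q" using assms p0 by (simp add: eta_v0_def[OF p] eta_v_low)
  then show ?thesis by (simp add: fterm_def power_add flip: power_mult)
qed (simp add: fterm_0)

lemma v_JJ: "x \<in> RR C s \<Longrightarrow> subring_rat C \<Longrightarrow> 1 \<le> i \<Longrightarrow> i < n \<Longrightarrow> v i * x \<in> JJ C s"
  by (rule ring_idealD(5)[OF JJ_ideal RR_subring]) (auto simp: JJ_def intro: ispan_gen RR_subring)

text \<open>This holds modulo \<open>JJ\<close>, without reduction modulo p. If k <= m + n, a
  summand with a nonzero t_s contains some v_j with j < n; a summand of the defect either has i < n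
  or has a last index at most m, where it vanishes.\<close>

theorem eta_v_mid:
  assumes k: "m < k" "k \<le> m + n"
  shows "eta_v p m 1 k - (v k + of_nat p * tv k) \<in> JJ ZZ 1"
proof -
  note J = JJ_ideal[OF ZZ, of 1]
  note Js = ring_idealD[OF J RRs]
  have A: "(\<Sum>s\<in>{1..<k}. tgen m 1 s * eta_v p m 1 (k - s) ^ (p ^ s)) \<in> JJ ZZ 1"
  proof (rule ring_ideal_sum[OF J])
    fix s assume s: "s \<in> {1..<k}"
    show "tgen m 1 s * eta_v p m 1 (k - s) ^ (p ^ s) \<in> JJ ZZ 1"
    proof (cases "s \<le> m")
      case True
      then show ?thesis using s Js(2) by (simp add: tgen_def)
    next
      case False
      then have ks: "1 \<le> k - s" "k - s < n" using s k by auto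
      have "v (k - s) * v (k - s) ^ (p ^ s - 1) \<in> JJ ZZ 1"
        using ks by (intro v_JJ lpolys_power ZZ v_RR) auto
      moreover have "v (k - s) ^ (p ^ s) = v (k - s) * v (k - s) ^ (p ^ s - 1)"
        using power_minus_mult[of "p ^ s" "v (k - s)"] p0 by (simp add: mult.commute)
      moreover have "tgen m 1 s \<in> RR ZZ 1"
        by (rule gens_RR[OF tgen_mem]) auto
      ultimately show ?thesis using ks nm p0 by (auto simp: eta_v_low intro: Js(4))
    qed
  qed
  have B: "fdefect p (eta_log p m 1) (eta_v0 p m 1) k \<in> JJ ZZ 1"
    unfolding fdefect_eq
  proof (intro ring_ideal_sum[OF J])
    fix i j assume ij: "i \<in> {1..k}" "j \<in> {..k - i}"
    show "v i * fterm i j (k - i - j) \<in> JJ ZZ 1"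
    proof (cases "i < n")
      case True
      then show ?thesis using ij by (intro v_JJ ZZ gens_RR[OF fterm_mem[of _ k]]) auto
    next
      case False
      then have "k - i - j \<le> m" using k by auto
      then show ?thesis using Js(2) by (simp add: fterm_low)
    qed
  qed
  have "eta_v p m 1 k - (v k + of_nat p * tv k) = fdefect p (eta_log p m 1) (eta_v0 p m 1) k -
      (\<Sum>s\<in>{1..<k}. tgen m 1 s * eta_v p m 1 (k - s) ^ (p ^ s))"
  proof -
    have k1: "1 \<le> k" and tk: "tgen m 1 k = tv k" using k by (auto simp: tgen_def)
    have "a + b - c + d - (a + b) = d - c" for a b c d :: lpoly by simp
    then show ?thesis unfolding eta_v_formula[OF p k1] tk .
  qed
  then show ?thesis using Js(7)[OF B A] by simp
qed

definition Sg :: "nat \<Rightarrow> gen set" where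
  "Sg k = V ` {1..} \<union> {T 1 j | j. m < j \<and> j < k}"

lemma gens_Sg: "K < k \<Longrightarrow> x \<in> lpolys C (gens m 1 K) U \<Longrightarrow> x \<in> lpolys C (Sg k) U"
  by (erule lpolys_mono) (auto simp: gens_def Sg_def)

lemma Sg_RR: "x \<in> lpolys C (Sg k) {} \<Longrightarrow> x \<in> RR C 1"
  by (erule lpolys_mono) (auto simp: Sg_def allgens_def)

text \<open>In degree k the newest variable t_k enters linearly with coefficient p; products and the
  defect involve lower indices.\<close>

lemma eta_v_lead_t:
  assumes "1 \<le> k"
  shows "eta_v p m 1 k - of_nat p * tgen m 1 k \<in> lpolys ZZ (Sg k) {}"
proof -
  have "v k - (\<Sum>s\<in>{1..<k}. tgen m 1 s * eta_v p m 1 (k - s) ^ (p ^ s)) +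
      (\<Sum>i\<in>{1..k}. \<Sum>j\<le>k - i. v i * fterm i j (k - i - j)) \<in> lpolys ZZ (Sg k) {}"
  proof (intro lpolys_add lpolys_diff lpolys_sum lpolys_mult lpolys_power ZZ)
    fix s assume s: "s \<in> {1..<k}"
    then show "tgen m 1 s \<in> lpolys ZZ (Sg k) {}" by (intro gens_Sg[OF _ tgen_mem]) auto
    show "eta_v p m 1 (k - s) \<in> lpolys ZZ (Sg k) {}"
      using s by (intro gens_Sg[OF _ eta_v_integral[OF p]]) auto
  next
    fix i j assume ij: "i \<in> {1..k}" "j \<in> {..k - i}"
    then show "v i \<in> lpolys ZZ (Sg k) {}" by (auto intro: lpolys_gvar simp: Sg_def)
    show "fterm i j (k - i - j) \<in> lpolys ZZ (Sg k) {}"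
      using ij assms by (intro gens_Sg[OF _ fterm_mem[of _ "k - 1"]]) auto
  qed (use assms in \<open>auto intro: lpolys_gvar simp: Sg_def\<close>)
  moreover have "a + b - c + d - b = a - c + d" for a b c d :: lpoly by simp
  ultimately show ?thesis unfolding eta_v_formula[OF p assms] fdefect_eq by (simp only:)
qed

text \<open>Only a subgroup: the terms that may be ignored when determining how a relation depends
  on t_k, modulo p and the killed variables.\<close>

definition MM :: "nat \<Rightarrow> lpoly set" where
  "MM k = {x + y | x y. x \<in> KB \<and> y \<in> lpolys ZZ (Sg k) {}}"

lemma MM_KB: "x \<in> KB \<Longrightarrow> x \<in> MM k"
  unfolding MM_def using lpolys_0[OF ZZ, of "Sg k" "{}"] by force

lemma MM_Sg: "x \<in> lpolys ZZ (Sg k) {} \<Longrightarrow> x \<in> MM k"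
  unfolding MM_def using KB_simps(2) by force

lemma MM_0 [simp]: "0 \<in> MM k"
  by (rule MM_Sg) (simp add: lpolys_0)

lemma MM_add: "x \<in> MM k \<Longrightarrow> y \<in> MM k \<Longrightarrow> x + y \<in> MM k"
proof -
  assume "x \<in> MM k" "y \<in> MM k"
  then obtain a b c d where "x = a + b" "y = c + d" "a \<in> KB" "c \<in> KB" "b \<in> lpolys ZZ (Sg k) {}" "d \<in> lpolys ZZ (Sg k) {}"
    unfolding MM_def by blast
  then have "x + y = (a + c) + (b + d)" "a + c \<in> KB" "b + d \<in> lpolys ZZ (Sg k) {}"
    using KB_simps(3) lpolys_add[OF ZZ] by auto
  then show ?thesis unfolding MM_def by blast
qed

lemma MM_uminus: "x \<in> MM k \<Longrightarrow> - x \<in> MM k"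
proof -
  assume "x \<in> MM k"
  then obtain a b where "x = a + b" "a \<in> KB" "b \<in> lpolys ZZ (Sg k) {}"
    unfolding MM_def by blast
  then have "- x = - a + - b" "- a \<in> KB" "- b \<in> lpolys ZZ (Sg k) {}"
    using KB_simps(6) lpolys_uminus[OF ZZ] by auto
  then show ?thesis unfolding MM_def by blast
qed

lemma MM_diff: "x \<in> MM k \<Longrightarrow> y \<in> MM k \<Longrightarrow> x - y \<in> MM k"
  using MM_add[of x k "- y"] MM_uminus[of y k] by simp

lemma MM_sum: "(\<And>i. i \<in> A \<Longrightarrow> f i \<in> MM k) \<Longrightarrow> sum f A \<in> MM k"
  by (induction A rule: infinite_finite_induct) (auto intro: MM_add)

text \<open>Write the right unit of v_k as p t_k + g. The Frobenius lift produces p t_k^(p^n), and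
  division by p leaves t_k^(p^n). The subtracted power differs from g^(p^n) by a high power of p,
  and what remains of g involves only earlier t's.\<close>

lemma fterm_lead:
  assumes k: "m < k"
  shows "v n * fterm n 0 k - v n * tv k ^ (p ^ n) \<in> MM k"
proof -
  define g where "g = eta_v p m 1 k - of_nat p * tv k"
  have gS: "g \<in> lpolys ZZ (Sg k) {}" using eta_v_lead_t[of k] k by (simp add: g_def tgen_def)
  define R where "R = lpolys ZZ (Sg (Suc k)) {}"
  have R: "subring R" unfolding R_def by (rule subring_lpolys) simp
  have tR: "tv k \<in> R" unfolding R_def using k by (intro lpolys_gvar ZZ) (auto simp: Sg_def)
  have gR: "g \<in> R" unfolding R_def by (rule lpolys_mono[OF gS]) (auto simp: Sg_def)
  \<comment> \<open>The difference has n + 1 factors p; after division by p at least one is left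
    because n >= 1.\<close>
  have "(of_nat p * tv k + g) ^ (p ^ n) - g ^ (p ^ n) \<in> pmult p (Suc n) R"
    by (rule pmult_power_power_diff[OF R])
      (use tR gR in \<open>auto intro!: pmultI[of "tv k"] subringD[OF R] subring_of_nat[OF R]\<close>)
  then obtain w where w: "w \<in> R" "(of_nat p * tv k + g) ^ (p ^ n) - g ^ (p ^ n) = of_nat p ^ Suc n * w"
    by (rule pmultE)
  have Fg: "Frob p n g - g ^ (p ^ n) \<in> pmult p 1 (Zpol p)"
    by (rule Frob_cong[OF p lpolys_mono[OF gS]]) auto
  then obtain h where h: "h \<in> Zpol p" "Frob p n g - g ^ (p ^ n) = of_nat p ^ 1 * h" by (rule pmultE)
  have hh: "h = const (1 / of_nat p) * (Frob p n g - g ^ (p ^ n))"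
    using h(2) p0 by (simp flip: mult.assoc)
  have hS: "h \<in> lpolys ZZ (Sg k) {}"
  proof -
    have "h \<in> lpolys UNIV (Sg k) {}"
      unfolding hh using lpolys_mono[OF gS, of UNIV "Sg k" "{}"]
      by (intro lpolys_const_mult lpolys_diff lpolys_power Frob_mem) auto
    then show ?thesis using lpolys_Int[OF h(1)] by fastforce
  qed
  have "eta_v0 p m 1 k = of_nat p * tv k + g" using k by (simp add: eta_v0_def[OF p] g_def)
  moreover have "Frob p n (of_nat p * tv k + g) = of_nat p * tv k ^ (p ^ n) + Frob p n g"
    by (simp add: Frob.hom_add Frob.hom_Qpol_mult Qpol_intros)
  ultimately have "fterm n 0 k = const (1 / of_nat p) * (of_nat p * tv k ^ (p ^ n) + Frob p n g - (of_nat p * tv k + g) ^ (p ^ n))"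
    by (simp add: fterm_def Frob.hom_1)
  also have "of_nat p * tv k ^ (p ^ n) + Frob p n g - (of_nat p * tv k + g) ^ (p ^ n) =
      of_nat p * (tv k ^ (p ^ n) + h - of_nat p ^ n * w)"
    using w(2) h(2) by (simp add: algebra_simps)
  finally have "fterm n 0 k = tv k ^ (p ^ n) + h - of_nat p ^ n * w"
    using p0 by (simp flip: mult.assoc)
  moreover have "(of_nat p :: lpoly) ^ n = of_nat p * of_nat p ^ (n - 1)" 
    using power_minus_mult[of n "of_nat p :: lpoly"] n1 by (simp add: mult.commute)
  ultimately have "v n * fterm n 0 k - v n * tv k ^ (p ^ n) = v n * h - of_nat p * (of_nat p ^ (n - 1) * w * v n)"
    by (simp only: ring_distribs mult_ac) simp
  moreover have "of_nat p * (of_nat p ^ (n - 1) * w * v n) \<in> MM k"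
    using n1 w(1) unfolding R_def
    by (intro MM_KB KB_gen lpolys_mult lpolys_power lpolys_of_nat v_RR ZZ Sg_RR)
  moreover have "v n * h \<in> MM k"
    using n1 hS by (intro MM_Sg lpolys_mult lpolys_gvar ZZ) (auto simp: Sg_def)
  ultimately show ?thesis by (auto intro: MM_diff)
qed

theorem eta_v_high_mod:
  assumes r: "1 \<le> r"
  shows "eta_v p m 1 (n + m + r) - (v n * tv (m + r) ^ (p ^ n) - v n ^ (p ^ (m + r)) * tv (m + r)) \<in> MM (m + r)"
proof -
  let ?k = "n + m + r" and ?l = "m + r"
  have "(\<Sum>s\<in>{1..<?k}. tgen m 1 s * eta_v p m 1 (?k - s) ^ (p ^ s) - (if s = ?l then v n ^ (p ^ ?l) * tv ?l else 0)) \<in> MM ?l"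
  proof (rule MM_sum)
    fix s assume s: "s \<in> {1..<?k}"
    \<comment> \<open>At s = m + r the other index is n and gives v_n^(p^(m+r)) t_(m+r). Beyond it
      the other index is below n, in J_n. Between m and m + r only earlier t's occur, because n <= m
      < s.\<close>
    consider "s \<le> m" | "m < s" "s < ?l" | "s = ?l" | "?l < s" by linarith
    then show "tgen m 1 s * eta_v p m 1 (?k - s) ^ (p ^ s) - (if s = ?l then v n ^ (p ^ ?l) * tv ?l else 0) \<in> MM ?l"
    proof cases
      case 1
      then show ?thesis using s r by (auto simp: tgen_def)
    next
      case 2
      have "tgen m 1 s * eta_v p m 1 (?k - s) ^ (p ^ s) \<in> lpolys ZZ (Sg ?l) {}"
        using 2 nm s by (intro lpolys_mult lpolys_power ZZ gens_Sg[OF _ tgen_mem] gens_Sg[OF _ eta_v_integral[OF p]]) auto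
      then show ?thesis using 2 by (auto intro: MM_Sg)
    next
      case 3
      then show ?thesis using r n1 nm p0 by (auto simp: tgen_def eta_v_low intro: MM_Sg lpolys_0)
    next
      case 4
      then have ks: "1 \<le> ?k - s" "?k - s < n" using s by auto
      have "v (?k - s) * v (?k - s) ^ (p ^ s - 1) \<in> KB"
        using ks by (intro KB_gen lpolys_power ZZ v_RR) (auto simp: KV_def)
      moreover have "v (?k - s) ^ (p ^ s) = v (?k - s) * v (?k - s) ^ (p ^ s - 1)"
        using power_minus_mult[of "p ^ s" "v (?k - s)"] p0 by (simp add: mult.commute)
      moreover have "tgen m 1 s \<in> RR ZZ 1"
        by (rule gens_RR[OF tgen_mem]) auto
      ultimately show ?thesis using ks 4 nm p0 by (auto simp: eta_v_low intro!: MM_KB KB_simps(4))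
    qed
  qed
  then have A: "(\<Sum>s\<in>{1..<?k}. tgen m 1 s * eta_v p m 1 (?k - s) ^ (p ^ s)) - v n ^ (p ^ ?l) * tv ?l \<in> MM ?l"
    using r n1 by (simp add: sum_subtractf)
  have "(\<Sum>i\<in>{1..?k}. \<Sum>j\<le>?k - i. v i * fterm i j (?k - i - j) - (if i = n then if j = 0 then v n * tv ?l ^ (p ^ n) else 0 else 0)) \<in> MM ?l"
  proof (intro MM_sum)
    fix i j assume ij: "i \<in> {1..?k}" "j \<in> {..?k - i}"
    \<comment> \<open>For i < n the factor v_i is killed. For i = n and j = 0 the last index is m +
      r and yields the leading power. All remaining terms have smaller last index.\<close>
    consider "i < n" | "i = n" "j = 0" | "n \<le> i" "i \<noteq> n \<or> j \<noteq> 0" "?k - i - j = 0" | "n \<le> i" "i \<noteq> n \<or> j \<noteq> 0" "?k - i - j \<noteq> 0" by linarith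
    then show "v i * fterm i j (?k - i - j) - (if i = n then if j = 0 then v n * tv ?l ^ (p ^ n) else 0 else 0) \<in> MM ?l"
    proof cases
      case 1
      then have "v i * fterm i j (?k - i - j) \<in> KB"
        using ij by (intro KB_gen gens_RR[OF fterm_mem[of _ ?k]]) (auto simp: KV_def)
      then show ?thesis using 1 by (auto intro: MM_KB)
    next
      case 2
      then show ?thesis using fterm_lead[of ?l] r by simp
    next
      case 3
      then show ?thesis by (auto simp: fterm_0 intro: MM_Sg lpolys_0)
    next
      case 4
      have "v i * fterm i j (?k - i - j) \<in> lpolys ZZ (Sg ?l) {}"
        using 4 r ij n1 by (intro lpolys_mult lpolys_gvar ZZ gens_Sg[OF _ fterm_mem[of _ "?l - 1"]]) (auto simp: Sg_def)
      then show ?thesis using 4 by (auto intro: MM_Sg)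
    qed
  qed
  moreover have "(\<Sum>i\<in>{1..?k}. \<Sum>j\<le>?k - i. if i = n then if j = 0 then v n * tv ?l ^ (p ^ n) else 0 else 0) = v n * tv ?l ^ (p ^ n)"
  proof -
    have "(\<Sum>i\<in>{1..?k}. \<Sum>j\<le>?k - i. if i = n then if j = 0 then v n * tv ?l ^ (p ^ n) else 0 else 0) =
      (\<Sum>i\<in>{1..?k}. if i = n then v n * tv ?l ^ (p ^ n) else 0)"
      by (intro sum.cong refl) auto
    then show ?thesis using n1 by simp
  qed
  ultimately have B: "fdefect p (eta_log p m 1) (eta_v0 p m 1) ?k - v n * tv ?l ^ (p ^ n) \<in> MM ?l"
    by (simp add: fdefect_eq sum_subtractf)
  have "v ?k + of_nat p * tv ?k \<in> MM ?l"
  proof (rule MM_add)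
    have "v ?k * 1 \<in> KB" using r by (intro KB_gen lpolys_1 ZZ) (auto simp: KV_def)
    then show "v ?k \<in> MM ?l" by (auto intro: MM_KB)
    show "of_nat p * tv ?k \<in> MM ?l" using r by (intro MM_KB KB_gen lpolys_gvar ZZ) (auto simp: allgens_def)
  qed
  from MM_add[OF MM_diff[OF this A] B]
  have "v ?k + of_nat p * tv ?k - (\<Sum>s\<in>{1..<?k}. tgen m 1 s * eta_v p m 1 (?k - s) ^ (p ^ s))
    + fdefect p (eta_log p m 1) (eta_v0 p m 1) ?k - (v n * tv ?l ^ (p ^ n) - v n ^ (p ^ ?l) * tv ?l) \<in> MM ?l"
  proof -
    have eq: "a - (b - c) + (d - e) = a - b + d - (e - c)" for a b c d e :: lpoly by (simp add: algebra_simps)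
    show ?thesis using MM_add[OF MM_diff[OF \<open>v ?k + of_nat p * tv ?k \<in> MM ?l\<close> A] B] unfolding eq .
  qed
  moreover have k1: "1 \<le> ?k" and tk: "tgen m 1 ?k = tv ?k" using r n1 by (auto simp: tgen_def)
  ultimately show ?thesis unfolding eta_v_formula[OF p k1] tk by blast
qed

end


section \<open>Torsion-freeness\<close>

context hopf_data
begin

definition lead :: "nat \<Rightarrow> lpoly" where
  "lead r = v n * tv (m + r) ^ (p ^ n) - v n ^ (p ^ (m + r)) * tv (m + r)"

definition rest :: "nat \<Rightarrow> lpoly" where
  "rest r = (SOME z. z \<in> lpolys ZZ (Sg (m + r)) {} \<and> eta_v p m 1 (n + m + r) - (lead r + z) \<in> KB)"

text \<open>A replacement for the relation \<open>uu r\<close> modulo \<open>KB\<close>: it contains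
  no t beyond t_(m+r), in which its leading coefficient is the unit v_n. The relation itself also
  involves later t's, with coefficients that vanish modulo p and the killed variables.\<close>

definition ww :: "nat \<Rightarrow> lpoly" where "ww r = lead r + rest r"
definition uu :: "nat \<Rightarrow> lpoly" where "uu r = eta_v p m 1 (n + m + r)"

lemma rest_props:
  assumes "1 \<le> r"
  shows "rest r \<in> lpolys ZZ (Sg (m + r)) {}" "uu r - ww r \<in> KB"
proof -
  obtain x z where "uu r - lead r = x + z" "x \<in> KB" "z \<in> lpolys ZZ (Sg (m + r)) {}"
    using eta_v_high_mod[OF assms] by (auto simp: MM_def lead_def uu_def)
  then have "uu r - (lead r + z) \<in> KB" by (simp add: algebra_simps)
  then have "\<exists>z. z \<in> lpolys ZZ (Sg (m + r)) {} \<and> eta_v p m 1 (n + m + r) - (lead r + z) \<in> KB"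
    using \<open>z \<in> lpolys ZZ (Sg (m + r)) {}\<close> by (auto simp: uu_def)
  from someI_ex[OF this] show "rest r \<in> lpolys ZZ (Sg (m + r)) {}" "uu r - ww r \<in> KB"
    by (simp_all add: rest_def[symmetric] ww_def uu_def)
qed

lemma N2: "1 < p ^ n"
  using prime_gt_1_nat[OF p] n1 by (simp add: one_less_power)

lemma ww_mem:
  assumes "1 \<le> r"
  shows "ww r \<in> lpolys ZZ (Sg (Suc (m + r))) {V n}"
proof -
  have "rest r \<in> lpolys ZZ (Sg (Suc (m + r))) {V n}"
    by (rule lpolys_mono[OF rest_props(1)[OF assms]]) (auto simp: Sg_def)
  moreover have "lead r \<in> lpolys ZZ (Sg (Suc (m + r))) {V n}"
    unfolding lead_def using n1 assms
    by (intro lpolys_diff lpolys_mult lpolys_power lpolys_gvar ZZ) (auto simp: Sg_def)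
  ultimately show ?thesis unfolding ww_def by (intro lpolys_add ZZ)
qed

lemma Sg_allgens: "Sg k \<subseteq> allgens m 1"
  by (auto simp: Sg_def allgens_def)

lemma ww_RR: "1 \<le> r \<Longrightarrow> ww r \<in> RR ZZ 1"
  by (rule lpolys_mono[OF ww_mem]) (use Sg_allgens in auto)

lemma uu_RR: "1 \<le> r \<Longrightarrow> uu r \<in> RR ZZ 1"
  unfolding uu_def by (intro eta_v_RR) auto

lemma coeff_upoly_ww:
  assumes r: "1 \<le> r"
  shows "coeff (upoly (T 1 (m + r)) (ww r)) d =
    (if d = p ^ n then v n else if d = 1 then - (v n ^ (p ^ (m + r))) else if d = 0 then rest r else 0)"
proof -
  let ?y = "T 1 (m + r)"
  have mem: "v n ^ k \<in> lpolys UNIV {V n} {}" "tv (m + r) ^ k \<in> lpolys UNIV UNIV {}" for k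
    by (intro lpolys_power lpolys_gvar; simp)+
  have mult: "upoly ?y (v n ^ k * tv (m + r) ^ j) = [:v n ^ k:] * monom 1 j" for k j
  proof -
    have "upoly ?y (v n ^ k * tv (m + r) ^ j) = upoly ?y (v n ^ k) * upoly ?y (tv (m + r) ^ j)"
      by (rule upoly_mult[OF mem]) auto
    moreover have "upoly ?y (v n ^ k) = [:v n ^ k:]" by (rule upoly_const[OF mem(1)]) auto
    ultimately show ?thesis by (simp add: upoly_gvar_power)
  qed
  have "upoly ?y (rest r) = [:rest r:]"
    by (rule upoly_const[OF rest_props(1)[OF r]]) (auto simp: Sg_def)
  then have "upoly ?y (ww r) = monom (v n) (p ^ n) - monom (v n ^ (p ^ (m + r))) 1 + [:rest r:]"
    unfolding ww_def lead_def using mult[of 1 "p ^ n"] mult[of "p ^ (m + r)" 1]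
    by (simp add: upoly_add upoly_diff smult_monom)
  then show ?thesis using N2 p0 by (auto simp: coeff_monom coeff_pCons split: nat.split)
qed

text \<open>Generated by the killed variables and the first r relations. Adding p gives
  \<open>KK r\<close> below, where each \<open>uu\<close> may be exchanged for
  \<open>ww\<close>.\<close>

definition HH :: "nat \<Rightarrow> lpoly set" where "HH r = ispan (RR ZZ 1) (gvar ` KV \<union> uu ` {1..r})"
definition KK :: "nat \<Rightarrow> lpoly set" where "KK r = ispan (RR ZZ 1) (insert (of_nat p) (gvar ` KV) \<union> ww ` {1..r})"

lemma HH_gens: "gvar ` KV \<union> uu ` {1..r} \<subseteq> RR ZZ 1"
  using KV_RR[OF ZZ] uu_RR by auto

lemma KK_gens: "insert (of_nat p) (gvar ` KV) \<union> ww ` {1..r} \<subseteq> RR ZZ 1"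
  using KG_RR ww_RR by auto

lemma HH_ideal: "ring_ideal (RR ZZ 1) (HH r)"
  unfolding HH_def by (rule ispan_ideal[OF RRs HH_gens])

lemma KK_ideal: "ring_ideal (RR ZZ 1) (KK r)"
  unfolding KK_def by (rule ispan_ideal[OF RRs KK_gens])

lemma KB_KK: "KB \<subseteq> KK r"
  unfolding KB_def KK_def by (rule ispan_mono) auto

lemma HH_mono: "r \<le> s \<Longrightarrow> HH r \<subseteq> HH s"
  unfolding HH_def by (rule ispan_mono) auto

lemma KK_mono: "r \<le> s \<Longrightarrow> KK r \<subseteq> KK s"
  unfolding KK_def by (rule ispan_mono) auto

lemma HH_KK: "HH r \<subseteq> KK r"
proof -
  note K = ring_idealD[OF KK_ideal RRs]
  have "gvar ` KV \<union> uu ` {1..r} \<subseteq> KK r"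
  proof (intro Un_least image_subsetI)
    show "gvar g \<in> KK r" if "g \<in> KV" for g
      unfolding KK_def using that by (intro ispan_gen RRs) auto
    show "uu i \<in> KK r" if "i \<in> {1..r}" for i
    proof -
      have "ww i \<in> KK r" unfolding KK_def using that by (intro ispan_gen RRs) auto
      moreover have "uu i - ww i \<in> KK r" using rest_props(2)[of i] KB_KK that by auto
      ultimately have "(uu i - ww i) + ww i \<in> KK r" by (metis K(3))
      then show ?thesis by simp
    qed
  qed
  then show ?thesis unfolding HH_def KK_def by (intro ispan_subset_ispan RRs)
qed

lemma KK_HH:
  assumes "x \<in> KK r"
  obtains z b where "z \<in> HH r" "b \<in> RR ZZ 1" "x = z + of_nat p * b"
proof -
  let ?L = "ispan (RR ZZ 1) (insert (of_nat p) (gvar ` KV \<union> uu ` {1..r}))"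
  have L: "ring_ideal (RR ZZ 1) ?L"
    using HH_gens[of r] by (intro ispan_ideal RRs insert_subsetI lpolys_of_nat ZZ)
  have KB: "KB \<subseteq> ?L" unfolding KB_def by (rule ispan_mono) auto
  have "insert (of_nat p) (gvar ` KV) \<union> ww ` {1..r} \<subseteq> ?L"
  proof (intro Un_least image_subsetI)
    show "insert (of_nat p) (gvar ` KV) \<subseteq> ?L" by (auto intro: ispan_gen RRs)
    show "ww i \<in> ?L" if "i \<in> {1..r}" for i
    proof -
      have "uu i \<in> ?L" using that by (intro ispan_gen RRs) auto
      moreover have "uu i - ww i \<in> ?L" using rest_props(2)[of i] KB that by auto
      ultimately have "uu i - (uu i - ww i) \<in> ?L" by (rule ring_idealD(7)[OF L RRs])
      then show ?thesis by simp
    qed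
  qed
  then have "KK r \<subseteq> ?L" unfolding KK_def by (intro ispan_subset_ispan RRs)
  then have "x \<in> ?L" using assms by auto
  from ispan_insert[OF this RRs] show ?thesis using that unfolding HH_def by (metis mult.commute)
qed

text \<open>\<open>ww (Suc r)\<close> is monic up to the unit v_n in a variable absent from
  \<open>KK r\<close>, hence a non-zero-divisor modulo it. Asking only for the coefficients of
  degree at least p^n is what makes the lemma usable for reduced elements.\<close>

lemma KK_division:
  assumes a: "a \<in> RR ZZ 1" and d: "\<And>d. p ^ n \<le> d \<Longrightarrow> coeff (upoly (T 1 (m + Suc r)) (a * ww (Suc r))) d \<in> KK r"
  shows "a \<in> KK r"
proof -
  let ?y = "T 1 (m + Suc r)"
  have y: "?y \<in> allgens m 1" "?y \<notin> {V n}" by (auto simp: allgens_def)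
  have w: "ww (Suc r) \<in> RR ZZ 1" by (rule ww_RR) simp
  have "coeff (upoly ?y a) d \<in> KK r" for d
  proof (rule coeff_mult_unit_lead[OF KK_ideal RRs, where B = "upoly ?y (ww (Suc r))" and N = "p ^ n" and s = 0])
    show "coeff (upoly ?y a) d \<in> RR ZZ 1" "coeff (upoly ?y (ww (Suc r))) d \<in> RR ZZ 1" for d
      using coeff_upoly_mem[OF ZZ a, of ?y d] coeff_upoly_mem[OF ZZ w, of ?y d] by (auto elim: lpolys_mono)
    show "coeff (upoly ?y (ww (Suc r))) d = 0" if "p ^ n < d" for d
      using that N2 by (subst coeff_upoly_ww) auto
    show "gvar_inv (V n) \<in> RR ZZ 1" using n1 by (intro lpolys_gvar_inv ZZ) (auto simp: allgens_def)
    show "gvar_inv (V n) * coeff (upoly ?y (ww (Suc r))) (p ^ n) = 1" by (subst coeff_upoly_ww) auto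
    show "coeff (upoly ?y a * upoly ?y (ww (Suc r))) d \<in> KK r" if "p ^ n + 0 \<le> d" for d
      using d[of d] that upoly_mult[OF a w y(2)] by simp
  qed simp
  moreover have "gvar ?y \<in> RR ZZ 1" using y by (intro lpolys_gvar ZZ)
  ultimately show ?thesis using upoly_coeff_ideal[OF KK_ideal RRs a y(2)] by blast
qed

lemma KK_coeff:
  assumes "x \<in> KK r"
  shows "coeff (upoly (T 1 (m + Suc r)) x) d \<in> KK r"
  unfolding KK_def
proof (rule coeff_upoly_ispan[OF ZZ assms[unfolded KK_def]])
  let ?y = "T 1 (m + Suc r)"
  have "gvar g \<in> lpolys ZZ (allgens m 1 - {?y}) {V n}" if "g \<in> KV" for g
    using that n1 by (intro lpolys_gvar ZZ) (auto simp: KV_def allgens_def)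
  moreover have "ww i \<in> lpolys ZZ (allgens m 1 - {?y}) {V n}" if "i \<in> {1..r}" for i
    using that by (intro lpolys_mono[OF ww_mem]) (auto simp: Sg_def allgens_def)
  ultimately show "insert (of_nat p) (gvar ` KV) \<union> ww ` {1..r} \<subseteq> lpolys ZZ (allgens m 1 - {?y}) {V n}"
    by (auto intro: lpolys_of_nat)
qed simp

lemma KK_Suc:
  assumes "x \<in> KK (Suc r)"
  obtains y a where "y \<in> KK r" "a \<in> RR ZZ 1" "x = y + a * ww (Suc r)"
proof -
  have "insert (of_nat p) (gvar ` KV) \<union> ww ` {1..Suc r} = insert (ww (Suc r)) (insert (of_nat p) (gvar ` KV) \<union> ww ` {1..r})"
    by (auto simp: atLeastAtMostSuc_conv)
  with assms have "x \<in> ispan (RR ZZ 1) (insert (ww (Suc r)) (insert (of_nat p) (gvar ` KV) \<union> ww ` {1..r}))"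
    by (simp add: KK_def)
  from ispan_insert[OF this RRs] show ?thesis using that unfolding KK_def by blast
qed

lemma HH_Suc:
  assumes "x \<in> HH (Suc r)"
  obtains y a where "y \<in> HH r" "a \<in> RR ZZ 1" "x = y + a * uu (Suc r)"
proof -
  have "gvar ` KV \<union> uu ` {1..Suc r} = insert (uu (Suc r)) (gvar ` KV \<union> uu ` {1..r})"
    by (auto simp: atLeastAtMostSuc_conv)
  with assms have "x \<in> ispan (RR ZZ 1) (insert (uu (Suc r)) (gvar ` KV \<union> uu ` {1..r}))"
    by (simp add: HH_def)
  from ispan_insert[OF this RRs] show ?thesis using that unfolding HH_def by blast
qed

lemma KV_kill: "KV \<inter> {V n} = {}" "KV \<inter> allgens m s = KV"
  using n1 by (auto simp: KV_def allgens_def)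

lemma HH_0: "HH 0 = ispan (RR ZZ 1) (gvar ` (KV \<inter> allgens m 1))"
  using KV_kill by (simp add: HH_def)

text \<open>Regularity of the relations modulo p makes p regular modulo the relations. From p x = y
  + a u one gets a u = 0 modulo p and the earlier relations, so a = z + p b there, and induction
  applies to x - b u.\<close>

lemma HH_torsion_free: "x \<in> RR ZZ 1 \<Longrightarrow> of_nat p * x \<in> HH r \<Longrightarrow> x \<in> HH r"
proof (induction r arbitrary: x)
  case 0
  interpret fixing "\<lambda>x. if x \<in> KV then 0 else gvar x" "{V n}" by (rule fixing_kill[OF KV_kill(1)])
  have "kill KV (of_nat p * x) = of_nat p * kill KV x"
    unfolding kill_def const_of_nat[symmetric] by (rule hom_const_mult)
  moreover have "kill KV (of_nat p * x) = 0"
    using 0 KV_kill by (intro kill_ispan[of _ ZZ "allgens m 1" "{V n}"]) (auto simp: HH_0)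
  ultimately have "kill KV x = 0"
    using of_nat_mult_lpoly_cancel[of p "kill KV x" 0] p0 by simp
  then show ?case using diff_kill_mem_ispan[OF ZZ 0(1) KV_kill(1)] by (simp add: HH_0)
next
  case (Suc r)
  note K = ring_idealD[OF KK_ideal RRs] and H = ring_idealD[OF HH_ideal RRs]
  from HH_Suc[OF Suc.prems(2)] obtain y a where ya: "y \<in> HH r" "a \<in> RR ZZ 1" "of_nat p * x = y + a * uu (Suc r)" .
  have "a * ww (Suc r) \<in> KK r"
  proof -
    have "of_nat p * x \<in> KK r" using KB_gen(1)[OF Suc.prems(1)] KB_KK by auto
    moreover have "y \<in> KK r" using ya HH_KK by auto
    moreover have "a * (uu (Suc r) - ww (Suc r)) \<in> KK r"
      using rest_props(2)[of "Suc r"] KB_KK ya(2) by (intro K(4)) auto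
    ultimately have "of_nat p * x - y - a * (uu (Suc r) - ww (Suc r)) \<in> KK r" by (intro K(7))
    then show ?thesis using ya(3) by (simp add: algebra_simps)
  qed
  from KK_division[OF ya(2) KK_coeff[OF this]] have "a \<in> KK r" .
  from KK_HH[OF this] obtain z b where zb: "z \<in> HH r" "b \<in> RR ZZ 1" "a = z + of_nat p * b" .
  have u: "uu (Suc r) \<in> RR ZZ 1" by (rule uu_RR) simp
  have bu: "b * uu (Suc r) \<in> RR ZZ 1" using zb u by (intro lpolys_mult ZZ)
  have "of_nat p * (x - b * uu (Suc r)) = y + z * uu (Suc r)"
    using ya(3) zb(3) by (simp add: algebra_simps)
  moreover have "y + z * uu (Suc r) \<in> HH r" using ya zb u by (intro H(3) H(5))
  ultimately have "of_nat p * (x - b * uu (Suc r)) \<in> HH r" by (rule ssubst)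
  then have "x - b * uu (Suc r) \<in> HH r"
    by (rule Suc.IH[OF lpolys_diff[OF ZZ Suc.prems(1) bu]])
  then have "x - b * uu (Suc r) \<in> HH (Suc r)" using HH_mono[of r "Suc r"] by auto
  moreover have "b * uu (Suc r) \<in> HH (Suc r)"
    by (rule H(4)[OF zb(2)]) (auto simp: HH_def intro!: ispan_gen RRs)
  ultimately have "(x - b * uu (Suc r)) + b * uu (Suc r) \<in> HH (Suc r)" by (rule H(3))
  then show ?case by simp
qed

section \<open>From finitely many relations to the full ideal\<close>

lemma II_HH: "x \<in> II ZZ 1 \<Longrightarrow> \<exists>r. x \<in> HH r"
  unfolding II_def
proof (induction rule: ispan.induct)
  case zero
  then show ?case using ring_idealD(2)[OF HH_ideal RRs] by blast
next
  case (step x a g)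
  then obtain r where r: "x \<in> HH r" by blast
  obtain s where s: "g \<in> HH s"
  proof -
    from step(3) consider k where "g = eta_v p m 0 k" "n + m < k" | k where "g = eta_v p m 1 k" "n + m < k"
      | k where "g = v k" "1 \<le> k" "k < n"
      by (auto simp: rels_def le_Suc_eq numeral_eq_Suc) (metis One_nat_def le_0_eq le_SucE)
    then show ?thesis
    proof cases
      case 1
      then have "g \<in> gvar ` KV" using p0 by (simp add: eta_v_zero KV_def)
      then show ?thesis using that[of 0] by (auto simp: HH_def intro: ispan_gen RRs)
    next
      case 2
      then have "g = uu (k - n - m)" "k - n - m \<in> {1..k}" by (auto simp: uu_def)
      then have "g \<in> gvar ` KV \<union> uu ` {1..k}" by blast
      then show ?thesis using that[of k] unfolding HH_def by (blast intro: ispan_gen[OF RRs])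
    next
      case 3
      then have "g \<in> gvar ` KV" by (auto simp: KV_def)
      then show ?thesis using that[of 0] by (auto simp: HH_def intro: ispan_gen RRs)
    qed
  qed
  have "x \<in> HH (r + s)" "g \<in> HH (r + s)" using r s HH_mono[of r "r + s"] HH_mono[of s "r + s"] by auto
  then show ?case using step(2) ring_idealD(3,4)[OF HH_ideal RRs] by blast
qed

lemma HH_II: "HH r \<subseteq> II ZZ 1"
  unfolding HH_def II_def
proof (intro ispan_mono Un_least image_subsetI order_refl)
  show "uu i \<in> rels 1" if "i \<in> {1..r}" for i
  proof -
    have "n + m < n + m + i" "(1::nat) \<le> 1" using that by auto
    then show ?thesis unfolding rels_def uu_def by blast
  qed
  show "gvar g \<in> rels 1" if gK: "g \<in> KV" for g
  proof -
    obtain k where k: "g = V k" "k \<in> {1..<n} \<or> n + m < k" using gK unfolding KV_def by fastforce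
    then show ?thesis
    proof (cases "n + m < k")
      case True
      then have "gvar g = eta_v p m 0 k" using k p0 by (simp add: eta_v_zero)
      then show ?thesis using True unfolding rels_def by blast
    qed (auto simp: rels_def)
  qed
qed

lemma II_torsion_free: "x \<in> RR ZZ 1 \<Longrightarrow> of_nat p * x \<in> II ZZ 1 \<Longrightarrow> x \<in> II ZZ 1"
  using II_HH[of "of_nat p * x"] HH_torsion_free HH_II by blast

section \<open>Clearing powers of p\<close>

lemma rat_denominator: "\<exists>k. of_nat p ^ k * q \<in> ZZ" for q :: rat
proof -
  obtain a b where q: "q = of_int a / of_int b" "b > 0" by (metis quotient_of_div quotient_of_denom_pos surj_pair)
  obtain k c where kc: "b = int p ^ k * c" "\<not> int p dvd c"
    using multiplicity_decompose'[of b "int p"] q(2) p by (metis not_prime_unit order_less_irrefl prime_int_nat_transfer prime_nat_int_transfer)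
  have "of_nat p ^ k * q = of_int a / of_int c" using q kc p0 by (auto simp: field_simps)
  then show ?thesis unfolding Zloc_def using kc(2) by blast
qed

lemma ZZ_mult_p_power: "q \<in> ZZ \<Longrightarrow> of_nat p ^ k * q \<in> ZZ"
proof -
  have "(of_nat (p ^ k) :: rat) \<in> ZZ" by (rule subring_rat_of_nat) simp
  then show "q \<in> ZZ \<Longrightarrow> of_nat p ^ k * q \<in> ZZ" by (auto intro: subring_ratD[OF ZZ])
qed

lemma lpolys_denominator:
  assumes "a \<in> lpolys UNIV S U"
  shows "\<exists>k. of_nat p ^ k * a \<in> lpolys ZZ S U"
proof -
  obtain K where K: "\<And>e. of_nat p ^ K e * lookup a e \<in> ZZ"
  proof
    show "of_nat p ^ (SOME k. of_nat p ^ k * lookup a e \<in> ZZ) * lookup a e \<in> ZZ" for e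
      by (rule someI_ex) (rule rat_denominator)
  qed
  let ?k = "\<Sum>e\<in>keys a. K e"
  have "const (of_nat p ^ ?k) * a \<in> lpolys ZZ S U"
  proof (rule lpolysI)
    fix e assume e: "e \<in> keys (const (of_nat p ^ ?k) * a)"
    then have ea: "e \<in> keys a" by (auto simp: in_keys_iff)
    have "?k = K e + (?k - K e)" using member_le_sum[OF ea, of K] by simp
    then have "of_nat p ^ ?k * lookup a e = of_nat p ^ (?k - K e) * (of_nat p ^ K e * lookup a e)"
      by (metis add.commute mult.assoc power_add)
    moreover have "of_nat p ^ (?k - K e) * (of_nat p ^ K e * lookup a e) \<in> ZZ"
      by (rule ZZ_mult_p_power[OF K])
    ultimately show "lookup (const (of_nat p ^ ?k) * a) e \<in> ZZ"
      unfolding lookup_const_mult by (rule ssubst)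
    show "x \<in> S" if "lookup e x \<noteq> 0" for x using that ea assms by (auto simp: in_keys_iff dest: lpolysD)
    show "x \<in> U" if "lookup e x < 0" for x using that ea assms by (auto simp: in_keys_iff dest: lpolysD)
  qed
  then show ?thesis by (auto simp: const_power const_of_nat)
qed

lemma II_denominator: "x \<in> II UNIV 1 \<Longrightarrow> \<exists>k. of_nat p ^ k * x \<in> II ZZ 1"
  unfolding II_def
proof (induction rule: ispan.induct)
  case (step x a g)
  note I = ring_idealD[OF ispan_ideal[OF RRs rels_RR[of ZZ 1, OF order_refl ZZ]] RRs]
  from step obtain k l where kl: "of_nat p ^ k * x \<in> ispan (RR ZZ 1) (rels 1)" "of_nat p ^ l * a \<in> RR ZZ 1"
    using lpolys_denominator by blast
  have pR: "of_nat p ^ j \<in> RR ZZ 1" for j by (intro lpolys_power lpolys_of_nat ZZ)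
  have "of_nat p ^ l * (of_nat p ^ k * x) + of_nat p ^ k * ((of_nat p ^ l * a) * g) \<in> ispan (RR ZZ 1) (rels 1)"
    by (rule I(3)[OF I(4)[OF pR kl(1)] I(4)[OF pR I(4)[OF kl(2) ispan_gen[OF RRs step(3)]]]])
  moreover have "of_nat p ^ l * (of_nat p ^ k * x) + of_nat p ^ k * ((of_nat p ^ l * a) * g) = of_nat p ^ (k + l) * (x + a * g)"
    by (simp add: algebra_simps power_add)
  ultimately show ?case by metis
qed (auto intro: ispan.zero)

text \<open>Torsion-freeness in the form used below: it transfers rational identities between
  integral elements of degree 1 to the integral complex.\<close>

theorem II_saturated:
  assumes "x \<in> II UNIV 1" "x \<in> RR ZZ 1"
  shows "x \<in> II ZZ 1"
proof -
  have "of_nat p ^ k * x \<in> II ZZ 1 \<Longrightarrow> x \<in> II ZZ 1" for k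
  proof (induction k)
    case (Suc k)
    then have "of_nat p * (of_nat p ^ k * x) \<in> II ZZ 1" by (simp add: mult.assoc)
    moreover have "of_nat p ^ k * x \<in> RR ZZ 1"
      using assms(2) by (intro lpolys_mult lpolys_power lpolys_of_nat ZZ)
    ultimately have "of_nat p ^ k * x \<in> II ZZ 1" by (rule II_torsion_free[rotated])
    then show ?case by (rule Suc.IH)
  qed simp
  then show ?thesis using II_denominator[OF assms(1)] by blast
qed

section \<open>Elements of low degree in the t's, modulo p\<close>

lemma KK_0: "KK 0 = KB"
  by (simp add: KK_def KB_def)

lemma KK_reduced:
  assumes "x \<in> KK r" "\<And>i d. s < i \<Longrightarrow> p ^ n \<le> d \<Longrightarrow> coeff (upoly (T 1 (m + i)) x) d = 0"
  shows "x \<in> KK s"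
proof (cases "r \<le> s")
  case False
  then have "s \<le> r" by simp
  from this assms(1) show ?thesis
  proof (induction r rule: dec_induct)
    case base
    then show ?case .
  next
    case (step r)
    note K = ring_idealD[OF KK_ideal RRs]
    from KK_Suc[OF step.prems] obtain y a where ya: "y \<in> KK r" "a \<in> RR ZZ 1" "x = y + a * ww (Suc r)" .
    have "a \<in> KK r"
    proof (rule KK_division[OF ya(2)])
      fix d assume d: "p ^ n \<le> d"
      have "a * ww (Suc r) = x - y" using ya(3) by simp
      then have "coeff (upoly (T 1 (m + Suc r)) (a * ww (Suc r))) d = - coeff (upoly (T 1 (m + Suc r)) y) d"
        using assms(2)[of "Suc r" d] d step.hyps by (simp add: upoly_diff)
      then show "coeff (upoly (T 1 (m + Suc r)) (a * ww (Suc r))) d \<in> KK r"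
        using KK_coeff[OF ya(1)] K(6) by simp
    qed
    then have "x \<in> KK r" unfolding ya(3) using ya(1) ww_RR[of "Suc r"] by (intro K(3) K(5)) auto
    then show ?case by (rule step.IH)
  qed
qed (use assms KK_mono in blast)

text \<open>Monomials without killed variables cannot come from those variables, so only the
  generator p accounts for their coefficients.\<close>

lemma KB_lookup:
  assumes "x \<in> KB" "\<And>g. g \<in> KV \<Longrightarrow> lookup e g = 0"
  shows "\<exists>c\<in>ZZ. lookup x e = of_nat p * c"
proof -
  from KK_HH[of x 0] assms(1) KK_0 obtain z b where zb: "z \<in> HH 0" "b \<in> RR ZZ 1" "x = z + of_nat p * b" by metis
  have "lookup z e = lookup (kill KV z) e"
    using lookup_kill[OF _ KV_kill(1), of z ZZ "allgens m 1" e] ring_idealD(1)[OF HH_ideal RRs zb(1)] assms(2) by auto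
  also have "\<dots> = 0"
    using zb(1) KV_kill by (subst kill_ispan[of _ ZZ "allgens m 1" "{V n}"]) (auto simp: HH_0)
  finally have "lookup x e = of_nat p * lookup b e"
    using zb(3) lookup_const_mult[of "of_nat p" b e] by (simp add: lookup_add const_of_nat)
  then show ?thesis using lpolys_lookup[OF ZZ zb(2)] by blast
qed

end


section \<open>Integrality of rational coboundaries\<close>

lemma (in fixing) hom_close:
  assumes g: "fixing g U" and P: "P \<in> lpolys C S U" and C: "subring_rat C"
    and R: "subring R" "\<And>c. c \<in> C \<Longrightarrow> const c \<in> R" and I: "ring_ideal R I"
    and x: "\<And>x. x \<in> S \<Longrightarrow> f x \<in> R \<and> g x \<in> R \<and> f x - g x \<in> I"
    and inv: "\<And>x. x \<in> S \<inter> U \<Longrightarrow> gvar_inv x \<in> R"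
  shows "lsubst f P - lsubst g P \<in> I"
proof -
  note Is = ring_idealD[OF I R(1)]
  have mon: "smon f e - smon g e \<in> I" if e: "e \<in> keys P" for e
  proof -
    have S: "y \<in> S" if "y \<in> keys e" for y using that e P by (auto simp: lpolys_def)
    have U: "y \<in> U" if "lookup e y < 0" for y using that e P by (auto simp: lpolys_def)
    have sp: "spow f y (lookup e y) \<in> R \<and> spow g y (lookup e y) \<in> R \<and> spow f y (lookup e y) - spow g y (lookup e y) \<in> I"
      if y: "y \<in> keys e" for y
    proof (cases "lookup e y < 0")
      case True
      then show ?thesis using inv[of y] S[OF y] U[of y] Is(2) by (auto simp: spow_def intro: subring_power R)
    next
      case False
      then show ?thesis using x[OF S[OF y]] by (auto simp: spow_def intro!: subring_power R ring_ideal_power_diff[OF I])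
    qed
    have "finite A \<Longrightarrow> A \<subseteq> keys e \<Longrightarrow> (\<Prod>y\<in>A. spow f y (lookup e y)) \<in> R \<and> (\<Prod>y\<in>A. spow g y (lookup e y)) \<in> R \<and>
       (\<Prod>y\<in>A. spow f y (lookup e y)) - (\<Prod>y\<in>A. spow g y (lookup e y)) \<in> I" for A
    proof (induction A rule: finite_induct)
      case empty
      then show ?case using Is(2) subringD(2)[OF R(1)] by simp
    next
      case (insert y A)
      let ?a = "spow f y (lookup e y)" and ?b = "spow g y (lookup e y)"
      let ?P = "\<Prod>y\<in>A. spow f y (lookup e y)" and ?Q = "\<Prod>y\<in>A. spow g y (lookup e y)"
      have *: "?a \<in> R" "?b \<in> R" "?a - ?b \<in> I" "?P \<in> R" "?Q \<in> R" "?P - ?Q \<in> I" using sp[of y] insert by auto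
      have "?a * ?P - ?b * ?Q = ?a * (?P - ?Q) + (?a - ?b) * ?Q" by (simp add: algebra_simps)
      moreover have "\<dots> \<in> I" using * by (intro Is(3) Is(4) Is(5))
      ultimately show ?case using insert * subringD(4)[OF R(1)] by simp
    qed
    from this[of "keys e"] show ?thesis by (simp add: smon_def)
  qed
  have "lsubst f P - lsubst g P = (\<Sum>e\<in>keys P. const (lookup P e) * (smon f e - smon g e))"
    by (simp add: lsubst_mext mext_def ring_distribs sum_subtractf)
  also have "\<dots> \<in> I"
    by (intro ring_ideal_sum[OF I] Is(4) R(2) lpolys_lookup[OF C P] mon)
  finally show ?thesis .
qed

lemma subring_of_rat: "subring_rat C \<Longrightarrow> subring C"
  by (simp add: subring_rat_def subring_def)

context hopf_data
begin

text \<open>A polynomial model of the right unit modulo J_n on v_n, ..., v_(m+n), as found in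
  \<open>eta_v_mid\<close>. Unlike the right unit it is explicit on monomials.\<close>

definition thf :: "gen \<Rightarrow> lpoly" where
  "thf x = (case x of V k \<Rightarrow> if m < k \<and> k \<le> m + n then v k + of_nat p * tv k else v k | T i k \<Rightarrow> gvar (T i k))"

definition theta :: "lpoly \<Rightarrow> lpoly" where "theta = lsubst thf"

sublocale th: fixing thf "{V n}" rewrites "lsubst thf \<equiv> theta"
  using nm by unfold_locales (auto simp: thf_def theta_def)

text \<open>Normal forms for E_m(n) modulo J_n, with coefficients in \<open>C\<close>.\<close>

abbreviation EE :: "rat set \<Rightarrow> lpoly set" where "EE C \<equiv> lpolys C (V ` {n..m + n}) {V n}"

lemma EE_RR: "x \<in> EE C \<Longrightarrow> x \<in> RR C s"
  using n1 by (elim lpolys_mono) (auto simp: allgens_def)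

lemma tv_RR: "subring_rat C \<Longrightarrow> m < k \<Longrightarrow> tv k \<in> RR C 1"
  by (rule lpolys_gvar) (auto simp: allgens_def)

lemma cf0_theta:
  assumes w: "w \<in> EE UNIV"
  shows "coface p m 0 w - theta w \<in> JJ UNIV 1"
  unfolding coface_eq theta_def
proof (rule fixing.hom_close[OF fixing_cofun th.fixing_axioms w subring_rat_UNIV RR_subring _ JJ_ideal])
  fix x assume x: "x \<in> V ` {n..m + n}"
  then obtain k where k: "x = V k" "n \<le> k" "k \<le> m + n" by auto
  have k1: "1 \<le> k" using k n1 by simp
  have "cofun p m 0 x - thf x \<in> JJ UNIV 1"
  proof (cases "k \<le> m")
    case True
    then show ?thesis using k k1 p0 ring_idealD(2)[OF JJ_ideal RR_subring, of UNIV] by (simp add: cofun_def thf_def eta_v_low)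
  next
    case False
    have "JJ ZZ 1 \<subseteq> JJ UNIV 1" unfolding JJ_def using RR_UNIV by (intro ispan_mono) auto
    then show ?thesis using eta_v_mid[of k] False k by (auto simp: cofun_def thf_def)
  qed
  moreover have "thf x \<in> RR UNIV 1"
    using k k1 by (auto simp: thf_def intro!: v_RR lpolys_add lpolys_mult lpolys_of_nat tv_RR)
  moreover have "cofun p m 0 x \<in> RR UNIV 1"
    using cofun_RR[of UNIV 0 0 x] k k1 by (auto simp: allgens_def)
  ultimately show "cofun p m 0 x \<in> RR UNIV 1 \<and> thf x \<in> RR UNIV 1 \<and> cofun p m 0 x - thf x \<in> JJ UNIV 1" by simp
next
  show "gvar_inv x \<in> RR UNIV 1" if "x \<in> V ` {n..m + n} \<inter> {V n}" for x
    using that n1 by (intro lpolys_gvar_inv) (auto simp: allgens_def)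
qed (auto intro: lpolys_const)

section \<open>Expansion of powers of v_k + p t_k modulo p\<close>

abbreviation pZZ :: "rat set" where "pZZ \<equiv> pmult p 1 ZZ"

lemmas ZZs = subringD[OF subring_of_rat[OF ZZ]]
lemmas ZZ_sub = subring_of_rat[OF ZZ]
lemmas pZZ_ideal = pmult_ideal[OF ZZ_sub, of p 1]
lemmas pZZs = ring_idealD[OF pZZ_ideal ZZ_sub]

text \<open>Write f = p^u c with c prime to p. From p^u <= f follows u <= f - 1, and equality forces
  p^(f-1) <= f, that is f = 1 or f = p = 2.\<close>

lemma p_power_div:
  assumes f: "1 \<le> f"
  shows "of_nat (p ^ (f - 1)) / of_nat f \<in> ZZ"
    and "f \<noteq> 1 \<Longrightarrow> \<not> (f = 2 \<and> p = 2) \<Longrightarrow> of_nat (p ^ (f - 1)) / of_nat f \<in> pZZ"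
proof -
  obtain u c where f': "f = p ^ u * c" "\<not> p dvd c"
    using multiplicity_decompose'[of f p] f p not_prime_unit by (metis One_nat_def not_one_le_zero)
  have c0: "c > 0" using f' f by (cases "c = 0") auto
  have c: "1 / of_nat c \<in> ZZ"
  proof -
    have "\<not> int p dvd int c" using f'(2) by simp
    moreover have "1 / of_nat c = of_int 1 / (of_int (int c) :: rat)" by simp
    ultimately show ?thesis unfolding Zloc_def by blast
  qed
  have le: "p ^ u \<le> f" using f' c0 by simp
  have uu: "u \<le> f - 1"
    using le prime_gt_1_nat[OF p] power_gt_expt[of p u] by linarith
  have eq: "of_nat (p ^ j) / of_nat f = of_nat (p ^ (j - u)) * (1 / of_nat c :: rat)" if "u \<le> j" for j
  proof -
    have "p ^ j = p ^ (j - u) * p ^ u" using that by (simp flip: power_add)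
    then have "(of_nat (p ^ j) :: rat) = of_nat (p ^ (j - u)) * of_nat (p ^ u)" by (metis of_nat_mult)
    then show ?thesis using p0 c0 by (simp add: f'(1))
  qed
  have pw: "of_nat k \<in> ZZ" for k by (rule subring_rat_of_nat) simp
  show "of_nat (p ^ (f - 1)) / of_nat f \<in> ZZ" unfolding eq[OF uu] by (intro ZZs(4) pw c)
  assume f1: "f \<noteq> 1" "\<not> (f = 2 \<and> p = 2)"
  have "u \<le> f - 2"
  proof (rule ccontr)
    assume "\<not> u \<le> f - 2"
    then have u: "u = f - 1" using uu by simp
    show False
    proof (cases "f = 2")
      case True
      then show False using u le f1 prime_ge_2_nat[OF p] by simp
    next
      case False
      then have f3: "f \<ge> 3" using f f1 by simp
      have "f < 2 ^ (f - 1)" using f3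
      proof (induction f rule: dec_induct)
        case (step j)
        then have "2 ^ (Suc j - 1) = (2::nat) ^ (j - 1) * 2"
            by (subst power_minus_mult) auto
        then show ?case using step by simp
      qed simp
      also have "\<dots> \<le> p ^ (f - 1)" using prime_ge_2_nat[OF p] by (intro power_mono) auto
      finally show False using le u by simp
    qed
  qed
  then have "f - 1 - u = Suc (f - 2 - u)" using f f1 by simp
  then have "of_nat (p ^ (f - 1)) / of_nat f = of_nat p ^ 1 * (of_nat (p ^ (f - 2 - u)) * (1 / of_nat c :: rat))"
    unfolding eq[OF uu] by simp
  then show "of_nat (p ^ (f - 1)) / of_nat f \<in> pZZ"
    by (rule pmultI[rotated]) (intro ZZs(4) pw c)
qed

lemma ZZ_of_int: "of_int z \<in> ZZ"
proof (cases z rule: int_cases2)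
  case (nonpos k)
  have "- of_nat k \<in> ZZ" by (intro ZZs(5) subring_rat_of_nat ZZ)
  then show ?thesis using nonpos by simp
qed (simp add: subring_rat_of_nat)

lemma const_RR: "c \<in> ZZ \<Longrightarrow> const c \<in> RR ZZ s"
  by (rule lpolys_const[OF ZZ])

abbreviation pR :: "lpoly set" where "pR \<equiv> pmult p 1 (RR ZZ 1)"

lemmas pR_ideal = pmult_ideal[OF RRs, of p 1]
lemmas pRs = ring_idealD[OF pR_ideal RRs]

lemma const_pR: "c \<in> pZZ \<Longrightarrow> x \<in> RR ZZ 1 \<Longrightarrow> const c * x \<in> pR"
proof -
  assume "c \<in> pZZ" and x: "x \<in> RR ZZ 1"
  then obtain d where d: "d \<in> ZZ" "c = of_nat p ^ 1 * d" by (rule_tac pmultE)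
  then have "const c * x = of_nat p ^ 1 * (const d * x)" by (simp add: const_mult const_of_nat mult.assoc)
  then show ?thesis by (rule pmultI[rotated]) (intro lpolys_mult const_RR d x ZZ)
qed

text \<open>The difference quotient of the a-th power: by f binom(a,f) = a binom(a-1,f-1), the
  increment from v_k to v_k + p t_k is p a times this element, whose coefficients are integral even
  when a is divisible by p.\<close>

definition sec :: "nat \<Rightarrow> nat \<Rightarrow> lpoly" where
  "sec k a = (\<Sum>f\<in>{1..a}. const (of_nat (p ^ (f - 1)) / of_nat f * of_nat ((a - 1) choose (f - 1))) * (tv k ^ f * v k ^ (a - f)))"

lemma vt_RR: "m < k \<Longrightarrow> tv k ^ i * v k ^ j \<in> RR ZZ 1"
  by (intro lpolys_mult lpolys_power tv_RR v_RR ZZ) auto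

lemma sec_RR: "m < k \<Longrightarrow> sec k a \<in> RR ZZ 1"
  unfolding sec_def
  by (intro lpolys_sum lpolys_const_mult ZZ vt_RR ZZs(4) p_power_div subring_rat_of_nat) auto

lemma power_expand: "(v k + of_nat p * tv k) ^ a = v k ^ a + const (of_nat (p * a)) * sec k a"
proof -
  have "(v k + of_nat p * tv k) ^ a = (\<Sum>f\<le>a. of_nat (a choose f) * (of_nat p * tv k) ^ f * v k ^ (a - f))"
    unfolding add.commute[of "v k"] by (rule binomial_ring)
  also have "\<dots> = v k ^ a + (\<Sum>f\<in>{1..a}. of_nat (a choose f) * (of_nat p * tv k) ^ f * v k ^ (a - f))"
    by (subst atMost_eq_insert) simp
  also have "(\<Sum>f\<in>{1..a}. of_nat (a choose f) * (of_nat p * tv k) ^ f * v k ^ (a - f)) = const (of_nat (p * a)) * sec k a"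
    unfolding sec_def sum_distrib_left
  proof (intro sum.cong refl)
    fix f assume f: "f \<in> {1..a}"
    then have "f * (a choose f) = a * ((a - 1) choose (f - 1))"
      using times_binomial_minus1_eq[of f a] by simp
    then have "(of_nat f * of_nat (a choose f) :: rat) = of_nat a * of_nat ((a - 1) choose (f - 1))"
      by (metis of_nat_mult)
    moreover have "(of_nat p ^ f :: rat) = of_nat p * of_nat (p ^ (f - 1))" using f by (cases f) auto
    ultimately have c: "of_nat (a choose f) * of_nat p ^ f =
       of_nat (p * a) * (of_nat (p ^ (f - 1)) / of_nat f * of_nat ((a - 1) choose (f - 1)) :: rat)"
      using f by (simp add: field_simps)
    have "of_nat (a choose f) * (of_nat p * tv k) ^ f * v k ^ (a - f) =
      const (of_nat (a choose f) * of_nat p ^ f) * (tv k ^ f * v k ^ (a - f))"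
      by (simp add: const_mult const_power const_of_nat power_mult_distrib mult_ac)
    then show "of_nat (a choose f) * (of_nat p * tv k) ^ f * v k ^ (a - f) = const (of_nat (p * a)) *
       (const (of_nat (p ^ (f - 1)) / of_nat f * of_nat ((a - 1) choose (f - 1))) * (tv k ^ f * v k ^ (a - f)))"
      unfolding c const_mult by (simp add: mult_ac)
  qed
  finally show ?thesis .
qed

text \<open>The residue of \<open>sec\<close> modulo p. For p = 2 the term f = 2 survives with
  coefficient (2/2) binom(a-1,1) = a - 1.\<close>

definition sec0 :: "nat \<Rightarrow> nat \<Rightarrow> lpoly" where
  "sec0 k a = (if a = 0 then 0 else tv k * v k ^ (a - 1)) +
     (if p = 2 \<and> 2 \<le> a then const (of_nat (a - 1)) * (tv k ^ 2 * v k ^ (a - 2)) else 0)"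

lemma sec_mod_p:
  assumes k: "m < k"
  shows "sec k a - sec0 k a \<in> pR"
proof -
  let ?c = "\<lambda>f. of_nat (p ^ (f - 1)) / of_nat f * of_nat ((a - 1) choose (f - 1)) :: rat"
  let ?t = "\<lambda>f. const (?c f) * (tv k ^ f * v k ^ (a - f))"
  have s0: "sec0 k a = (\<Sum>f\<in>{1..a}. if f = 1 then ?t f else 0) + (\<Sum>f\<in>{1..a}. if f = 2 then if p = 2 then ?t f else 0 else 0)"
    by (auto simp: sec0_def choose_one)
  have "sec k a - sec0 k a = (\<Sum>f\<in>{1..a}. ?t f - (if f = 1 then ?t f else 0) - (if f = 2 then if p = 2 then ?t f else 0 else 0))"
    unfolding s0 sec_def sum_subtractf by simp
  also have "\<dots> \<in> pR"
  proof (rule ring_ideal_sum[OF pR_ideal])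
    fix f assume f: "f \<in> {1..a}"
    show "?t f - (if f = 1 then ?t f else 0) - (if f = 2 then if p = 2 then ?t f else 0 else 0) \<in> pR"
    proof (cases "f = 1 \<or> f = 2 \<and> p = 2")
      case True
      then show ?thesis using pRs(2) by auto
    next
      case False
      have "?c f \<in> pZZ"
        by (rule pZZs(5)) (use f False p_power_div(2)[of f] in \<open>auto intro: subring_rat_of_nat\<close>)
      then have "?t f \<in> pR" by (intro const_pR vt_RR k)
      then show ?thesis using False by auto
    qed
  qed
  finally show ?thesis .
qed

text \<open>A Leibniz rule: a product of increments in two different factors carries one scalar
  \<open>q p a_k\<close>, which is integral, and a further increment divisible by p.\<close>

lemma prod_expand_mod_p:
  assumes "finite B" and k: "\<And>k. k \<in> B \<Longrightarrow> m < k" and q: "\<And>k. k \<in> B \<Longrightarrow> q * of_nat (p * a k) \<in> ZZ"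
  shows "const q * ((\<Prod>k\<in>B. v k ^ a k + const (of_nat (p * a k)) * sec k (a k)) - (\<Prod>k\<in>B. v k ^ a k))
     - (\<Sum>k\<in>B. const (q * of_nat (p * a k)) * sec k (a k) * (\<Prod>j\<in>B - {k}. v j ^ a j)) \<in> pR"
  using assms
proof (induction B rule: finite_induct)
  case empty
  then show ?case using pRs(2) by simp
next
  case (insert i B)
  let ?P = "\<Prod>k\<in>B. v k ^ a k + const (of_nat (p * a k)) * sec k (a k)" and ?Q = "\<Prod>k\<in>B. v k ^ a k"
  let ?S = "\<Sum>k\<in>B. const (q * of_nat (p * a k)) * sec k (a k) * (\<Prod>j\<in>B - {k}. v j ^ a j)"
  let ?c = "const (of_nat (p * a i)) * sec i (a i)"
  have IH: "const q * (?P - ?Q) - ?S \<in> pR" using insert by blast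
  have i: "m < i" "q * of_nat (p * a i) \<in> ZZ" using insert by auto
  have vR: "v k ^ a k \<in> RR ZZ 1" if "k \<in> insert i B" for k
    using insert(4)[OF that] by (intro lpolys_power v_RR ZZ) simp
  have PQ: "?P - ?Q \<in> pR"
  proof -
    have "finite A \<Longrightarrow> A \<subseteq> B \<Longrightarrow> (\<Prod>k\<in>A. v k ^ a k + const (of_nat (p * a k)) * sec k (a k)) - (\<Prod>k\<in>A. v k ^ a k) \<in> pR" for A
    proof (induction A rule: finite_induct)
      case (insert l A)
      let ?P = "\<Prod>k\<in>A. v k ^ a k + const (of_nat (p * a k)) * sec k (a k)" and ?Q = "\<Prod>k\<in>A. v k ^ a k"
      have l: "m < l" using insert \<open>\<And>k. k \<in> Set.insert i B \<Longrightarrow> m < k\<close> by auto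
      have Q: "?Q \<in> RR ZZ 1" using insert vR by (intro lpolys_prod ZZ) auto
      have s: "const (of_nat (p * a l)) * sec l (a l) \<in> pR"
        by (intro const_pR sec_RR l pmultI[of "of_nat (a l)"] subring_rat_of_nat) auto
      have "v l ^ a l + const (of_nat (p * a l)) * sec l (a l) \<in> RR ZZ 1"
        using insert vR pRs(1)[OF s] by (intro lpolys_add ZZ) auto
      then have "(v l ^ a l + const (of_nat (p * a l)) * sec l (a l)) * (?P - ?Q) + const (of_nat (p * a l)) * sec l (a l) * ?Q \<in> pR"
        using insert by (intro pRs(3) pRs(4) pRs(5)[OF Q s]) auto
      then show ?case using insert by (simp add: algebra_simps)
    qed (use pRs(2) in simp)
    then show ?thesis using insert(1) by blast
  qed
  have "(\<Sum>k\<in>insert i B. const (q * of_nat (p * a k)) * sec k (a k) * (\<Prod>j\<in>insert i B - {k}. v j ^ a j)) =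
      const (q * of_nat (p * a i)) * sec i (a i) * ?Q + v i ^ a i * ?S"
  proof -
    have "insert i B - {i} = B" using insert by auto
    moreover have "(\<Prod>j\<in>insert i B - {k}. v j ^ a j) = v i ^ a i * (\<Prod>j\<in>B - {k}. v j ^ a j)" if "k \<in> B" for k
    proof -
      have "insert i B - {k} = insert i (B - {k})" using that insert by auto
      then show ?thesis using insert by simp
    qed
    ultimately show ?thesis using insert by (simp add: sum_distrib_left mult_ac)
  qed
  then have "const q * ((\<Prod>k\<in>insert i B. v k ^ a k + const (of_nat (p * a k)) * sec k (a k)) - (\<Prod>k\<in>insert i B. v k ^ a k))
     - (\<Sum>k\<in>insert i B. const (q * of_nat (p * a k)) * sec k (a k) * (\<Prod>j\<in>insert i B - {k}. v j ^ a j)) =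
     v i ^ a i * (const q * (?P - ?Q) - ?S) + const (q * of_nat (p * a i)) * sec i (a i) * (?P - ?Q)"
    using insert by (simp add: algebra_simps const_mult)
  also have "\<dots> \<in> pR"
    by (intro pRs(3) pRs(4) IH PQ vR lpolys_mult const_RR i sec_RR ZZ) auto
  finally show ?case .
qed

section \<open>Coboundaries of monomials modulo p\<close>

definition Em :: "(gen \<Rightarrow>\<^sub>0 int) set" where
  "Em = {M. (\<forall>x. lookup M x \<noteq> 0 \<longrightarrow> x \<in> V ` {n..m + n}) \<and> (\<forall>x. lookup M x < 0 \<longrightarrow> x = V n)}"

abbreviation AA :: "nat set" where "AA \<equiv> {m + 1..m + n}"
abbreviation X :: "nat \<Rightarrow> gen \<Rightarrow>\<^sub>0 int" where "X k \<equiv> single (V k) 1"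
abbreviation Y :: "nat \<Rightarrow> gen \<Rightarrow>\<^sub>0 int" where "Y k \<equiv> single (T 1 k) 1"

text \<open>The part in direction k of the increment of q x^M that need not vanish modulo p: the
  first derivative times p t_k, and for p = 2 also the quadratic term coming from
  \<open>sec0\<close>.\<close>

definition dterm :: "(gen \<Rightarrow>\<^sub>0 int) \<Rightarrow> rat \<Rightarrow> nat \<Rightarrow> lpoly" where
  "dterm M q k = single (M - X k + Y k) (q * of_nat p * of_int (lookup M (V k))) +
     (if p = 2 then single (M - X k - X k + (Y k + Y k)) (q * of_nat p * of_int (lookup M (V k)) * of_int (lookup M (V k) - 1)) else 0)"

lemma EE_Em: "w \<in> EE C \<Longrightarrow> M \<in> keys w \<Longrightarrow> M \<in> Em"
  by (auto simp: Em_def in_keys_iff dest: lpolysD)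

lemma Em_nonneg: "M \<in> Em \<Longrightarrow> k \<in> AA \<Longrightarrow> 0 \<le> lookup M (V k)"
proof (rule ccontr)
  assume "M \<in> Em" and k: "k \<in> AA" and "\<not> 0 \<le> lookup M (V k)"
  then have "V k = V n" unfolding Em_def mem_Collect_eq not_le by blast
  then show False using k nm by simp
qed

text \<open>Separates the factor in v_n, ..., v_m, on which \<open>theta\<close> is the identity and
  which carries the negative exponents, from the powers of v_(m+1), ..., v_(m+n).\<close>

lemma split_Em:
  assumes M: "M \<in> Em"
  obtains M' where "M' \<in> Em"
    "smon thf M = single M' 1 * (\<Prod>k\<in>AA. (v k + of_nat p * tv k) ^ nat (lookup M (V k)))"
    "single M 1 = single M' 1 * (\<Prod>k\<in>AA. v k ^ nat (lookup M (V k)))"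
proof -
  define S where "S = (\<Sum>k\<in>AA. single (V k) (lookup M (V k)))"
  define M' where "M' = M - S"
  have S: "lookup S x = (if x \<in> V ` AA then lookup M x else 0)" for x
  proof -
    have "lookup S x = (\<Sum>k\<in>AA. if x = V k then lookup M x else 0)"
      unfolding S_def lookup_sum by (intro sum.cong) (auto simp: lookup_single when_def)
    also have "\<dots> = (if x \<in> V ` AA then lookup M x else 0)"
      by (cases x) auto
    finally show ?thesis .
  qed
  have keysS: "keys S \<subseteq> V ` AA" using S by (auto simp: in_keys_iff split: if_splits)
  have M'l: "lookup M' x = (if x \<in> V ` AA then 0 else lookup M x)" for x
    by (simp add: M'_def lookup_minus S)
  have M'E: "M' \<in> Em" using M by (auto simp: Em_def M'l)
  have SU: "S \<in> mons {V n}" "M' \<in> mons {V n}" using M by (auto simp: mons_def S M'l Em_def)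
  have inj: "inj_on V AA" by (auto simp: inj_on_def)
  have spl: "M = M' + S" by (simp add: M'_def)
  have smS: "smon f S = (\<Prod>k\<in>AA. f (V k) ^ nat (lookup M (V k)))" for f
  proof -
    have "smon f S = (\<Prod>x\<in>V ` AA. spow f x (lookup S x))" by (rule smon_superset[OF _ keysS]) auto
    also have "\<dots> = (\<Prod>k\<in>AA. f (V k) ^ nat (lookup M (V k)))"
      unfolding prod.reindex[OF inj] o_def using Em_nonneg[OF M] by (intro prod.cong) (auto simp: spow_def S)
    finally show ?thesis .
  qed
  have sM': "smon thf M' = single M' 1"
  proof (rule th.smon_eq_gvar)
    fix x assume "lookup M' x \<noteq> 0"
    then have "x \<in> V ` {n..m + n}" "x \<notin> V ` AA" using M by (auto simp: M'l Em_def split: if_splits)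
    then show "thf x = gvar x" by (auto simp: thf_def)
  qed
  have "fixing gvar {V n}" by (auto intro: fixing.intro)
  then have sg: "smon gvar S = single S 1" by (rule fixing.smon_eq_gvar) simp
  show ?thesis
  proof (rule that[OF M'E])
    show "smon thf M = single M' 1 * (\<Prod>k\<in>AA. (v k + of_nat p * tv k) ^ nat (lookup M (V k)))"
      unfolding spl th.smon_add[OF SU(2,1)] sM' smS using spl
      by (intro arg_cong2[where f = "(*)"] prod.cong) (auto simp: thf_def)
    show "single M 1 = single M' 1 * (\<Prod>k\<in>AA. v k ^ nat (lookup M (V k)))"
      using sg smS[of gvar] mult_single[of M' 1 S "1::rat"] spl by simp
  qed
qed

lemma theta_monomial:
  assumes M: "M \<in> Em" and q: "\<And>k. k \<in> AA \<Longrightarrow> q * of_nat p * of_int (lookup M (V k)) \<in> ZZ"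
  shows "const q * (smon thf M - single M 1) - (\<Sum>k\<in>AA. dterm M q k) \<in> pR"
proof -
  obtain M' where M': "M' \<in> Em"
    "smon thf M = single M' 1 * (\<Prod>k\<in>AA. (v k + of_nat p * tv k) ^ nat (lookup M (V k)))"
    "single M 1 = single M' 1 * (\<Prod>k\<in>AA. v k ^ nat (lookup M (V k)))"
    by (rule split_Em[OF M])
  define a where "a k = nat (lookup M (V k))" for k
  have a: "of_int (lookup M (V k)) = (of_nat (a k) :: rat)" "lookup M (V k) = int (a k)" if "k \<in> AA" for k
    using Em_nonneg[OF M that] by (simp_all add: a_def)
  have q': "q * of_nat (p * a k) \<in> ZZ" if "k \<in> AA" for k
    using q[OF that] a(1)[OF that] by (simp add: mult.assoc)
  let ?pre = "single M' 1"
  have preR: "?pre \<in> RR ZZ 1"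
    by (rule EE_RR[of _ ZZ], rule lpolys_single[OF ZZ])
      (use M'(1) in \<open>auto simp: Em_def ZZs\<close>)
  let ?P = "\<Prod>k\<in>AA. v k ^ a k + const (of_nat (p * a k)) * sec k (a k)" and ?Q = "\<Prod>k\<in>AA. v k ^ a k"
  let ?S = "\<Sum>k\<in>AA. const (q * of_nat (p * a k)) * sec k (a k) * (\<Prod>j\<in>AA - {k}. v j ^ a j)"
  let ?T = "\<Sum>k\<in>AA. const (q * of_nat (p * a k)) * sec0 k (a k) * (\<Prod>j\<in>AA - {k}. v j ^ a j)"
  have 1: "const q * (?P - ?Q) - ?S \<in> pR"
    by (rule prod_expand_mod_p) (use q' in auto)
  have 2: "?S - ?T \<in> pR"
    unfolding sum_subtractf[symmetric]
  proof (rule ring_ideal_sum[OF pR_ideal])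
    fix k assume k: "k \<in> AA"
    have "const (q * of_nat (p * a k)) * (sec k (a k) - sec0 k (a k)) * (\<Prod>j\<in>AA - {k}. v j ^ a j) \<in> pR"
      by (intro pRs(5) pRs(4) const_RR q'[OF k] sec_mod_p lpolys_prod lpolys_power v_RR ZZ) (use k in auto)
    then show "const (q * of_nat (p * a k)) * sec k (a k) * (\<Prod>j\<in>AA - {k}. v j ^ a j) -
       const (q * of_nat (p * a k)) * sec0 k (a k) * (\<Prod>j\<in>AA - {k}. v j ^ a j) \<in> pR"
      by (simp add: algebra_simps)
  qed
  have 3: "?pre * ?T = (\<Sum>k\<in>AA. dterm M q k)"
    unfolding sum_distrib_left
  proof (intro sum.cong refl)
    fix k assume k: "k \<in> AA"
    let ?R = "\<Prod>j\<in>AA - {k}. v j ^ a j"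
    let ?c = "q * of_nat (p * a k)"
    have full: "?pre * ?R * v k ^ a k = single M 1"
      using M'(3) prod.remove[OF _ k, of "\<lambda>j. v j ^ a j"] by (simp add: a_def mult_ac)
    have inv: "single N 1 * gvar_inv (V k) = single (N - X k) 1" for N
      by (simp add: gvar_inv_def mult_single single_uminus)
    have t: "single N 1 * tv k = single (N + Y k) 1" for N
      by (simp add: gvar_def mult_single)
    show "?pre * (const ?c * sec0 k (a k) * ?R) = dterm M q k"
    proof (cases "a k = 0")
      case True
      then show ?thesis using a[OF k] by (simp add: dterm_def)
    next
      case False
      have m1: "?pre * ?R * v k ^ (a k - 1) = single (M - X k) 1"
      proof -
        have "v k ^ a k = v k ^ (a k - 1) * v k" using False by (simp add: power_minus_mult)
        then have "single M 1 * gvar_inv (V k) = ?pre * ?R * v k ^ (a k - 1) * (v k * gvar_inv (V k))"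
          by (simp only: full[symmetric] mult.assoc)
        then show ?thesis by (simp only: inv gvar_mult_inv mult_1_right)
      qed
      have y1: "?pre * ?R * (tv k * v k ^ (a k - 1)) = single (M - X k + Y k) 1"
      proof -
        have "?pre * ?R * (tv k * v k ^ (a k - 1)) = ?pre * ?R * v k ^ (a k - 1) * tv k"
          by (simp only: mult_ac)
        then show ?thesis by (simp only: m1 t)
      qed
      have c: "const ?c * single N 1 = single N (q * of_nat p * of_int (lookup M (V k)))" for N
        using a[OF k] by (simp add: mult.assoc)
      show ?thesis
      proof (cases "p = 2 \<and> 2 \<le> a k")
        case True
        have m2: "?pre * ?R * v k ^ (a k - 2) = single (M - X k - X k) 1"
        proof -
          have "v k ^ (a k - 1) = v k ^ (a k - 2) * v k" using True power_minus_mult[of "a k - 1" "v k"] by simp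
          then have "single (M - X k) 1 * gvar_inv (V k) = ?pre * ?R * v k ^ (a k - 2) * (v k * gvar_inv (V k))"
            by (simp only: m1[symmetric] mult.assoc)
          then show ?thesis by (simp only: inv gvar_mult_inv mult_1_right)
        qed
        moreover have "?pre * ?R * (tv k ^ 2 * v k ^ (a k - 2)) = ?pre * ?R * v k ^ (a k - 2) * tv k * tv k"
          by (simp only: power2_eq_square mult_ac)
        ultimately have "?pre * ?R * (tv k ^ 2 * v k ^ (a k - 2)) = single (M - X k - X k) 1 * tv k * tv k"
          by (simp only: m2)
        then have y2: "?pre * ?R * (tv k ^ 2 * v k ^ (a k - 2)) = single (M - X k - X k + (Y k + Y k)) 1"
          by (simp only: t add.assoc)
        have s0: "sec0 k (a k) = tv k * v k ^ (a k - 1) + const (of_nat (a k - 1)) * (tv k ^ 2 * v k ^ (a k - 2))"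
          using False unfolding sec0_def if_P[OF True] by simp
        have "?pre * (const ?c * sec0 k (a k) * ?R) = const ?c * (?pre * ?R * (tv k * v k ^ (a k - 1))) +
            const (of_nat (a k - 1)) * (const ?c * (?pre * ?R * (tv k ^ 2 * v k ^ (a k - 2))))"
          unfolding s0 by (simp only: ring_distribs mult_ac)
        also have "\<dots> = dterm M q k"
          unfolding y1 y2 c dterm_def using True a[OF k] False by (simp add: of_nat_diff mult_ac)
        finally show ?thesis .
      next
        case F: False
        have s0: "sec0 k (a k) = tv k * v k ^ (a k - 1)" using F False by (auto simp: sec0_def)
        have "?pre * (const ?c * sec0 k (a k) * ?R) = const ?c * (?pre * ?R * (tv k * v k ^ (a k - 1)))"
          unfolding s0 by (simp only: mult_ac)
        also have "\<dots> = dterm M q k"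
        proof -
          have "p = 2 \<Longrightarrow> a k = 1" using F False by auto
          then show ?thesis unfolding y1 c dterm_def using a[OF k] by auto
        qed
        finally show ?thesis .
      qed
    qed
  qed
  have "?pre * ((const q * (?P - ?Q) - ?S) + (?S - ?T)) \<in> pR"
    by (intro pRs(4) pRs(3) preR 1 2)
  moreover have "?pre * ((const q * (?P - ?Q) - ?S) + (?S - ?T)) = const q * (?pre * ?P - ?pre * ?Q) - ?pre * ?T"
    by (simp add: algebra_simps)
  moreover have "?pre * ?P = smon thf M" using M'(2) by (simp add: power_expand a_def)
  moreover have "?pre * ?Q = single M 1" using M'(3) by (simp add: a_def)
  ultimately show ?thesis using 3 by simp
qed

text \<open>An exponent of v_k could become negative only for exponent 0, or 1 in the quadratic
  term, and there the coefficient is zero.\<close>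

lemma dterm_RR:
  assumes M: "M \<in> Em" and k: "k \<in> AA" and q: "q * of_nat p * of_int (lookup M (V k)) \<in> ZZ"
  shows "dterm M q k \<in> RR ZZ 1"
proof -
  have kV: "V k \<noteq> V n" using k nm by auto
  have *: "single (M + N) c \<in> RR ZZ 1" if c: "c \<in> ZZ" "c \<noteq> 0 \<Longrightarrow> lookup (M + N) (V k) \<ge> 0"
     and N: "\<And>x. lookup N x \<noteq> 0 \<Longrightarrow> x = V k \<or> x = T 1 k" "lookup N (T 1 k) \<ge> 0" for N c
  proof (cases "c = 0")
    case False
    show ?thesis
    proof (rule lpolys_single[OF ZZ c(1)])
      fix x
      show "x \<in> allgens m 1" if "lookup (M + N) x \<noteq> 0"
      proof -
        have "lookup M x \<noteq> 0 \<or> lookup N x \<noteq> 0" using that by (auto simp: lookup_add)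
        then show ?thesis using M N(1)[of x] k n1 by (auto simp: Em_def allgens_def)
      qed
      show "x \<in> {V n}" if "lookup (M + N) x < 0"
      proof -
        have "x \<noteq> V k" using that c(2) False by auto
        moreover have "x \<noteq> T 1 k"
        proof
          assume x: "x = T 1 k"
          have "lookup M (T 1 k) = 0" using M unfolding Em_def by blast
          then show False using that N(2) by (simp add: x lookup_add)
        qed
        ultimately have "lookup N x = 0" using N(1) by blast
        then show ?thesis using that M by (simp add: Em_def lookup_add)
      qed
    qed
  qed (simp add: lpolys_0)
  have lk: "lookup (M + (- X k + Y k)) (V k) = lookup M (V k) - 1" "lookup (M + (- X k - X k + (Y k + Y k))) (V k) = lookup M (V k) - 2"
    by (simp_all add: lookup_add lookup_minus lookup_single)
  have c2: "q * of_nat p * of_int (lookup M (V k)) * of_int (lookup M (V k) - 1) \<in> ZZ"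
  proof (rule ZZs(4)[OF q])
    show "of_int (lookup M (V k) - 1) \<in> ZZ" by (rule ZZ_of_int)
  qed
  have A: "single (M + (- X k + Y k)) (q * of_nat p * of_int (lookup M (V k))) \<in> RR ZZ 1"
  proof (rule *[OF q])
    assume "q * of_nat p * of_int (lookup M (V k)) \<noteq> 0"
    then have "lookup M (V k) \<noteq> 0" by auto
    then show "0 \<le> lookup (M + (- X k + Y k)) (V k)" unfolding lk using Em_nonneg[OF M k] by linarith
  qed (auto simp: lookup_add lookup_minus lookup_single when_def split: if_splits)
  have B: "single (M + (- X k - X k + (Y k + Y k))) (q * of_nat p * of_int (lookup M (V k)) * of_int (lookup M (V k) - 1)) \<in> RR ZZ 1"
  proof (rule *[OF c2])
    assume "q * of_nat p * of_int (lookup M (V k)) * of_int (lookup M (V k) - 1) \<noteq> 0"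
    then have "lookup M (V k) \<noteq> 0" "lookup M (V k) \<noteq> 1" by auto
    then show "0 \<le> lookup (M + (- X k - X k + (Y k + Y k))) (V k)" unfolding lk using Em_nonneg[OF M k] by linarith
  qed (auto simp: lookup_add lookup_minus lookup_single when_def split: if_splits)
  have "M - X k + Y k = M + (- X k + Y k)"
    "M - X k - X k + (Y k + Y k) = M + (- X k - X k + (Y k + Y k))" by simp_all
  then show ?thesis
    unfolding dterm_def using lpolys_add[OF ZZ A B] A
    by (cases "p = 2") (simp_all only: if_True if_False refl add_0_right)
qed

lemma theta_integral:
  assumes M: "M \<in> Em" and q: "\<And>k. k \<in> AA \<Longrightarrow> q * of_nat p * of_int (lookup M (V k)) \<in> ZZ"
  shows "theta (single M q) - single M q \<in> RR ZZ 1"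
proof -
  have "theta (single M q) - single M q = (const q * (smon thf M - single M 1) - (\<Sum>k\<in>AA. dterm M q k)) + (\<Sum>k\<in>AA. dterm M q k)"
    by (simp add: th.hom_single ring_distribs)
  also have "\<dots> \<in> RR ZZ 1"
    using pRs(1)[OF theta_monomial[OF M q]] dterm_RR[OF M _ q] by (intro lpolys_add lpolys_sum ZZ) auto
  finally show ?thesis .
qed

end


section \<open>Divisibility of the linear coefficients\<close>

context hopf_data
begin

lemma upoly_single: "upoly y (single e c) = monom (single (e - single y (lookup e y)) c) (nat (lookup e y))"
  unfolding upoly_def by (rule mext_single) simp

lemma Em_T: "M \<in> Em \<Longrightarrow> lookup M (T i k) = 0"
  unfolding Em_def by blast

lemma lookup_dterm_T:
  assumes "M \<in> Em"
  shows "lookup (M - X k + Y k) (T 1 l) = (if k = l then 1 else 0)"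
    "lookup (M - X k - X k + (Y k + Y k)) (T 1 l) = (if k = l then 2 else 0)"
  using Em_T[OF assms, of 1 l] by (auto simp: lookup_add lookup_minus lookup_single when_def simp del: lookup_frag_of)

text \<open>The coefficient of the linear term of \<open>dterm\<close>. Its integrality for all k is
  the bound on the denominator of the coefficient of x^M.\<close>

definition alpha :: "lpoly \<Rightarrow> (gen \<Rightarrow>\<^sub>0 int) \<Rightarrow> nat \<Rightarrow> rat" where
  "alpha w M k = lookup w M * of_nat p * of_int (lookup M (V k))"

lemma coeff_dterm:
  assumes M: "M \<in> Em"
  shows "3 \<le> d \<Longrightarrow> coeff (upoly (T 1 l) (dterm M q k)) d = 0"
    and "k \<noteq> l \<Longrightarrow> 1 \<le> d \<Longrightarrow> coeff (upoly (T 1 l) (dterm M q k)) d = 0"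
    and "coeff (upoly (T 1 k) (dterm M q k)) 1 = single (M - X k) (q * of_nat p * of_int (lookup M (V k)))"
    and "p = 2 \<Longrightarrow> coeff (upoly (T 1 k) (dterm M q k)) 2 =
      single (M - X k - X k) (q * of_nat p * of_int (lookup M (V k)) * of_int (lookup M (V k) - 1))"
proof -
  let ?e1 = "M - X k + Y k" and ?e2 = "M - X k - X k + (Y k + Y k)"
  let ?c1 = "q * of_nat p * of_int (lookup M (V k))"
  let ?c2 = "?c1 * of_int (lookup M (V k) - 1)"
  have u: "upoly (T 1 l) (dterm M q k) = monom (single (?e1 - single (T 1 l) (lookup ?e1 (T 1 l))) ?c1) (nat (lookup ?e1 (T 1 l))) +
    (if p = 2 then monom (single (?e2 - single (T 1 l) (lookup ?e2 (T 1 l))) ?c2) (nat (lookup ?e2 (T 1 l))) else 0)" for l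
    unfolding dterm_def upoly_add upoly_single[symmetric] by simp
  show "3 \<le> d \<Longrightarrow> coeff (upoly (T 1 l) (dterm M q k)) d = 0"
    unfolding u lookup_dterm_T[OF M] by (auto simp: coeff_monom)
  show "k \<noteq> l \<Longrightarrow> 1 \<le> d \<Longrightarrow> coeff (upoly (T 1 l) (dterm M q k)) d = 0"
    unfolding u lookup_dterm_T[OF M] by (auto simp: coeff_monom)
  show "coeff (upoly (T 1 k) (dterm M q k)) 1 = single (M - X k) ?c1"
    unfolding u lookup_dterm_T[OF M] by (simp add: coeff_monom)
  have "?e2 - single (T 1 k) 2 = M - X k - X k"
  proof -
    have "single (T 1 k) (2::int) = Y k + Y k" by (simp flip: single_add)
    then show ?thesis by simp
  qed
  then show "p = 2 \<Longrightarrow> coeff (upoly (T 1 k) (dterm M q k)) 2 = single (M - X k - X k) ?c2"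
    unfolding u lookup_dterm_T[OF M] by (simp add: coeff_monom)
qed

text \<open>The exponents of the t's reveal k and separate linear from quadratic terms; M is then
  determined, so different monomials of w cannot cancel.\<close>

lemma lookup_dterm:
  assumes M: "M \<in> Em" "M0 \<in> Em"
  shows "lookup (dterm M q k) (M0 - X k0 + Y k0) =
    (if M = M0 \<and> k = k0 then q * of_nat p * of_int (lookup M (V k)) else 0)"
proof -
  let ?e = "M0 - X k0 + Y k0"
  have t: "lookup ?e (T 1 k0) = 1" using lookup_dterm_T(1)[OF M(2), of k0 k0] by simp
  have 1: "M - X k + Y k = ?e \<longleftrightarrow> M = M0 \<and> k = k0"
  proof
    assume e: "M - X k + Y k = ?e"
    then have "k = k0" using t lookup_dterm_T(1)[OF M(1), of k k0] by (auto split: if_splits)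
    then show "M = M0 \<and> k = k0" using e by simp
  qed simp
  have 2: "M - X k - X k + (Y k + Y k) \<noteq> ?e"
  proof
    assume "M - X k - X k + (Y k + Y k) = ?e"
    then show False using t lookup_dterm_T(2)[OF M(1), of k k0] by (auto split: if_splits)
  qed
  show ?thesis unfolding dterm_def lookup_add lookup_single using 1 2 by (auto simp: lookup_single when_def)
qed

lemma pR_KB: "pR \<subseteq> KB"
  by (auto elim!: pmultE intro: KB_gen)

lemma KV_Em:
  assumes "M \<in> Em" "g \<in> KV" "k \<in> AA"
  shows "lookup M g = 0" "lookup (M - X k) g = 0" "lookup (M - X k + Y k) g = 0"
proof -
  obtain j where j: "g = V j" "j < n \<or> n + m < j" using assms(2) unfolding KV_def by fastforce
  have "g \<notin> V ` {n..m + n}" using j by auto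
  then show M: "lookup M g = 0" using assms(1) unfolding Em_def by blast
  have "j \<noteq> k" using j assms(3) nm by auto
  then show "lookup (M - X k) g = 0" "lookup (M - X k + Y k) g = 0"
    using M j by (auto simp: lookup_add lookup_minus lookup_single)
qed

text \<open>The descent step: if all linear coefficients are integral and the coboundary vanishes
  modulo p up to rational relations, then they are divisible by p.\<close>

lemma key_step:
  assumes w: "w \<in> EE UNIV" and q: "\<And>M k. k \<in> AA \<Longrightarrow> alpha w M k \<in> ZZ"
    and th: "theta w - w = of_nat p * b + x" "b \<in> RR ZZ 1" "x \<in> II UNIV 1" and k0: "k0 \<in> AA"
  shows "alpha w M0 k0 \<in> pZZ"
proof (cases "M0 \<in> keys w")
  case False
  then show ?thesis using pZZs(2) by (simp add: alpha_def in_keys_iff)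
next
  case M0: True
  \<comment> \<open>An explicit representative of the increment modulo p, of degree at most 2 in the
    t's.\<close>
  define F where "F = (\<Sum>M\<in>keys w. \<Sum>k\<in>AA. dterm M (lookup w M) k)"
  have Em: "M \<in> Em" if "M \<in> keys w" for M using EE_Em[OF w that] .
  have "theta w - w = (\<Sum>M\<in>keys w. const (lookup w M) * (smon thf M - single M 1))"
  proof -
    have "theta w = (\<Sum>M\<in>keys w. const (lookup w M) * smon thf M)"
      by (simp add: theta_def lsubst_mext mext_def)
    moreover have "w = (\<Sum>M\<in>keys w. const (lookup w M) * single M 1)"
      by (subst (1) poly_mapping_sum_single) simp
    ultimately show ?thesis by (simp add: ring_distribs sum_subtractf)
  qed
  then have "theta w - w - F = (\<Sum>M\<in>keys w. const (lookup w M) * (smon thf M - single M 1) - (\<Sum>k\<in>AA. dterm M (lookup w M) k))"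
    by (simp add: F_def sum_subtractf)
  also have "\<dots> \<in> pR"
    by (intro ring_ideal_sum[OF pR_ideal] theta_monomial Em) (use q in \<open>auto simp: alpha_def\<close>)
  finally have err: "theta w - w - F \<in> pR" .
  have FR: "F \<in> RR ZZ 1"
    unfolding F_def by (intro lpolys_sum ZZ dterm_RR Em) (use q in \<open>auto simp: alpha_def\<close>)
  have pb: "of_nat p * b \<in> pR" using th(2) by (intro pmultI[of b]) auto
  \<comment> \<open>A rational combination of relations that turns out to be integral; saturation
    makes it an integral combination.\<close>
  have "x = F - of_nat p * b + (theta w - w - F)" using th(1) by simp
  then have "x \<in> RR ZZ 1" using FR pRs(1)[OF pb] pRs(1)[OF err] by (metis lpolys_add lpolys_diff ZZ)
  then have "x \<in> II ZZ 1" by (rule II_saturated[OF th(3)])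
  then obtain r where "x \<in> HH r" using II_HH by blast
  then have xK: "x \<in> KK r" using HH_KK by blast
  note K = ring_idealD[OF KK_ideal RRs]
  have "of_nat p * b \<in> KK r" "theta w - w - F \<in> KK r" using pb err pR_KB KB_KK by blast+
  then have "of_nat p * b + x - (theta w - w - F) \<in> KK r" using K(7)[OF K(3)[OF _ xK]] by blast
  then have FK: "F \<in> KK r" using th(1) by simp
  have coeffF: "coeff (upoly y F) d = (\<Sum>M\<in>keys w. \<Sum>k\<in>AA. coeff (upoly y (dterm M (lookup w M) k)) d)" for y d
  proof -
    have s: "upoly y (sum f A) = (\<Sum>i\<in>A. upoly y (f i))" for f and A :: "'z set"
      by (induction A rule: infinite_finite_induct) (simp_all add: upoly_add)
    show ?thesis unfolding F_def s coeff_sum ..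
  qed
  have high: "coeff (upoly (T 1 l) F) d = 0" if "3 \<le> d" for l d
    unfolding coeffF by (intro sum.neutral ballI coeff_dterm(1) Em that)
  show ?thesis
  proof (cases "2 < p ^ n")
    case True
    \<comment> \<open>With p^n > 2 degree at most 2 is already reduced, so no relation is involved
      and F vanishes modulo p and the killed variables.\<close>
    have "F \<in> KK 0" using FK
    proof (rule KK_reduced)
      show "coeff (upoly (T 1 (m + i)) F) d = 0" if "p ^ n \<le> d" for i d
        using that True by (intro high) linarith
    qed
    then have "F \<in> KB" by (simp add: KK_0)
    then obtain c where c: "c \<in> ZZ" "lookup F (M0 - X k0 + Y k0) = of_nat p * c"
      using KB_lookup[of F "M0 - X k0 + Y k0"] KV_Em(3)[OF Em[OF M0] _ k0] by blast
    have "lookup F (M0 - X k0 + Y k0) = (\<Sum>M\<in>keys w. \<Sum>k\<in>AA. if M = M0 \<and> k = k0 then alpha w M k else 0)"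
      unfolding F_def lookup_sum
      by (intro sum.cong refl) (simp add: lookup_dterm[OF Em Em[OF M0]] alpha_def)
    also have "\<dots> = (\<Sum>M\<in>keys w. if M = M0 then alpha w M0 k0 else 0)"
    proof (intro sum.cong refl)
      fix M
      show "(\<Sum>k\<in>AA. if M = M0 \<and> k = k0 then alpha w M k else 0) = (if M = M0 then alpha w M0 k0 else 0)"
        using k0 by (cases "M = M0") auto
    qed
    also have "\<dots> = alpha w M0 k0" using M0 by simp
    finally show ?thesis using c by (intro pmultI[of c]) auto
  next
    case False
    \<comment> \<open>Here the first relation has degree \<open>2\<close> in \<open>t\<^bsub>m+1\<^esub>\<close>, and eliminating the squares mixes the
      coefficients; consider one of maximal degree in \<open>v\<^bsub>m+1\<^esub>\<close>.\<close>
    have pn: "p = 2" "n = 1"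
    proof -
      have "2 ^ n \<le> p ^ n" using prime_ge_2_nat[OF p] by (intro power_mono) auto
      then have "(2::nat) ^ n \<le> 2" using False by linarith
      then have "(2::nat) ^ n \<le> 2 ^ 1" by simp
      then have "n \<le> 1" by (subst (asm) power_increasing_iff) auto
      then show "n = 1" using n1 by simp
      then show "p = 2" using False prime_ge_2_nat[OF p] by simp
    qed
    have AA1: "AA = {m + 1}" using pn by auto
    then have k0': "k0 = m + 1" using k0 by simp
    let ?y = "T 1 (m + 1)"
    have "F \<in> KK (Suc 0)" using FK
    proof (rule KK_reduced)
      fix i d assume i: "Suc 0 < i" and d: "p ^ n \<le> d"
      have "coeff (upoly (T 1 (m + i)) (dterm M (lookup w M) k)) d = 0" if "M \<in> keys w" "k \<in> AA" for M k
        using i d that N2 AA1 by (intro coeff_dterm(2) Em) auto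
      then show "coeff (upoly (T 1 (m + i)) F) d = 0"
        unfolding coeffF by (intro sum.neutral ballI)
    qed
    from KK_Suc[OF this] obtain y0 a where ya: "y0 \<in> KK 0" "a \<in> RR ZZ 1" "F = y0 + a * ww (Suc 0)" .
    have y0c: "coeff (upoly ?y y0) d \<in> KB" for d using KK_coeff[OF ya(1), of d] by (simp add: KK_0)
    let ?A = "upoly ?y a" and ?B = "upoly ?y (ww 1)"
    have w1: "ww 1 \<in> RR ZZ 1" by (rule ww_RR) simp
    have AB: "upoly ?y F = upoly ?y y0 + ?A * ?B"
      using ya(3) upoly_mult[OF ya(2) w1, of ?y] by (simp add: upoly_add)
    have B12: "coeff ?B 2 = v n" "coeff ?B 1 = - (v n ^ (p ^ (m + 1)))"
      using coeff_upoly_ww[of 1] pn by simp_all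
    have Bhi: "coeff ?B d = 0" if "2 < d" for d
      using coeff_upoly_ww[of 1 d] that pn by simp
    have AR: "coeff ?A d \<in> RR ZZ 1" and BR: "coeff ?B d \<in> RR ZZ 1" for d
      using coeff_upoly_mem[OF ZZ w1, of ?y d] coeff_upoly_mem[OF ZZ ya(2), of ?y d] by (auto elim: lpolys_mono)
    \<comment> \<open>F has degree at most 2 and \<open>ww 1\<close> has degree 2, so modulo
      \<open>KB\<close> the multiplier is constant in t_(m+1).\<close>
    have A: "coeff ?A d \<in> KB" if "1 \<le> d" for d
    proof (rule coeff_mult_unit_lead[OF KB_ideal RRs, where B = ?B and N = 2 and s = 1])
      show "gvar_inv (V n) \<in> RR ZZ 1" using n1 by (intro lpolys_gvar_inv ZZ) (auto simp: allgens_def)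
      show "gvar_inv (V n) * coeff ?B 2 = 1" by (simp add: B12)
      show "coeff (?A * ?B) d \<in> KB" if "2 + 1 \<le> d" for d
      proof -
        have "coeff (?A * ?B) d = - coeff (upoly ?y y0) d"
          using high[of d "m + 1"] that AB by (simp add: add_eq_0_iff2)
        then show ?thesis using KB_simps(6)[OF y0c] by simp
      qed
    qed (use AR BR Bhi that in auto)
    let ?E = "p ^ (m + 1)"
    let ?F1 = "coeff (upoly ?y F) 1" and ?F2 = "coeff (upoly ?y F) 2"
    have c1: "coeff (?A * ?B) 1 = coeff ?A 0 * coeff ?B 1 + coeff ?A 1 * coeff ?B 0"
    proof -
      have "{..1::nat} = {0, 1}" by auto
      then show ?thesis unfolding coeff_mult by simp
    qed
    have c2: "coeff (?A * ?B) 2 = coeff ?A 0 * coeff ?B 2 + (coeff ?A 1 * coeff ?B 1 + coeff ?A 2 * coeff ?B 0)"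
    proof -
      have "{..2::nat} = {0, 1, 2}" by auto
      then show ?thesis unfolding coeff_mult by simp
    qed
    have E: "v n ^ ?E = v n ^ (?E - 1) * v n" using p0 by (subst power_minus_mult) auto
    have vE: "v n ^ (?E - 1) \<in> RR ZZ 1" using n1 by (intro lpolys_power v_RR ZZ)
    \<comment> \<open>The unknown constant multiplier enters the two coefficients with factors
      -v_n^E and v_n. This combination eliminates it.\<close>
    have "?F1 + v n ^ (?E - 1) * ?F2 = (coeff (upoly ?y y0) 1 + coeff ?A 1 * coeff ?B 0) +
      v n ^ (?E - 1) * (coeff (upoly ?y y0) 2 + (coeff ?A 1 * coeff ?B 1 + coeff ?A 2 * coeff ?B 0))"
      unfolding AB coeff_add c1 c2 B12 E by (simp add: algebra_simps)
    also have "\<dots> \<in> KB"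
      by (intro KB_simps(3) KB_simps(4)[OF vE] y0c KB_simps(5) A BR) auto
    finally have G: "?F1 + v n ^ (?E - 1) * ?F2 \<in> KB" .
    let ?x = "X (m + 1)"
    have F1: "?F1 = (\<Sum>M\<in>keys w. single (M - ?x) (alpha w M (m + 1)))"
      unfolding coeffF AA1 using coeff_dterm(3)[OF Em] by (intro sum.cong refl) (simp add: alpha_def)
    have F2: "v n ^ (?E - 1) * ?F2 = (\<Sum>M\<in>keys w. single (single (V n) (int (?E - 1)) + (M - ?x - ?x)) (alpha w M (m + 1) * of_int (lookup M (V (m + 1)) - 1)))"
      unfolding coeffF AA1 gvar_power_single sum_distrib_left using coeff_dterm(4)[OF Em pn(1)]
      by (intro sum.cong refl) (simp add: alpha_def mult_single)
    show ?thesis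
    proof (rule ccontr)
      assume neg: "alpha w M0 k0 \<notin> pZZ"
      define Bad where "Bad = {M \<in> keys w. alpha w M k0 \<notin> pZZ}"
      have "finite Bad" "Bad \<noteq> {}" using M0 neg by (auto simp: Bad_def)
      then obtain N where N: "N \<in> Bad" "\<And>M. M \<in> Bad \<Longrightarrow> lookup M (V k0) \<le> lookup N (V k0)"
        using obtains_MAX[of Bad "\<lambda>M. lookup M (V k0)"] by (metis Max_ge finite_imageI imageI)
      have Nk: "N \<in> keys w" using N by (simp add: Bad_def)
      have nV: "V n \<noteq> V k0" using k0 nm by auto
      have L: "lookup (?F1 + v n ^ (?E - 1) * ?F2) (N - X k0) =
         alpha w N k0 + (\<Sum>M\<in>keys w. if single (V n) (int (?E - 1)) + (M - ?x - ?x) = N - X k0 then alpha w M k0 * of_int (lookup M (V k0) - 1) else 0)"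
      proof -
        have "lookup ?F1 (N - X k0) = (\<Sum>M\<in>keys w. if M = N then alpha w N k0 else 0)"
          unfolding F1 lookup_sum k0' by (intro sum.cong refl) (auto simp: lookup_single when_def)
        then have "lookup ?F1 (N - X k0) = alpha w N k0" using Nk by simp
        then show ?thesis unfolding lookup_add F2 lookup_sum lookup_single when_def k0' by (simp only:)
      qed
      have S: "(\<Sum>M\<in>keys w. if single (V n) (int (?E - 1)) + (M - ?x - ?x) = N - X k0 then alpha w M k0 * of_int (lookup M (V k0) - 1) else 0) \<in> pZZ"
      proof (rule ring_ideal_sum[OF pZZ_ideal])
        fix M assume M: "M \<in> keys w"
        show "(if single (V n) (int (?E - 1)) + (M - ?x - ?x) = N - X k0 then alpha w M k0 * of_int (lookup M (V k0) - 1) else 0) \<in> pZZ"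
        proof (cases "single (V n) (int (?E - 1)) + (M - ?x - ?x) = N - X k0")
          case True
          then have "lookup (single (V n) (int (?E - 1)) + (M - ?x - ?x)) (V k0) = lookup (N - X k0) (V k0)" by simp
          \<comment> \<open>The quadratic term lowers the degree in v_(m+1) by two, the linear one
            by only one. A monomial M that interferes therefore has larger degree than N, so its
            coefficient is already known to be divisible by p.\<close>
          then have "lookup M (V k0) = lookup N (V k0) + 1"
            using nV by (simp add: lookup_add lookup_minus lookup_single k0')
          then have "M \<notin> Bad" using N(2)[of M] by auto
          then have "alpha w M k0 \<in> pZZ" using M by (simp add: Bad_def)
          then show ?thesis unfolding if_P[OF True] by (rule pZZs(5)[OF ZZ_of_int])
        qed (use pZZs(2) in simp)
      qed
      have "lookup (?F1 + v n ^ (?E - 1) * ?F2) (N - X k0) \<in> pZZ"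
      proof -
        obtain c where "c \<in> ZZ" "lookup (?F1 + v n ^ (?E - 1) * ?F2) (N - X k0) = of_nat p * c"
          using KB_lookup[OF G] KV_Em(2)[OF Em[OF Nk] _ k0] by blast
        then show ?thesis by (intro pmultI[of c]) auto
      qed
      from pZZs(7)[OF this S] have "alpha w N k0 \<in> pZZ" unfolding L add_diff_cancel_right' .
      then show False using N by (simp add: Bad_def)
    qed
  qed
qed

text \<open>Start from a power of p that clears all denominators and remove its factors one by
  one.\<close>

theorem coboundary_integrality:
  assumes w: "w \<in> EE UNIV" and z: "z \<in> RR ZZ 1" and d: "cobar_d p m 0 w - z \<in> II UNIV 1" and k: "k \<in> AA"
  shows "alpha w M k \<in> ZZ"
proof -
  have th: "theta w - w - z \<in> II UNIV 1"
  proof -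
    have "cobar_d p m 0 w = coface p m 0 w - w" using EE_RR[OF w, of 0] by (rule cobar_d_0)
    then have "theta w - w - z = (cobar_d p m 0 w - z) - (coface p m 0 w - theta w)" by simp
    moreover have "coface p m 0 w - theta w \<in> II UNIV 1" using cf0_theta[OF w] JJ_subset_II by blast
    ultimately show ?thesis using d ring_idealD(7)[OF II_UNIV RR_subring[OF subring_rat_UNIV]] by (simp only:)
  qed
  have "(\<forall>M. \<forall>k\<in>AA. of_nat p ^ K * alpha w M k \<in> ZZ) \<Longrightarrow> (\<forall>M. \<forall>k\<in>AA. alpha w M k \<in> ZZ)" for K
  proof (induction K)
    case (Suc K)
    have "of_nat p ^ K * alpha w M k \<in> ZZ" if k: "k \<in> AA" for M k
    proof -
      let ?w = "const (of_nat p ^ Suc K) * w"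
      have al: "alpha ?w M k = of_nat p ^ Suc K * alpha w M k" for M k by (simp add: alpha_def mult.assoc)
      have "alpha ?w M k \<in> pZZ"
      proof (rule key_step[OF _ _ _ _ _ k])
        show "?w \<in> EE UNIV" using w by (intro lpolys_const_mult) auto
        show "alpha ?w M k \<in> ZZ" if "k \<in> AA" for M k using Suc.prems that al by simp
        \<comment> \<open>Scaling by p^(K+1) makes the integral coboundary z divisible by p, as
          \<open>key_step\<close> requires.\<close>
        show "theta ?w - ?w = of_nat p * (const (of_nat p ^ K) * z) + const (of_nat p ^ Suc K) * (theta w - w - z)"
          unfolding th.hom_const_mult by (simp add: const_mult const_of_nat algebra_simps)
        show "const (of_nat p ^ K) * z \<in> RR ZZ 1"
          using z ZZ_mult_p_power[of 1 K] ZZs(2) by (intro lpolys_const_mult ZZ) auto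
        show "const (of_nat p ^ Suc K) * (theta w - w - z) \<in> II UNIV 1"
          by (rule ring_idealD(4)[OF II_UNIV RR_subring[OF subring_rat_UNIV] _ th]) (intro lpolys_const subring_rat_UNIV UNIV_I)
      qed
      then obtain c where c: "c \<in> ZZ" "alpha ?w M k = of_nat p ^ 1 * c" by (rule pmultE)
      then have "of_nat p * (of_nat p ^ K * alpha w M k) = of_nat p * c" unfolding al by simp
      then show ?thesis using c p0 by simp
    qed
    then show ?case using Suc.IH by blast
  qed simp
  moreover obtain K where "of_nat p ^ K * w \<in> EE ZZ" using lpolys_denominator[OF w] by blast
  then have K: "lookup (const (of_nat p ^ K) * w) M \<in> ZZ" for M
    using lpolys_lookup[OF ZZ] by (metis const_of_nat const_power)
  have "of_nat p ^ K * alpha w M k \<in> ZZ" for M k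
  proof -
    have "of_nat p ^ K * alpha w M k = lookup (const (of_nat p ^ K) * w) M * (of_nat p * of_int (lookup M (V k)))"
      by (simp add: alpha_def mult.assoc)
    also have "\<dots> \<in> ZZ" by (intro ZZs(4) K ZZ_of_int subring_rat_of_nat ZZ)
    finally show ?thesis .
  qed
  ultimately show ?thesis using k by blast
qed

end


section \<open>Presentations by generators of prescribed order\<close>

definition coset_class :: "'a::ab_group_add set \<Rightarrow> 'a \<Rightarrow> 'a set" where
  "coset_class B x = (\<lambda>b. b + x) ` B"

locale submodule_cosets =
  fixes A B :: "'a::comm_ring_1 set"
  assumes A: "subring A"
    and B: "0 \<in> B" "\<And>x z. x \<in> B \<Longrightarrow> z \<in> B \<Longrightarrow> x + z \<in> B" "\<And>a x. a \<in> A \<Longrightarrow> x \<in> B \<Longrightarrow> a * x \<in> B"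
begin

abbreviation "cls \<equiv> coset_class B"

lemma B_minus: "x \<in> B \<Longrightarrow> - x \<in> B"
  using B(3)[of "- 1" x] subringD[OF A] by simp

lemma B_diff: "x \<in> B \<Longrightarrow> z \<in> B \<Longrightarrow> x - z \<in> B"
  using B(2)[of x "- z"] B_minus[of z] by simp

lemma B_sum: "(\<And>i. i \<in> F \<Longrightarrow> f i \<in> B) \<Longrightarrow> sum f F \<in> B"
  by (induction F rule: infinite_finite_induct) (auto intro: B)

lemma cls_eq_iff: "cls x = cls z \<longleftrightarrow> x - z \<in> B"
proof
  assume "cls x = cls z"
  then have "0 + x \<in> cls z" using B(1) unfolding coset_class_def by blast
  then show "x - z \<in> B" by (auto simp: coset_class_def)
next
  assume d: "x - z \<in> B"
  have "b + x \<in> cls z" "b + z \<in> cls x" if "b \<in> B" for b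
  proof -
    have "b + x = (b + (x - z)) + z" "b + z = (b - (x - z)) + x" by simp_all
    then show "b + x \<in> cls z" "b + z \<in> cls x"
      unfolding coset_class_def using B(2)[OF that d] B_diff[OF that d] by blast+
  qed
  then show "cls x = cls z" unfolding coset_class_def by blast
qed

lemma cls_add: "{u + w | u w. u \<in> cls x \<and> w \<in> cls z} = cls (x + z)"
proof (intro equalityI subsetI)
  fix t assume "t \<in> {u + w | u w. u \<in> cls x \<and> w \<in> cls z}"
  then obtain b c where "t = (b + x) + (c + z)" "b \<in> B" "c \<in> B" by (auto simp: coset_class_def)
  then have "t = (b + c) + (x + z)" "b + c \<in> B" using B by (auto simp: algebra_simps)
  then show "t \<in> cls (x + z)" by (auto simp: coset_class_def)
next
  fix t assume "t \<in> cls (x + z)"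
  then obtain b where "t = b + (x + z)" "b \<in> B" by (auto simp: coset_class_def)
  then have "t = (b + x) + (0 + z)" "b + x \<in> cls x" "0 + z \<in> cls z" using B(1) by (auto simp: coset_class_def algebra_simps)
  then show "t \<in> {u + w | u w. u \<in> cls x \<and> w \<in> cls z}" by blast
qed

lemma cls_smult: "r \<in> A \<Longrightarrow> {b + r * u | b u. b \<in> B \<and> u \<in> cls x} = cls (r * x)"
proof (intro equalityI subsetI)
  fix t assume r: "r \<in> A" and "t \<in> {b + r * u | b u. b \<in> B \<and> u \<in> cls x}"
  then obtain b c where "t = b + r * (c + x)" "b \<in> B" "c \<in> B" by (auto simp: coset_class_def)
  then have "t = (b + r * c) + r * x" by (simp add: algebra_simps)
  moreover have "b + r * c \<in> B" using B r \<open>b \<in> B\<close> \<open>c \<in> B\<close> by blast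
  ultimately show "t \<in> cls (r * x)" by (auto simp: coset_class_def)
next
  fix t assume r: "r \<in> A" and "t \<in> cls (r * x)"
  then obtain b where "t = b + r * x" "b \<in> B" by (auto simp: coset_class_def)
  moreover have "x \<in> cls x" using B(1) by (force simp: coset_class_def)
  ultimately show "t \<in> {b + r * u | b u. b \<in> B \<and> u \<in> cls x}" by blast
qed

end

text \<open>\<open>Z\<close> and \<open>B\<close> play the roles of cocycles and coboundaries. By
  \<open>span\<close> the y_i generate the quotient; by \<open>rel\<close> the only relations are
  the diagonal ones q_i y_i = 0, which makes the quotient a direct sum of cyclic modules.\<close>

locale cyclic_presentation = submodule_cosets A B
  for A B :: "'a::comm_ring_1 set" +
  fixes Z :: "'a set" and I :: "'i set" and q :: "'i \<Rightarrow> 'a" and y :: "'i \<Rightarrow> 'a"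
    and M :: "('a, 'a set) module"
  assumes Z: "\<And>x z. x \<in> Z \<Longrightarrow> z \<in> Z \<Longrightarrow> x + z \<in> Z" "\<And>a x. a \<in> A \<Longrightarrow> x \<in> Z \<Longrightarrow> a * x \<in> Z" "0 \<in> Z"
    and q: "\<And>i. i \<in> I \<Longrightarrow> q i \<in> A" and y: "\<And>i. i \<in> I \<Longrightarrow> y i \<in> Z"
    and M: "carrier M = coset_class B ` Z" "add M = (\<lambda>Y W. {u + w | u w. u \<in> Y \<and> w \<in> W})"
      "module.smult M = (\<lambda>r Y. {b + r * u | b u. b \<in> B \<and> u \<in> Y})"
    and span: "\<And>z. z \<in> Z \<Longrightarrow> \<exists>F a. finite F \<and> F \<subseteq> I \<and> (\<forall>i\<in>F. a i \<in> A) \<and> z - (\<Sum>i\<in>F. a i * y i) \<in> B"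
    and rel: "\<And>F a. finite F \<Longrightarrow> F \<subseteq> I \<Longrightarrow> (\<forall>i\<in>F. a i \<in> A) \<Longrightarrow>
      (\<Sum>i\<in>F. a i * y i) \<in> B \<longleftrightarrow> (\<forall>i\<in>F. \<exists>c\<in>A. a i = c * q i)"
begin

abbreviation "R \<equiv> set_ring A"

definition J :: "'i \<Rightarrow> 'a set" where "J i = {c * q i | c. c \<in> A}"

lemma Z_sum: "(\<And>i. i \<in> F \<Longrightarrow> f i \<in> Z) \<Longrightarrow> sum f F \<in> Z"
  by (induction F rule: infinite_finite_induct) (auto intro: Z)

lemma PIdl_eq: "PIdl\<^bsub>R\<^esub> (q i) = J i"
  by (simp add: cgenideal_def J_def set_ring_def)

lemma J_ideal: "i \<in> I \<Longrightarrow> ring_ideal A (J i)"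
  unfolding ring_ideal_def J_def
proof (intro conjI ballI subsetI)
  assume i: "i \<in> I"
  note As = subringD[OF A]
  show "x \<in> A" if "x \<in> {c * q i | c. c \<in> A}" for x using that q[OF i] As by auto
  show "0 \<in> {c * q i | c. c \<in> A}" using As(1) by (intro CollectI exI[of _ 0]) simp
  show "x + z \<in> {c * q i | c. c \<in> A}" if "x \<in> {c * q i | c. c \<in> A}" "z \<in> {c * q i | c. c \<in> A}" for x z
  proof -
    from that obtain c d where "x = c * q i" "z = d * q i" "c \<in> A" "d \<in> A" by auto
    then show ?thesis using As(3)[of c d] by (intro CollectI exI[of _ "c + d"]) (simp add: ring_distribs)
  qed
  show "r * x \<in> {c * q i | c. c \<in> A}" if "r \<in> A" "x \<in> {c * q i | c. c \<in> A}" for r x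
  proof -
    from that obtain c where "x = c * q i" "c \<in> A" by auto
    then show ?thesis using As(4)[of r c] that by (intro CollectI exI[of _ "r * c"]) (simp add: mult.assoc)
  qed
qed

lemma J_ideal': "i \<in> I \<Longrightarrow> ideal (J i) R"
  using ideal_set_ring[OF A] J_ideal by blast

definition cos :: "'i \<Rightarrow> 'a \<Rightarrow> 'a set" where "cos i a = {j + a | j. j \<in> J i}"

lemma rcos_eq: "J i +>\<^bsub>R\<^esub> a = cos i a"
  by (auto simp: a_r_coset_def r_coset_def cos_def set_ring_def)

lemma cos_eq_iff:
  assumes i: "i \<in> I"
  shows "cos i a = cos i b \<longleftrightarrow> a - b \<in> J i"
proof -
  note Js = ring_idealD[OF J_ideal[OF i] A]
  show ?thesis
  proof
    assume "cos i a = cos i b"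
    then have "0 + a \<in> cos i b" using Js(2) unfolding cos_def by blast
    then show "a - b \<in> J i" by (auto simp: cos_def)
  next
    assume d: "a - b \<in> J i"
    have "j + a \<in> cos i b" "j + b \<in> cos i a" if "j \<in> J i" for j
    proof -
      have "j + a = (j + (a - b)) + b" "j + b = (j - (a - b)) + a" by simp_all
      then show "j + a \<in> cos i b" "j + b \<in> cos i a"
        unfolding cos_def using Js(3)[OF that d] Js(7)[OF that d] by blast+
    qed
    then show "cos i a = cos i b" unfolding cos_def by blast
  qed
qed

lemma cos_0: "cos i 0 = J i"
  by (simp add: cos_def)

lemma cos_self: "i \<in> I \<Longrightarrow> a \<in> cos i a"
  using ring_idealD(2)[OF J_ideal A, of i] by (force simp: cos_def)

lemma cos_mem: "i \<in> I \<Longrightarrow> b \<in> cos i a \<Longrightarrow> cos i a = cos i b"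
proof -
  assume i: "i \<in> I" and "b \<in> cos i a"
  then obtain j where "b = j + a" "j \<in> J i" by (auto simp: cos_def)
  then have "b - a \<in> J i" by simp
  then show "cos i a = cos i b" using cos_eq_iff[OF i] by metis
qed

lemma carrier_Quot: "carrier (R Quot J i) = cos i ` A"
proof -
  have "carrier R = A" by (simp add: set_ring_def)
  then show ?thesis
    unfolding FactRing_def A_RCOSETS_def RCOSETS_def partial_object.select_convs
      rcos_eq[unfolded a_r_coset_def] by blast
qed

lemma Quot_add:
  assumes i: "i \<in> I" and a: "a \<in> A" "b \<in> A"
  shows "cos i a \<oplus>\<^bsub>R Quot J i\<^esub> cos i b = cos i (a + b)"
proof -
  interpret ideal "J i" R by (rule J_ideal'[OF i])
  show ?thesis
    using a_rcos_sum[of a b] a by (simp add: FactRing_def rcos_eq) (simp add: set_ring_def)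
qed

lemma Quot_mult:
  assumes i: "i \<in> I" and a: "a \<in> A" "b \<in> A"
  shows "cos i a \<otimes>\<^bsub>R Quot J i\<^esub> cos i b = cos i (a * b)"
proof -
  interpret ideal "J i" R by (rule J_ideal'[OF i])
  show ?thesis
    using rcoset_mult_add[of a b] a by (simp add: FactRing_def rcos_eq) (simp add: set_ring_def)
qed

abbreviation "S \<equiv> cyclic_sum R I q"

definition supp :: "('i \<Rightarrow> 'a set) \<Rightarrow> 'i set" where "supp f = {i \<in> I. f i \<noteq> J i}"

lemma carrier_S: "f \<in> carrier S \<longleftrightarrow> f \<in> (\<Pi>\<^sub>E i\<in>I. cos i ` A) \<and> finite (supp f)"
proof -
  have "group (add_monoid (R Quot J i))" if "i \<in> I" for i
    using ideal.quotient_is_ring[OF J_ideal'[OF that]] by (intro abelian_group.a_group ring.is_abelian_group)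
  then show ?thesis
    unfolding cyclic_sum_def Let_def
    by (simp add: carrier_sum_group PIdl_eq carrier_Quot supp_def) (simp add: FactRing_def)
qed

lemma S_add: "f \<oplus>\<^bsub>S\<^esub> g = (\<lambda>i\<in>I. f i \<oplus>\<^bsub>R Quot J i\<^esub> g i)"
  by (simp add: cyclic_sum_def Let_def PIdl_eq)

lemma S_smult: "r \<odot>\<^bsub>S\<^esub> f = (\<lambda>i\<in>I. cos i r \<otimes>\<^bsub>R Quot J i\<^esub> f i)"
  by (simp add: cyclic_sum_def Let_def PIdl_eq rcos_eq)

definition rep :: "('i \<Rightarrow> 'a set) \<Rightarrow> 'i \<Rightarrow> 'a" where "rep f i = (SOME a. a \<in> A \<and> a \<in> f i)"

lemma rep:
  assumes "f \<in> carrier S" "i \<in> I"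
  shows "rep f i \<in> A" "f i = cos i (rep f i)"
proof -
  obtain a where a: "a \<in> A" "f i = cos i a" using assms by (auto simp: carrier_S PiE_def Pi_def)
  then have "\<exists>a. a \<in> A \<and> a \<in> f i" using cos_self[OF assms(2)] by blast
  from someI_ex[OF this] have "rep f i \<in> A" "rep f i \<in> f i" by (simp_all add: rep_def)
  then show "rep f i \<in> A" "f i = cos i (rep f i)" using a cos_mem[OF assms(2)] by auto
qed

definition hmap :: "('i \<Rightarrow> 'a set) \<Rightarrow> 'a set" where
  "hmap f = cls (\<Sum>i\<in>supp f. rep f i * y i)"

lemma J_y: "i \<in> I \<Longrightarrow> a \<in> J i \<Longrightarrow> a * y i \<in> B"
proof -
  assume i: "i \<in> I" and a: "a \<in> J i"
  have "a \<in> A" by (rule ring_idealD(1)[OF J_ideal[OF i] A a])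
  then show "a * y i \<in> B" using rel[of "{i}" "\<lambda>_. a"] i a unfolding J_def by simp blast
qed

text \<open>Independence of the chosen representatives, and freedom to enlarge the index set, so
  that two elements can be compared on the union of their supports.\<close>

lemma hmap_eq:
  assumes f: "f \<in> carrier S" and F: "finite F" "supp f \<subseteq> F" "F \<subseteq> I" and a: "\<And>i. i \<in> F \<Longrightarrow> f i = cos i (a i)"
  shows "hmap f = cls (\<Sum>i\<in>F. a i * y i)"
proof -
  have "(\<Sum>i\<in>supp f. rep f i * y i) = (\<Sum>i\<in>F. (if i \<in> supp f then rep f i else 0) * y i)"
    by (rule sum.mono_neutral_cong_left) (use F in auto)
  then have "(\<Sum>i\<in>supp f. rep f i * y i) - (\<Sum>i\<in>F. a i * y i) = (\<Sum>i\<in>F. ((if i \<in> supp f then rep f i else 0) - a i) * y i)"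
    by (simp add: sum_subtractf ring_distribs)
  also have "\<dots> \<in> B"
  proof (rule B_sum)
    fix i assume iF: "i \<in> F"
    then have i: "i \<in> I" using F by auto
    have "cos i (if i \<in> supp f then rep f i else 0) = cos i (a i)"
      using a[OF iF] rep[OF f i] i by (auto simp: supp_def cos_0)
    then show "((if i \<in> supp f then rep f i else 0) - a i) * y i \<in> B"
      by (intro J_y[OF i]) (simp only: cos_eq_iff[OF i])
  qed
  finally show ?thesis unfolding hmap_def cls_eq_iff .
qed

theorem presentation:
  "\<exists>h. h \<in> module_iso R S M \<and> (\<forall>e\<in>I. h (cyclic_gen R I q e) = cls (y e))"
proof (intro exI[of _ hmap] conjI ballI)
  note As = subringD[OF A]
  have S_I: "S_op \<in> carrier S" if "\<And>i. i \<in> I \<Longrightarrow> S_op i \<in> cos i ` A" "S_op \<in> extensional I" "supp S_op \<subseteq> F" "finite F" for S_op F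
    unfolding carrier_S using that finite_subset[of "supp S_op" F] by (auto simp: PiE_def)
  have val: "hmap f \<in> cls ` Z" if f: "f \<in> carrier S" for f
    unfolding hmap_def by (intro imageI Z_sum Z(2) rep[OF f] y) (auto simp: supp_def)
  have add: "hmap (f \<oplus>\<^bsub>S\<^esub> g) = hmap f \<oplus>\<^bsub>M\<^esub> hmap g" if f: "f \<in> carrier S" and g: "g \<in> carrier S" for f g
  proof -
    let ?F = "supp f \<union> supp g"
    have F: "finite ?F" "?F \<subseteq> I" using f g by (auto simp: carrier_S supp_def)
    have fg: "(f \<oplus>\<^bsub>S\<^esub> g) i = cos i (rep f i + rep g i)" if "i \<in> I" for i
      using rep[OF f that] rep[OF g that] Quot_add[OF that, of "rep f i" "rep g i"] that by (simp add: S_add)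
    have sup: "supp (f \<oplus>\<^bsub>S\<^esub> g) \<subseteq> ?F"
    proof
      fix i assume i: "i \<in> supp (f \<oplus>\<^bsub>S\<^esub> g)"
      then have iI: "i \<in> I" by (simp add: supp_def)
      show "i \<in> ?F"
      proof (rule ccontr)
        assume "i \<notin> ?F"
        then have fi: "f i = cos i 0" and gi: "g i = cos i 0" using iI by (auto simp: supp_def cos_0)
        have "(f \<oplus>\<^bsub>S\<^esub> g) i = cos i (0 + 0)"
          using Quot_add[OF iI As(1) As(1)] iI by (simp add: S_add fi gi)
        then show False using i by (simp add: supp_def cos_0)
      qed
    qed
    have "f \<oplus>\<^bsub>S\<^esub> g \<in> carrier S"
    proof (rule S_I[OF _ _ sup F(1)])
      show "(f \<oplus>\<^bsub>S\<^esub> g) i \<in> cos i ` A" if "i \<in> I" for i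
        using fg[OF that] rep[OF f that] rep[OF g that] As by auto
    qed (simp add: S_add)
    then have "hmap (f \<oplus>\<^bsub>S\<^esub> g) = cls (\<Sum>i\<in>?F. (rep f i + rep g i) * y i)"
      by (rule hmap_eq[OF _ F(1) sup F(2)]) (use fg F in auto)
    also have "\<dots> = cls ((\<Sum>i\<in>?F. rep f i * y i) + (\<Sum>i\<in>?F. rep g i * y i))"
      by (simp add: ring_distribs sum.distrib)
    also have "\<dots> = hmap f \<oplus>\<^bsub>M\<^esub> hmap g"
    proof -
      have "hmap f = cls (\<Sum>i\<in>?F. rep f i * y i)" by (rule hmap_eq[OF f F(1) _ F(2)]) (use rep[OF f] F in auto)
      moreover have "hmap g = cls (\<Sum>i\<in>?F. rep g i * y i)" by (rule hmap_eq[OF g F(1) _ F(2)]) (use rep[OF g] F in auto)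
      ultimately show ?thesis by (simp add: M(2) cls_add)
    qed
    finally show ?thesis .
  qed
  have smult: "hmap (r \<odot>\<^bsub>S\<^esub> f) = r \<odot>\<^bsub>M\<^esub> hmap f" if r: "r \<in> A" and f: "f \<in> carrier S" for r f
  proof -
    let ?F = "supp f"
    have F: "finite ?F" "?F \<subseteq> I" using f by (auto simp: carrier_S supp_def)
    have rf: "(r \<odot>\<^bsub>S\<^esub> f) i = cos i (r * rep f i)" if "i \<in> I" for i
      using rep[OF f that] Quot_mult[OF that r, of "rep f i"] that by (simp add: S_smult)
    have sup: "supp (r \<odot>\<^bsub>S\<^esub> f) \<subseteq> ?F"
    proof
      fix i assume i: "i \<in> supp (r \<odot>\<^bsub>S\<^esub> f)"
      then have iI: "i \<in> I" by (simp add: supp_def)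
      show "i \<in> ?F"
      proof (rule ccontr)
        assume "i \<notin> ?F"
        then have fi: "f i = cos i 0" using iI by (auto simp: supp_def cos_0)
        have "(r \<odot>\<^bsub>S\<^esub> f) i = cos i (r * 0)"
          using Quot_mult[OF iI r As(1)] iI by (simp add: S_smult fi)
        then show False using i by (simp add: supp_def cos_0)
      qed
    qed
    have "r \<odot>\<^bsub>S\<^esub> f \<in> carrier S"
    proof (rule S_I[OF _ _ sup F(1)])
      show "(r \<odot>\<^bsub>S\<^esub> f) i \<in> cos i ` A" if "i \<in> I" for i
        using rf[OF that] rep[OF f that] r As by auto
    qed (simp add: S_smult)
    then have "hmap (r \<odot>\<^bsub>S\<^esub> f) = cls (\<Sum>i\<in>?F. (r * rep f i) * y i)"
      by (rule hmap_eq[OF _ F(1) sup F(2)]) (use rf F in auto)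
    also have "\<dots> = cls (r * (\<Sum>i\<in>?F. rep f i * y i))"
      by (simp add: sum_distrib_left mult.assoc)
    also have "\<dots> = r \<odot>\<^bsub>M\<^esub> hmap f"
      using r by (simp add: M(3) cls_smult hmap_def)
    finally show ?thesis .
  qed
  have inj: "inj_on hmap (carrier S)"
  proof (rule inj_onI)
    fix f g assume f: "f \<in> carrier S" and g: "g \<in> carrier S" and eq: "hmap f = hmap g"
    let ?F = "supp f \<union> supp g"
    have F: "finite ?F" "?F \<subseteq> I" using f g by (auto simp: carrier_S supp_def)
    have "hmap f = cls (\<Sum>i\<in>?F. rep f i * y i)" by (rule hmap_eq[OF f F(1) _ F(2)]) (use rep[OF f] F in auto)
    moreover have "hmap g = cls (\<Sum>i\<in>?F. rep g i * y i)" by (rule hmap_eq[OF g F(1) _ F(2)]) (use rep[OF g] F in auto)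
    ultimately have "cls (\<Sum>i\<in>?F. rep f i * y i) = cls (\<Sum>i\<in>?F. rep g i * y i)" using eq by simp
    then have "(\<Sum>i\<in>?F. rep f i * y i) - (\<Sum>i\<in>?F. rep g i * y i) \<in> B" by (simp only: cls_eq_iff)
    then have "(\<Sum>i\<in>?F. (rep f i - rep g i) * y i) \<in> B" by (simp add: ring_distribs sum_subtractf)
    then have "\<forall>i\<in>?F. \<exists>c\<in>A. rep f i - rep g i = c * q i"
      by (subst (asm) rel) (use F rep[OF f] rep[OF g] As in auto)
    then have J: "rep f i - rep g i \<in> J i" if "i \<in> ?F" for i using that unfolding J_def by blast
    have on: "f i = g i" if "i \<in> ?F" for i
    proof -
      have i: "i \<in> I" using that F by blast
      have "cos i (rep f i) = cos i (rep g i)" unfolding cos_eq_iff[OF i] by (rule J[OF that])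
      then show ?thesis using rep(2)[OF f i] rep(2)[OF g i] by simp
    qed
    show "f = g"
    proof (rule ext)
      fix i
      consider "i \<in> ?F" | "i \<in> I" "i \<notin> ?F" | "i \<notin> I" by blast
      then show "f i = g i"
      proof cases
        case 2
        then show ?thesis by (auto simp: supp_def)
      next
        case 3
        then show ?thesis using f g by (auto simp: carrier_S PiE_def extensional_def)
      qed (rule on)
    qed
  qed
  have surj: "cls z \<in> hmap ` carrier S" if z: "z \<in> Z" for z
  proof -
    obtain F a where Fa: "finite F" "F \<subseteq> I" "\<forall>i\<in>F. a i \<in> A" "z - (\<Sum>i\<in>F. a i * y i) \<in> B"
      using span[OF z] by blast
    let ?f = "\<lambda>i\<in>I. cos i (if i \<in> F then a i else 0)"
    have sup: "supp ?f \<subseteq> F" by (auto simp: supp_def cos_0 split: if_splits)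
    have f: "?f \<in> carrier S" by (rule S_I[OF _ _ sup Fa(1)]) (use Fa As in auto)
    have "hmap ?f = cls (\<Sum>i\<in>F. a i * y i)"
      by (rule hmap_eq[OF f Fa(1) sup Fa(2)]) (use Fa in auto)
    moreover have "cls z = cls (\<Sum>i\<in>F. a i * y i)" using Fa(4) cls_eq_iff by blast
    ultimately have "cls z = hmap ?f" by (simp only:)
    then show ?thesis using f by (rule image_eqI)
  qed
  have "hmap ` carrier S = carrier M"
    unfolding M(1) using val surj by blast
  then show "hmap \<in> module_iso R S M"
    unfolding module_iso_def bij_betw_def using inj add smult by (auto simp: set_ring_def)
  fix e assume e: "e \<in> I"
  have g: "cyclic_gen R I q e = (\<lambda>j\<in>I. cos j (if j = e then 1 else 0))"
    unfolding cyclic_gen_def PIdl_eq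
  proof (intro restrict_ext)
    have "\<one>\<^bsub>R\<^esub> = 1" by (simp add: set_ring_def)
    then show "(if j = e then \<one>\<^bsub>R Quot J j\<^esub> else \<zero>\<^bsub>R Quot J j\<^esub>) = cos j (if j = e then 1 else 0)" for j
      by (simp add: FactRing_def rcos_eq cos_0)
  qed
  have sup: "supp (cyclic_gen R I q e) \<subseteq> {e}" by (auto simp: supp_def g cos_0 split: if_splits)
  have "cyclic_gen R I q e \<in> carrier S" by (rule S_I[OF _ _ sup]) (use As in \<open>auto simp: g\<close>)
  then have "hmap (cyclic_gen R I q e) = cls (\<Sum>i\<in>{e}. 1 * y i)"
    by (rule hmap_eq[OF _ _ sup]) (use e in \<open>auto simp: g\<close>)
  then show "hmap (cyclic_gen R I q e) = cls (y e)" by simp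
qed

end


section \<open>The generators\<close>

lemma lookup_mult_single: "lookup (P * single e c) N = lookup P (N - e) * c" for P :: lpoly
proof -
  have "P * single e c = (\<Sum>M\<in>keys P. single (M + e) (lookup P M * c))"
    by (subst (1) poly_mapping_sum_single[of P]) (simp add: sum_distrib_right mult_single)
  then have "lookup (P * single e c) N = (\<Sum>M\<in>keys P. lookup (single (M + e) (lookup P M * c)) N)"
    by (simp only: lookup_sum)
  also have "\<dots> = (\<Sum>M\<in>keys P. if M = N - e then lookup P (N - e) * c else 0)"
  proof (intro sum.cong refl)
    show "lookup (single (M + e) (lookup P M * c)) N = (if M = N - e then lookup P (N - e) * c else 0)" for M
      by (cases "M = N - e") (auto simp: lookup_single when_def)
  qed
  finally have "lookup (P * single e c) N = (\<Sum>M\<in>keys P. if M = N - e then lookup P (N - e) * c else 0)" .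
  then show ?thesis by (auto simp: in_keys_iff)
qed

context hopf_data
begin

definition min_nu :: "(nat \<Rightarrow> nat) \<Rightarrow> nat" where
  "min_nu e = the_enat (Min ((\<lambda>i. nu p (e i)) ` {1..n}))"

text \<open>Some e_i is nonzero, so the minimum is finite and attained at a nonzero entry; zero
  entries are divisible by every power.\<close>

lemma min_nu:
  assumes e: "e \<in> exps n"
  shows "i \<in> {1..n} \<Longrightarrow> p ^ min_nu e dvd e i" "\<exists>i\<in>{1..n}. \<not> p ^ Suc (min_nu e) dvd e i"
proof -
  let ?S = "(\<lambda>i. nu p (e i)) ` {1..n}"
  obtain i0 where i0: "i0 \<in> {1..n}" "e i0 \<noteq> 0" using e by (auto simp: exps_def)
  have S: "finite ?S" "?S \<noteq> {}" using i0 by auto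
  have "Min ?S \<le> nu p (e i0)" using i0 by (intro Min_le) auto
  then have fin: "Min ?S = enat (min_nu e)"
    using i0 by (cases "Min ?S") (auto simp: min_nu_def nu_def)
  show "p ^ min_nu e dvd e i" if i: "i \<in> {1..n}"
  proof (cases "e i = 0")
    case False
    have "enat (min_nu e) \<le> nu p (e i)" unfolding fin[symmetric] using i S by (intro Min_le) auto
    then have "min_nu e \<le> multiplicity p (e i)" using False by (simp add: nu_def)
    then show ?thesis by (rule multiplicity_dvd')
  qed simp
  obtain i where i: "i \<in> {1..n}" "nu p (e i) = enat (min_nu e)" using Min_in[OF S] fin by auto
  then have "e i \<noteq> 0" "multiplicity p (e i) = min_nu e" by (auto simp: nu_def split: if_splits)
  then have "\<not> p ^ Suc (min_nu e) dvd e i"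
    using multiplicity_geI[of "e i" p "Suc (min_nu e)"] p not_prime_unit by auto
  then show "\<exists>i\<in>{1..n}. \<not> p ^ Suc (min_nu e) dvd e i" using i by blast
qed

abbreviation qq :: "(nat \<Rightarrow> nat) \<Rightarrow> nat" where "qq \<equiv> gen_order p n"

lemma qq_eq: "qq e = p ^ Suc (min_nu e)"
  by (simp add: gen_order_def min_nu_def power_add)

lemma qq_pos: "0 < qq e"
  using p0 by (simp add: qq_eq)

lemma qq_integral: "e \<in> exps n \<Longrightarrow> i \<in> {1..n} \<Longrightarrow> 1 / of_nat (qq e) * of_nat p * of_nat (e i) \<in> ZZ"
proof -
  assume "e \<in> exps n" "i \<in> {1..n}"
  then obtain u where u: "e i = p ^ min_nu e * u" using min_nu(1) by blast
  have "1 / of_nat (qq e) * of_nat p * of_nat (e i) = (of_nat u :: rat)"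
    using p0 by (simp add: qq_eq u)
  then show ?thesis by (simp add: subring_rat_of_nat)
qed

text \<open>At an index that attains the minimum, e_i is p^min times a unit u of Z_(p), and dividing
  \<open>p e_i c\<close> by u gives the claim.\<close>

lemma qq_denominator:
  assumes e: "e \<in> exps n" and c: "\<And>i. i \<in> {1..n} \<Longrightarrow> c * of_nat p * of_nat (e i) \<in> ZZ"
  shows "of_nat (qq e) * c \<in> ZZ"
proof -
  obtain i where i: "i \<in> {1..n}" "\<not> p ^ Suc (min_nu e) dvd e i" using min_nu(2)[OF e] by blast
  then obtain u where u: "e i = p ^ min_nu e * u" using min_nu(1)[OF e] by blast
  have "\<not> p dvd u" using i(2) unfolding u by (auto simp: mult.commute)
  then have nd: "\<not> int p dvd int u" by simp
  then have inv: "1 / of_nat u \<in> ZZ"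
  proof -
    have "1 / of_nat u = of_int 1 / (of_int (int u) :: rat)" by simp
    then show ?thesis unfolding Zloc_def using nd by blast
  qed
  have "u \<noteq> 0" using nd by (cases u) auto
  then have "of_nat (qq e) * c = c * of_nat p * of_nat (e i) * (1 / of_nat u)"
    by (simp add: qq_eq u)
  then show ?thesis using ZZs(4)[OF c[OF i(1)] inv] by simp
qed

definition emon :: "(nat \<Rightarrow> nat) \<Rightarrow> gen \<Rightarrow>\<^sub>0 int" where
  "emon e = (\<Sum>i\<in>{1..n}. single (V (m + i)) (int (e i)))"

lemma lookup_emon: "lookup (emon e) (V k) = (if k \<in> AA then int (e (k - m)) else 0)" "lookup (emon e) (T i k) = 0"
proof -
  have "lookup (emon e) (V k) = (\<Sum>i\<in>{1..n}. if i = k - m then if k \<in> AA then int (e (k - m)) else 0 else 0)"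
    unfolding emon_def lookup_sum by (intro sum.cong refl) (auto simp: lookup_single when_def)
  also have "\<dots> = (if k \<in> AA then int (e (k - m)) else 0)" by auto
  finally show "lookup (emon e) (V k) = (if k \<in> AA then int (e (k - m)) else 0)" .
  show "lookup (emon e) (T i k) = 0" unfolding emon_def lookup_sum by (simp add: lookup_single)
qed

lemma emon_Em: "emon e \<in> Em"
  unfolding Em_def
proof (intro CollectI conjI allI impI)
  fix x
  show "lookup (emon e) x \<noteq> 0 \<Longrightarrow> x \<in> V ` {n..m + n}"
    using nm by (cases x) (auto simp: lookup_emon split: if_splits)
  show "lookup (emon e) x < 0 \<Longrightarrow> x = V n"
    by (cases x) (auto simp: lookup_emon split: if_splits)
qed

abbreviation frac :: "(nat \<Rightarrow> nat) \<Rightarrow> lpoly" where "frac \<equiv> fraction p n m"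

lemma frac_eq: "frac e = single (emon e) (1 / of_nat (qq e))"
proof -
  have "finite I \<Longrightarrow> (\<Prod>i\<in>I. single (h i) 1) = single (\<Sum>i\<in>I. h i) (1::rat)" for h :: "nat \<Rightarrow> gen \<Rightarrow>\<^sub>0 int" and I
    by (induction I rule: finite_induct) (auto simp: mult_single)
  then show ?thesis by (simp add: fraction_def gvar_power_single emon_def)
qed

abbreviation AR :: "lpoly set" where "AR \<equiv> lpolys ZZ (V ` {n..m}) {V n}"

lemma Rnm_eq: "Rnm p n m = set_ring AR"
  by (simp add: Rnm_def)

lemma AR_RR: "x \<in> lpolys C (V ` {n..m}) {V n} \<Longrightarrow> x \<in> RR C s"
  using n1 by (elim lpolys_mono) (auto simp: allgens_def)

lemma AR_subring: "subring AR"
  by (rule subring_lpolys[OF ZZ])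

lemma single_EE: "M \<in> Em \<Longrightarrow> single M c \<in> EE UNIV"
  by (rule lpolys_single) (auto simp: Em_def)

lemma frac_EE: "frac e \<in> EE UNIV"
  unfolding frac_eq by (intro single_EE emon_Em)

text \<open>An integral cocycle for the image of the fraction under the connecting homomorphism. The
  coboundary of the fraction itself is integral only up to rational multiples of J_n, hence the use
  of \<open>theta\<close>.\<close>

definition yy :: "(nat \<Rightarrow> nat) \<Rightarrow> lpoly" where "yy e = theta (frac e) - frac e"

lemma yy_RR: "e \<in> exps n \<Longrightarrow> yy e \<in> RR ZZ 1"
  unfolding yy_def frac_eq
proof (rule theta_integral[OF emon_Em])
  fix k assume e: "e \<in> exps n" and k: "k \<in> AA"
  then have "k - m \<in> {1..n}" by auto
  from qq_integral[OF e this] show "1 / of_nat (qq e) * of_nat p * of_int (lookup (emon e) (V k)) \<in> ZZ"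
    using k by (simp add: lookup_emon)
qed

lemma frac_yy: "cobar_d p m 0 (frac e) - yy e \<in> JJ UNIV 1"
  using cf0_theta[OF frac_EE, of e] cobar_d_0[OF EE_RR[OF frac_EE], of e] by (simp add: yy_def)

lemmas RRq = RR_subring[OF subring_rat_UNIV]
lemmas IIq = ring_idealD[OF II_UNIV RRq]
lemmas IIz = ring_idealD[OF II_ideal[OF order_refl ZZ] RR_subring[OF ZZ]]

lemma II_le: "II ZZ s \<subseteq> II UNIV s"
  by (rule II_mono) auto

lemma frac_yy_II: "cobar_d p m 0 (frac e) - yy e \<in> II UNIV 1"
  using frac_yy JJ_subset_II by blast

lemma JJ_integral:
  assumes "x \<in> JJ UNIV s" "x \<in> RR ZZ s"
  shows "x \<in> II ZZ s"
proof -
  let ?K = "V ` {1..<n}"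
  have K: "v ` {1..<n} = gvar ` (?K \<inter> allgens m s)" "?K \<inter> {V n} = {}" by (auto simp: allgens_def)
  have "x \<in> ispan (RR ZZ s) (gvar ` (?K \<inter> allgens m s))"
    by (rule ispan_gvar_integral[OF _ K(2) ZZ assms(2)]) (use assms(1) in \<open>simp add: JJ_def K(1)\<close>)
  then show ?thesis using JJ_subset_II[of ZZ s] by (auto simp: JJ_def K(1))
qed

text \<open>The coboundary of \<open>frac e\<close> is \<open>yy e\<close> up to \<open>J\<^sub>n\<close>, so \<open>d d = 0\<close> puts \<open>d (yy e)\<close> into the rational
  ideal \<open>J\<^sub>n\<close>, whose integral elements are known.\<close>

lemma cobar_d_yy: "e \<in> exps n \<Longrightarrow> cobar_d p m 1 (yy e) \<in> II ZZ 2"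
proof -
  assume e: "e \<in> exps n"
  have "cobar_d p m 1 (cobar_d p m 0 (frac e) - yy e) \<in> JJ UNIV (Suc 1)"
    by (rule cobar_d_JJ[OF _ _ _ frac_yy]) auto
  moreover have "cobar_d p m 1 (cobar_d p m 0 (frac e) - yy e) = - cobar_d p m 1 (yy e)"
    using cobar_d_d[OF EE_RR[OF frac_EE]] by (simp add: cobar_d_diff)
  ultimately have "- cobar_d p m 1 (yy e) \<in> JJ UNIV 2" by simp
  then have "- (- cobar_d p m 1 (yy e)) \<in> JJ UNIV 2" by (rule ring_idealD(6)[OF JJ_ideal[OF subring_rat_UNIV] RRq])
  moreover have "cobar_d p m 1 (yy e) \<in> RR ZZ 2" using cobar_d_RR[of ZZ 1 "yy e"] yy_RR[OF e] by simp
  ultimately show ?thesis by (intro JJ_integral) simp_all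
qed

lemma II_0: "II C 0 = ispan (RR C 0) (gvar ` (KV \<inter> allgens m 0))"
proof -
  have "rels 0 = gvar ` KV"
  proof
    show "rels 0 \<subseteq> gvar ` KV" using p0 by (auto simp: rels_def KV_def eta_v_zero)
    show "gvar ` KV \<subseteq> rels 0"
    proof (rule image_subsetI)
      fix g assume "g \<in> KV"
      then obtain k where k: "g = V k" "k \<in> {1..<n} \<or> n + m < k" unfolding KV_def by blast
      show "gvar g \<in> rels 0"
      proof (cases "n + m < k")
        case True
        then have "gvar g = eta_v p m 0 k" using k p0 by (simp add: eta_v_zero)
        then show ?thesis using True unfolding rels_def by blast
      qed (use k in \<open>auto simp: rels_def\<close>)
    qed
  qed
  then show ?thesis using KV_kill by (simp add: II_def)
qed

lemma kill_II_0: "x \<in> II C 0 \<Longrightarrow> subring_rat C \<Longrightarrow> kill KV x = 0"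
  unfolding II_0 by (rule kill_ispan[OF _ KV_kill(1)])

lemma diff_kill_II_0: "x \<in> RR UNIV 0 \<Longrightarrow> x - kill KV x \<in> II UNIV 0"
  unfolding II_0 by (rule diff_kill_mem_ispan[OF subring_rat_UNIV _ KV_kill(1)])

lemma kill_EE: "x \<in> RR C 0 \<Longrightarrow> kill KV x \<in> EE C"
proof -
  assume "x \<in> RR C 0"
  from kill_mem[OF this KV_kill(1)] show ?thesis
  proof (rule lpolys_mono)
    show "allgens m 0 - KV \<subseteq> V ` {n..m + n}"
    proof
      fix g assume g: "g \<in> allgens m 0 - KV"
      then obtain k where k: "g = V k" "1 \<le> k" by (auto simp: allgens_def)
      have "k \<notin> {1..<n}" "k \<notin> {n + m<..}" using g k by (auto simp: KV_def)
      then show "g \<in> V ` {n..m + n}" using k by auto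
    qed
  qed auto
qed

abbreviation kx :: "lpoly \<Rightarrow> lpoly" where "kx \<equiv> kill {V k | k. m < k}"

lemma kx_disj: "{V k | k. m < k} \<inter> {V n} = {}"
  using nm by auto

text \<open>By \<open>rational_H0\<close> a rational 0-cocycle agrees with its part in v_1, ..., v_m
  modulo the killed variables, and M contains a later v but no killed variable.\<close>

lemma rational_cocycle_lookup:
  assumes W: "W \<in> RR UNIV 0" and d: "cobar_d p m 0 W \<in> II UNIV 1"
    and M: "M \<in> Em" "k \<in> AA" "lookup M (V k) \<noteq> 0"
  shows "lookup W M = 0"
proof -
  have kW: "kx W \<in> RR UNIV 0" by (rule lpolys_mono[OF kill_mem[OF W kx_disj]]) auto
  have R: "kx W - W \<in> RR UNIV 0" using kW W by (intro lpolys_diff) auto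
  have "kill KV (kx W - W) = 0" using rational_H0[OF W d] by (rule kill_II_0) simp
  then have "lookup (kx W - W) M = 0"
    using lookup_kill[OF R KV_kill(1), of M] KV_Em(1)[OF M(1) _ M(2)] by auto
  moreover have "lookup (kx W) M = 0"
    using lookup_kill[OF W kx_disj, of M] M(2,3) by fastforce
  ultimately show ?thesis by (simp add: lookup_minus)
qed

lemma cobar_d_AR: "r \<in> lpolys C (V ` {n..m}) {V n} \<Longrightarrow> x \<in> RR C' s' \<Longrightarrow> cobar_d p m s (r * x) = r * cobar_d p m s x"
proof (rule cobar_d_linear)
  assume "r \<in> lpolys C (V ` {n..m}) {V n}"
  then show "r \<in> lpolys C (V ` {1..m}) {V n}" using n1 by (elim lpolys_mono) auto
qed (rule lpolys_UNIV)

lemma cobar_d_AR_0: "r \<in> lpolys C (V ` {n..m}) {V n} \<Longrightarrow> cobar_d p m 0 r = 0"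
  using cobar_d_AR[of r C 1 UNIV 0 0] cobar_d_0[of 1 UNIV] by (simp add: lpolys_1)


section \<open>The cohomology groups\<close>

definition ZC :: "lpoly set" where "ZC = {x \<in> RR ZZ 1. cobar_d p m 1 x \<in> II ZZ 2}"
definition BC :: "lpoly set" where "BC = {b + cobar_d p m 0 x | b x. b \<in> II ZZ 1 \<and> x \<in> RR ZZ 0}"

lemma BC_I: "b \<in> II ZZ 1 \<Longrightarrow> x \<in> RR ZZ 0 \<Longrightarrow> b + cobar_d p m 0 x \<in> BC"
  by (auto simp: BC_def)

lemma II_BC: "b \<in> II ZZ 1 \<Longrightarrow> b \<in> BC"
proof -
  assume b: "b \<in> II ZZ 1"
  have "(0::lpoly) \<in> RR ZZ 0" by (rule lpolys_0[OF ZZ])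
  from BC_I[OF b this] show ?thesis using cobar_d_diff[of 0 0 0] by simp
qed

lemma BC_add: "x \<in> BC \<Longrightarrow> z \<in> BC \<Longrightarrow> x + z \<in> BC"
proof -
  assume "x \<in> BC" "z \<in> BC"
  then obtain b u c w where "x = b + cobar_d p m 0 u" "z = c + cobar_d p m 0 w" and
    m: "b \<in> II ZZ 1" "c \<in> II ZZ 1" "u \<in> RR ZZ 0" "w \<in> RR ZZ 0" unfolding BC_def by blast
  then have "x + z = (b + c) + cobar_d p m 0 (u + w)" by (simp add: cobar_d_add)
  then show ?thesis using BC_I[OF IIz(3)[OF m(1,2)] lpolys_add[OF ZZ m(3,4)]] by simp
qed

lemma BC_mult: "a \<in> AR \<Longrightarrow> x \<in> BC \<Longrightarrow> a * x \<in> BC"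
proof -
  assume a: "a \<in> AR" and "x \<in> BC"
  then obtain b u where "x = b + cobar_d p m 0 u" and m: "b \<in> II ZZ 1" "u \<in> RR ZZ 0" unfolding BC_def by blast
  then have "a * x = a * b + cobar_d p m 0 (a * u)" using cobar_d_AR[OF a m(2)] by (simp add: ring_distribs)
  then show ?thesis using BC_I[OF IIz(4)[OF AR_RR[OF a] m(1)] lpolys_mult[OF ZZ AR_RR[OF a] m(2)]] by simp
qed

lemma BC_sum: "(\<And>i. i \<in> F \<Longrightarrow> f i \<in> BC) \<Longrightarrow> sum f F \<in> BC"
  by (induction F rule: infinite_finite_induct) (auto intro: BC_add II_BC IIz(2))

lemma d_sum_frac:
  assumes a: "\<And>e. e \<in> F \<Longrightarrow> a e \<in> AR"
  shows "cobar_d p m 0 (\<Sum>e\<in>F. a e * frac e) - (\<Sum>e\<in>F. a e * yy e) \<in> II UNIV 1"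
proof -
  have "cobar_d p m 0 (\<Sum>e\<in>F. a e * frac e) - (\<Sum>e\<in>F. a e * yy e) = (\<Sum>e\<in>F. a e * (cobar_d p m 0 (frac e) - yy e))"
    unfolding cobar_d_sum sum_subtractf[symmetric]
    by (intro sum.cong refl) (simp add: cobar_d_AR[OF a EE_RR[OF frac_EE]] ring_distribs)
  also have "\<dots> \<in> II UNIV 1"
    by (intro ring_ideal_sum[OF II_UNIV] IIq(4)[OF _ frac_yy_II] RR_UNIV[OF AR_RR[of _ ZZ]] a)
  finally show ?thesis .
qed

text \<open>\<open>qq e\<close> times the fraction is the integral monomial x^e, whose coboundary is
  an integral coboundary.\<close>

lemma qq_yy: "e \<in> exps n \<Longrightarrow> of_nat (qq e) * yy e \<in> BC"
proof -
  assume e: "e \<in> exps n"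
  have xe: "single (emon e) 1 \<in> RR ZZ 0"
    using emon_Em[of e] n1 by (intro lpolys_single ZZ ZZs(2)) (auto simp: Em_def allgens_def)
  have "of_nat (qq e) * frac e = single (emon e) 1"
    using qq_pos[of e] by (simp add: frac_eq flip: const_of_nat)
  moreover have qA: "of_nat (qq e) \<in> AR" by (intro lpolys_of_nat ZZ)
  ultimately have "cobar_d p m 0 (single (emon e) 1) = of_nat (qq e) * cobar_d p m 0 (frac e)"
    using cobar_d_AR[OF qA EE_RR[OF frac_EE]] by metis
  then have "of_nat (qq e) * yy e - cobar_d p m 0 (single (emon e) 1) = - (of_nat (qq e) * (cobar_d p m 0 (frac e) - yy e))"
    by (simp add: ring_distribs)
  moreover have "\<dots> \<in> II UNIV 1" by (intro IIq(6) IIq(4) frac_yy_II RR_UNIV[OF AR_RR[OF qA]])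
  moreover have "of_nat (qq e) * yy e - cobar_d p m 0 (single (emon e) 1) \<in> RR ZZ 1"
    using cobar_d_RR[of ZZ 0, OF order_refl ZZ _ xe] yy_RR[OF e] by (intro lpolys_diff lpolys_mult lpolys_of_nat ZZ) simp_all
  ultimately have "of_nat (qq e) * yy e - cobar_d p m 0 (single (emon e) 1) \<in> II ZZ 1"
    by (intro II_saturated) simp_all
  from BC_I[OF this xe] show ?thesis by simp
qed

text \<open>If the combination of the \<open>yy e\<close> is the coboundary of an integral x, then
  the same combination of fractions minus x is a rational 0-cocycle. Its coefficients at monomials
  involving v_(m+1), ..., v_(m+n) vanish, so those of a_e / \<open>qq e\<close> are coefficients of
  x.\<close>

lemma relations:
  assumes F: "finite F" "F \<subseteq> exps n" and a: "\<forall>e\<in>F. a e \<in> AR"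
  shows "(\<Sum>e\<in>F. a e * yy e) \<in> BC \<longleftrightarrow> (\<forall>e\<in>F. \<exists>c\<in>AR. a e = c * of_nat (qq e))"
proof
  assume r: "\<forall>e\<in>F. \<exists>c\<in>AR. a e = c * of_nat (qq e)"
  show "(\<Sum>e\<in>F. a e * yy e) \<in> BC"
  proof (rule BC_sum)
    fix e assume e: "e \<in> F"
    then obtain c where c: "c \<in> AR" "a e = c * of_nat (qq e)" using r by blast
    have "c * (of_nat (qq e) * yy e) \<in> BC" using e F by (intro BC_mult[OF c(1)] qq_yy) auto
    then show "a e * yy e \<in> BC" by (simp add: c(2) mult.assoc)
  qed
next
  assume "(\<Sum>e\<in>F. a e * yy e) \<in> BC"
  then obtain b x where bx: "(\<Sum>e\<in>F. a e * yy e) = b + cobar_d p m 0 x" "b \<in> II ZZ 1" "x \<in> RR ZZ 0" unfolding BC_def by blast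
  let ?W = "(\<Sum>e\<in>F. a e * frac e) - x"
  have WR: "?W \<in> RR UNIV 0"
    using a by (intro lpolys_diff lpolys_sum lpolys_mult subring_rat_UNIV RR_UNIV[OF AR_RR] EE_RR[OF frac_EE] RR_UNIV[OF bx(3)]) auto
  have "cobar_d p m 0 ?W = (cobar_d p m 0 (\<Sum>e\<in>F. a e * frac e) - (\<Sum>e\<in>F. a e * yy e)) + b"
    by (simp add: cobar_d_diff bx(1))
  then have dW: "cobar_d p m 0 ?W \<in> II UNIV 1"
    using IIq(3)[OF d_sum_frac[of F a]] a bx(2) II_le by auto
  show "\<forall>e\<in>F. \<exists>c\<in>AR. a e = c * of_nat (qq e)"
  proof
    fix e assume e: "e \<in> F"
    then have ee: "e \<in> exps n" and ae: "a e \<in> AR" using F a by auto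
    have "const (1 / of_nat (qq e)) * a e \<in> AR"
    proof (rule lpolysI)
      fix M assume M: "M \<in> keys (const (1 / of_nat (qq e)) * a e)"
      then have Mk: "lookup (a e) M \<noteq> 0" by (auto simp: in_keys_iff)
      show MV: "x \<in> V ` {n..m}" if "lookup M x \<noteq> 0" for x by (rule lpolysD(2)[OF ae Mk that])
      show MU: "x \<in> {V n}" if "lookup M x < 0" for x by (rule lpolysD(3)[OF ae Mk that])
      have M0: "lookup M (V k) = 0" if "k \<in> AA" for k using MV[of "V k"] that by (auto simp: image_iff)
      \<comment> \<open>Here e is not zero, so this monomial involves some v_(m+i), as
        \<open>rational_cocycle_lookup\<close> requires.\<close>
      let ?N = "M + emon e"
      have NE: "?N \<in> Em"
        unfolding Em_def
      proof (intro CollectI conjI allI impI)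
        fix x
        show "x \<in> V ` {n..m + n}" if "lookup ?N x \<noteq> 0"
        proof -
          have "lookup M x \<noteq> 0 \<or> lookup (emon e) x \<noteq> 0" using that by (auto simp: lookup_add)
          then show ?thesis using MV[of x] emon_Em[of e] unfolding Em_def by auto
        qed
        show "x = V n" if "lookup ?N x < 0"
        proof -
          have "lookup M x < 0 \<or> lookup (emon e) x < 0" using that by (auto simp: lookup_add)
          then show ?thesis using MU[of x] emon_Em[of e] unfolding Em_def by auto
        qed
      qed
      obtain i where i: "i \<in> {1..n}" "e i \<noteq> 0" using ee by (auto simp: exps_def)
      then have iA: "m + i \<in> AA" by auto
      then have "lookup ?N (V (m + i)) \<noteq> 0" using i M0[OF iA] by (simp add: lookup_add lookup_emon)
      from rational_cocycle_lookup[OF WR dW NE iA this]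
      have "lookup (\<Sum>e\<in>F. a e * frac e) ?N = lookup x ?N" by (simp add: lookup_minus)
      moreover have "lookup (\<Sum>e\<in>F. a e * frac e) ?N = (\<Sum>e'\<in>F. if e' = e then lookup (a e) M * (1 / of_nat (qq e)) else 0)"
        unfolding lookup_sum
      proof (intro sum.cong refl)
        fix e' assume e': "e' \<in> F"
        show "lookup (a e' * frac e') ?N = (if e' = e then lookup (a e) M * (1 / of_nat (qq e)) else 0)"
        proof (cases "e' = e")
          case True
          then show ?thesis by (simp add: frac_eq lookup_mult_single)
        next
          case False
          \<comment> \<open>The coefficients a_e' contain none of v_(m+1), ..., v_(m+n), so the
            exponents of these in N determine e.\<close>
          have "lookup (a e') (?N - emon e') = 0"
          proof (rule ccontr)
            assume nz: "lookup (a e') (?N - emon e') \<noteq> 0"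
            have aR: "a e' \<in> AR" using a e' by auto
            have "e' j = e j" for j
            proof (cases "j \<in> {1..n}")
              case True
              then have jA: "m + j \<in> AA" by auto
              have "lookup (?N - emon e') (V (m + j)) = 0"
                using lpolysD(2)[OF aR nz, of "V (m + j)"] jA by (auto simp: image_iff)
              then show ?thesis using M0[OF jA] jA by (simp add: lookup_add lookup_minus lookup_emon)
            next
              case False
              have "e' \<in> exps n" using e' F by auto
              then show ?thesis using False ee by (simp add: exps_def)
            qed
            then show False using \<open>e' \<noteq> e\<close> by blast
          qed
          then show ?thesis using False by (simp add: frac_eq lookup_mult_single)
        qed
      qed
      moreover have "lookup x ?N \<in> ZZ" by (rule lpolys_lookup[OF ZZ bx(3)])
      ultimately show "lookup (const (1 / of_nat (qq e)) * a e) M \<in> ZZ" using e F by simp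
    qed
    moreover have "a e = (const (1 / of_nat (qq e)) * a e) * of_nat (qq e)"
      using qq_pos[of e] by (simp add: mult.commute[of _ "of_nat _"] flip: mult.assoc)
    ultimately show "\<exists>c\<in>AR. a e = c * of_nat (qq e)" by blast
  qed
qed

definition expo :: "(gen \<Rightarrow>\<^sub>0 int) \<Rightarrow> nat \<Rightarrow> nat" where
  "expo M i = (if i \<in> {1..n} then nat (lookup M (V (m + i))) else 0)"

lemma lookup_minus_emon_expo:
  assumes M: "M \<in> Em"
  shows "lookup (M - emon (expo M)) x = (if x \<in> V ` AA then 0 else lookup M x)"
proof (cases x)
  case (V k)
  show ?thesis
  proof (cases "k \<in> AA")
    case True
    then show ?thesis using V Em_nonneg[OF M True] by (auto simp: lookup_minus lookup_emon expo_def)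
  qed (use V in \<open>auto simp: lookup_minus lookup_emon\<close>)
qed (auto simp: lookup_minus lookup_emon)

lemma single_AR:
  assumes M: "M \<in> Em" and c: "c \<in> C" and C: "subring_rat C"
  shows "single (M - emon (expo M)) c \<in> lpolys C (V ` {n..m}) {V n}"
proof (rule lpolys_single[OF C c])
  fix x
  show "x \<in> V ` {n..m}" if "lookup (M - emon (expo M)) x \<noteq> 0"
  proof -
    have "x \<notin> V ` AA" "lookup M x \<noteq> 0" using that by (auto simp: lookup_minus_emon_expo[OF M] split: if_splits)
    then obtain k where k: "x = V k" "k \<in> {n..m + n}" using M unfolding Em_def by blast
    then have "k \<notin> AA" using \<open>x \<notin> V ` AA\<close> by blast
    then show ?thesis using k by simp
  qed
  show "x \<in> {V n}" if "lookup (M - emon (expo M)) x < 0"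
    using that M by (auto simp: lookup_minus_emon_expo[OF M] Em_def split: if_splits)
qed

text \<open>Sorting the rational primitive w by its exponents in v_(m+1), ..., v_(m+n) writes it
  through the fractions, and the denominator bound makes the coefficients integral.\<close>

lemma spanning:
  assumes z: "z \<in> ZC"
  shows "\<exists>F a. finite F \<and> F \<subseteq> exps n \<and> (\<forall>e\<in>F. a e \<in> AR) \<and> z - (\<Sum>e\<in>F. a e * yy e) \<in> BC"
proof -
  have zR: "z \<in> RR ZZ 1" and zd: "cobar_d p m 1 z \<in> II UNIV 2" using z II_le by (auto simp: ZC_def)
  let ?w0 = "- aug p m z"
  have zU: "z \<in> RR UNIV 1" by (rule RR_UNIV[OF zR])
  have w0R: "?w0 \<in> RR UNIV 0" using aug_RR[OF zU] by (intro lpolys_uminus) auto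
  have H1: "z - cobar_d p m 0 ?w0 \<in> II UNIV 1" using rational_H1[OF zU zd] by (simp add: cobar_d_uminus)
  \<comment> \<open>Passing to the normal form changes the primitive by an element of the rational
    ideal, hence its coboundary as well.\<close>
  define w where "w = kill KV ?w0"
  have wE: "w \<in> EE UNIV" unfolding w_def by (rule kill_EE[OF w0R])
  have "cobar_d p m 0 (?w0 - w) \<in> II UNIV (Suc 0)"
    by (rule cobar_d_II[OF _ _ _ diff_kill_II_0[OF w0R, folded w_def]]) auto
  then have "cobar_d p m 0 ?w0 - cobar_d p m 0 w \<in> II UNIV 1" by (simp add: cobar_d_diff)
  then have dw: "z - cobar_d p m 0 w \<in> II UNIV 1" using IIq(3)[OF H1] by fastforce
  have "cobar_d p m 0 w - z \<in> II UNIV 1" using IIq(6)[OF dw] by simp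
  then have al: "alpha w M k \<in> ZZ" if "k \<in> AA" for M k
    using coboundary_integrality[OF wE zR _ that] by blast
  have Em: "M \<in> Em" if "M \<in> keys w" for M using EE_Em[OF wE that] .
  define F where "F = expo ` keys w - {\<lambda>_. 0}"
  have F: "finite F" "F \<subseteq> exps n"
  proof -
    show "F \<subseteq> exps n"
    proof
      fix e assume "e \<in> F"
      then obtain M where M: "e = expo M" "expo M \<noteq> (\<lambda>_. 0)" by (auto simp: F_def)
      then obtain i where "expo M i \<noteq> 0" by auto
      then have "i \<in> {1..n}" "e i \<noteq> 0" using M by (auto simp: expo_def split: if_splits)
      moreover have "\<forall>j. j \<notin> {1..n} \<longrightarrow> e j = 0" using M(1) unfolding expo_def by presburger
      ultimately show "e \<in> exps n" unfolding exps_def by blast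
    qed
  qed (simp add: F_def)
  \<comment> \<open>Collects the monomials with the same exponents e, divided by x^e; the factor
    \<open>qq e\<close> compensates the denominator of the fraction.\<close>
  define a where "a e = (\<Sum>M\<in>{M \<in> keys w. expo M = e}. single (M - emon e) (of_nat (qq e) * lookup w M))" for e
  have aA: "a e \<in> AR" if e: "e \<in> F" for e
    unfolding a_def
  proof (intro lpolys_sum ZZ)
    fix M assume M: "M \<in> {M \<in> keys w. expo M = e}"
    have "of_nat (qq e) * lookup w M \<in> ZZ"
    proof (rule qq_denominator)
      show "e \<in> exps n" using e F by auto
      fix i assume i: "i \<in> {1..n}"
      then have iA: "m + i \<in> AA" by auto
      have ME: "M \<in> Em" using M Em by auto
      have "e i = nat (lookup M (V (m + i)))" using M i by (auto simp: expo_def)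
      then have "lookup M (V (m + i)) = int (e i)" using Em_nonneg[OF ME iA] by simp
      then show "lookup w M * of_nat p * of_nat (e i) \<in> ZZ" using al[OF iA, of M] by (simp add: alpha_def)
    qed
    then show "single (M - emon e) (of_nat (qq e) * lookup w M) \<in> AR"
      using single_AR[of M _ ZZ] M Em ZZ by auto
  qed
  have af: "a e * frac e = (\<Sum>M\<in>{M \<in> keys w. expo M = e}. single M (lookup w M))" for e
    unfolding a_def sum_distrib_right
    by (intro sum.cong refl) (use qq_pos[of e] in \<open>simp add: frac_eq mult_single\<close>)
  have w_split: "w = (\<Sum>e\<in>F. a e * frac e) + (\<Sum>M\<in>{M \<in> keys w. expo M = (\<lambda>_. 0)}. single M (lookup w M))"
  proof -
    have "w = (\<Sum>M\<in>keys w. single M (lookup w M))" by (rule poly_mapping_sum_single)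
    also have "\<dots> = (\<Sum>e\<in>expo ` keys w. \<Sum>M\<in>{M \<in> keys w. expo M = e}. single M (lookup w M))"
      by (rule sum.group[symmetric]) auto
    also have "\<dots> = (\<Sum>e\<in>insert (\<lambda>_. 0) F. \<Sum>M\<in>{M \<in> keys w. expo M = e}. single M (lookup w M))"
      by (rule sum.mono_neutral_left) (auto simp: F_def intro!: sum.neutral)
    also have "\<dots> = (\<Sum>M\<in>{M \<in> keys w. expo M = (\<lambda>_. 0)}. single M (lookup w M)) + (\<Sum>e\<in>F. a e * frac e)"
      by (subst sum.insert) (auto simp: F_def af)
    finally show ?thesis by (simp add: add.commute)
  qed
  \<comment> \<open>No integrality is known for these coefficients, but the monomials lie in v_n,
    ..., v_m and have coboundary zero.\<close>
  have "(\<Sum>M\<in>{M \<in> keys w. expo M = (\<lambda>_. 0)}. single M (lookup w M)) \<in> lpolys UNIV (V ` {n..m}) {V n}"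
  proof (intro lpolys_sum subring_rat_UNIV)
    fix M assume M: "M \<in> {M \<in> keys w. expo M = (\<lambda>_. 0)}"
    have "emon (\<lambda>_. 0) = 0" by (simp add: emon_def)
    then show "single M (lookup w M) \<in> lpolys UNIV (V ` {n..m}) {V n}"
      using single_AR[of M "lookup w M" UNIV] M Em by auto
  qed
  then have "cobar_d p m 0 w = cobar_d p m 0 (\<Sum>e\<in>F. a e * frac e)"
    by (subst w_split) (simp add: cobar_d_add cobar_d_AR_0)
  then have "z - (\<Sum>e\<in>F. a e * yy e) = (z - cobar_d p m 0 w) + (cobar_d p m 0 (\<Sum>e\<in>F. a e * frac e) - (\<Sum>e\<in>F. a e * yy e))"
    by simp
  also have "\<dots> \<in> II UNIV 1" by (intro IIq(3) dw d_sum_frac aA)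
  finally have "z - (\<Sum>e\<in>F. a e * yy e) \<in> II UNIV 1" .
  moreover have "z - (\<Sum>e\<in>F. a e * yy e) \<in> RR ZZ 1"
    using F by (intro lpolys_diff lpolys_sum lpolys_mult ZZ zR AR_RR[OF aA] yy_RR) auto
  ultimately have "z - (\<Sum>e\<in>F. a e * yy e) \<in> BC" by (intro II_BC II_saturated)
  then show ?thesis using F aA by blast
qed

section \<open>Identification with the cobar complexes and their Ext groups\<close>

lemma E_J_simps:
  "fst (E_J p n m) s = RR ZZ s" "snd (E_J p n m) s = II ZZ s"
  "fst (pinv_E_J p n m) s = RR UNIV s" "snd (pinv_E_J p n m) s = II UNIV s"
  "fst (E_pinf_J p n m) s = RR UNIV s" "snd (E_pinf_J p n m) s = {x + y | x y. x \<in> II UNIV s \<and> y \<in> RR ZZ s}"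
  by (simp_all add: E_J_def pinv_E_J_def E_pinf_J_def carrier_Gam rel_ideal_eq)

lemma cocycles_E_J: "cocycles p m (E_J p n m) 1 = ZC"
  by (simp add: cocycles_def E_J_simps ZC_def)

lemma coboundaries_E_J: "coboundaries p m (E_J p n m) 1 = BC"
proof -
  have "coboundaries p m (E_J p n m) (Suc 0) = BC"
    unfolding coboundaries_def nat.case E_J_simps BC_def One_nat_def ..
  then show ?thesis by simp
qed

lemma ext_class_E_J: "ext_class p m (E_J p n m) 1 x = coset_class BC x"
  by (simp add: ext_class_def coset_class_def coboundaries_E_J)

lemma ZC_add: "x \<in> ZC \<Longrightarrow> z \<in> ZC \<Longrightarrow> x + z \<in> ZC"
  by (auto simp: ZC_def cobar_d_add intro: lpolys_add IIz)

lemma ZC_mult: "a \<in> AR \<Longrightarrow> x \<in> ZC \<Longrightarrow> a * x \<in> ZC"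
proof -
  assume a: "a \<in> AR" and "x \<in> ZC"
  then have x: "x \<in> RR ZZ 1" "cobar_d p m 1 x \<in> II ZZ 2" by (auto simp: ZC_def)
  then show ?thesis unfolding ZC_def using lpolys_mult[OF ZZ AR_RR[OF a] x(1)] IIz(4)[OF AR_RR[OF a] x(2)]
    by (simp add: cobar_d_AR[OF a x(1)])
qed

lemma presentation: "cyclic_presentation AR BC ZC (exps n) (\<lambda>e. of_nat (qq e)) yy (Ext p m (E_J p n m) 1)"
proof unfold_locales
  show "subring AR" by (rule AR_subring)
  show "0 \<in> BC" by (intro II_BC IIz(2))
  show "0 \<in> ZC" using cobar_d_diff[of 1 0 0] IIz(2) by (simp add: ZC_def lpolys_0)
  show "yy e \<in> ZC" if "e \<in> exps n" for e using yy_RR[OF that] cobar_d_yy[OF that] by (simp add: ZC_def)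
  show "of_nat (qq e) \<in> AR" for e by (intro lpolys_of_nat ZZ)
  show "carrier (Ext p m (E_J p n m) 1) = coset_class BC ` ZC"
    by (simp add: Ext_def cocycles_E_J ext_class_E_J)
  show "add (Ext p m (E_J p n m) 1) = (\<lambda>Y W. {u + w | u w. u \<in> Y \<and> w \<in> W})"
    by (simp add: Ext_def)
  show "module.smult (Ext p m (E_J p n m) 1) = (\<lambda>r Y. {b + r * u | b u. b \<in> BC \<and> u \<in> Y})"
    by (simp add: Ext_def coboundaries_E_J)
  show "((\<Sum>i\<in>F. a i * yy i) \<in> BC) = (\<forall>i\<in>F. \<exists>c\<in>AR. a i = c * of_nat (qq i))"
    if "finite F" "F \<subseteq> exps n" "\<forall>i\<in>F. a i \<in> AR" for F a
    by (rule relations[OF that])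
qed (blast intro: BC_add BC_mult ZC_add ZC_mult spanning)+

lemma coboundaries_E_J_0: "coboundaries p m (E_J p n m) 0 = II ZZ 0"
  by (simp add: coboundaries_def E_J_simps)

text \<open>All of \<open>AR\<close> is invariant, and by \<open>rational_H0\<close> nothing else
  is, modulo the relations. The group is a copy of the base ring, free of rank one over
  Z_(p)[v_n, v_n^(-1), v_(n+1), ..., v_m], and so larger than Z_(p) itself.\<close>

lemma Ext_0: "(\<lambda>r. ext_class p m (E_J p n m) 0 r) \<in> module_iso (Rnm p n m) (regular_module (Rnm p n m)) (Ext p m (E_J p n m) 0)"
proof -
  interpret C: submodule_cosets AR "II ZZ 0"
    by unfold_locales (auto intro: AR_subring[THEN subringD(3)] AR_subring IIz AR_RR)
  let ?c = "coset_class (II ZZ 0)"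
  have ec: "ext_class p m (E_J p n m) 0 = ?c"
    by (rule ext) (simp add: ext_class_def coset_class_def coboundaries_E_J_0)
  have coc: "cocycles p m (E_J p n m) 0 = {x \<in> RR ZZ 0. cobar_d p m 0 x \<in> II ZZ 1}"
    by (simp add: cocycles_def E_J_simps)
  have AR_coc: "r \<in> {x \<in> RR ZZ 0. cobar_d p m 0 x \<in> II ZZ 1}" if "r \<in> AR" for r
    using that cobar_d_AR_0[OF that] AR_RR[OF that] IIz(2) by simp
  have kill_AR: "kill KV r = r" if r: "r \<in> AR" for r
  proof -
    have "fixing (\<lambda>x. if x \<in> KV then 0 else gvar x) {V n}" by (rule fixing_kill[OF KV_kill(1)])
    then show ?thesis unfolding kill_def by (rule fixing.hom_id[OF _ r]) (auto simp: KV_def)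
  qed
  have inj: "inj_on ?c AR"
  proof (rule inj_onI)
    fix r s assume rs: "r \<in> AR" "s \<in> AR" "?c r = ?c s"
    then have "r - s \<in> II ZZ 0" using C.cls_eq_iff by blast
    then have "kill KV (r - s) = 0" by (rule kill_II_0) simp
    moreover have "r - s \<in> AR" using rs by (intro lpolys_diff ZZ)
    ultimately show "r = s" using kill_AR by fastforce
  qed
  have surj: "?c x \<in> ?c ` AR" if x: "x \<in> RR ZZ 0" "cobar_d p m 0 x \<in> II ZZ 1" for x
  proof -
    \<comment> \<open>Dropping the v_k with k > m is justified by the cocycle condition, dropping
      v_1, ..., v_(n-1) by J_n.\<close>
    define r where "r = kill KV (kx x)"
    have k1: "kx x \<in> lpolys ZZ (allgens m 0 - {V k | k. m < k}) {V n}" by (rule kill_mem[OF x(1) kx_disj])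
    have rA: "r \<in> AR" unfolding r_def
      by (rule lpolys_mono[OF kill_mem[OF k1 KV_kill(1)]]) (auto simp: allgens_def KV_def image_iff)
    have xU: "x \<in> RR UNIV 0" "kx x \<in> RR UNIV 0"
      using x(1) lpolys_mono[OF k1, of UNIV "allgens m 0" "{V n}"] by (auto intro: RR_UNIV)
    have k2: "kx x - x \<in> II UNIV 0" using rational_H0[OF xU(1)] x(2) II_le by blast
    have "kx x - r \<in> II UNIV 0" unfolding r_def by (rule diff_kill_II_0[OF xU(2)])
    from IIq(7)[OF this k2] have "x - r \<in> II UNIV 0" by simp
    moreover have "x - r \<in> RR ZZ 0" using x(1) AR_RR[OF rA] by (intro lpolys_diff ZZ)
    ultimately have "x - r \<in> II ZZ 0" unfolding II_0 by (rule ispan_gvar_integral[OF _ KV_kill(1) ZZ])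
    then show ?thesis using C.cls_eq_iff rA by blast
  qed
  have "?c ` AR = ?c ` {x \<in> RR ZZ 0. cobar_d p m 0 x \<in> II ZZ 1}"
  proof
    show "?c ` AR \<subseteq> ?c ` {x \<in> RR ZZ 0. cobar_d p m 0 x \<in> II ZZ 1}" using AR_coc by (rule_tac image_mono) blast
    show "?c ` {x \<in> RR ZZ 0. cobar_d p m 0 x \<in> II ZZ 1} \<subseteq> ?c ` AR" using surj by blast
  qed
  then show ?thesis
    unfolding module_iso_def bij_betw_def Ext_def ec coc coboundaries_E_J_0 Rnm_eq regular_module_def
    using inj C.cls_add C.cls_smult by (simp add: set_ring_def)
qed

lemma fraction_cocycle: "e \<in> exps n \<Longrightarrow> frac e \<in> cocycles p m (E_pinf_J p n m) 0"
proof -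
  assume e: "e \<in> exps n"
  have "cobar_d p m 0 (frac e) = (cobar_d p m 0 (frac e) - yy e) + yy e" by simp
  then have "\<exists>x y. cobar_d p m 0 (frac e) = x + y \<and> x \<in> II UNIV 1 \<and> y \<in> RR ZZ 1"
    using frac_yy_II yy_RR[OF e] by blast
  then show ?thesis using EE_RR[OF frac_EE] by (simp add: cocycles_def E_J_simps)
qed

text \<open>The connecting map is a set of possible values. Changing the lift by an integral element
  adds a coboundary, changing it by the rational ideal adds a rational relation, and
  \<open>II_saturated\<close> makes the total change an integral one. The set is therefore a single
  class.\<close>

lemma connecting_fraction:
  assumes e: "e \<in> exps n"
  shows "connecting p n m 0 (ext_class p m (E_pinf_J p n m) 0 (frac e)) = coset_class BC (yy e)"
proof (intro equalityI subsetI)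
  have ec: "ext_class p m (E_pinf_J p n m) 0 (frac e) = {i + r + frac e | i r. i \<in> II UNIV 0 \<and> r \<in> RR ZZ 0}"
    by (auto simp: ext_class_def coboundaries_def E_J_simps)
  fix y assume "y \<in> connecting p n m 0 (ext_class p m (E_pinf_J p n m) 0 (frac e))"
  then obtain i r where yR: "y \<in> RR ZZ 1" and ir: "i \<in> II UNIV 0" "r \<in> RR ZZ 0"
    "cobar_d p m 0 (i + r + frac e) - y \<in> II UNIV 1"
    by (auto simp: connecting_def E_J_simps ec)
  let ?b = "y - cobar_d p m 0 r - yy e"
  have di: "cobar_d p m 0 i \<in> II UNIV 1" using cobar_d_II[of UNIV 0 i] ir by simp
  have "?b = cobar_d p m 0 i + (cobar_d p m 0 (frac e) - yy e) - (cobar_d p m 0 (i + r + frac e) - y)"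
    by (simp add: cobar_d_add)
  also have "\<dots> \<in> II UNIV 1" by (intro IIq(7) IIq(3) di frac_yy_II ir)
  finally have "?b \<in> II UNIV 1" .
  moreover have "?b \<in> RR ZZ 1"
    using cobar_d_RR[of ZZ 0 r] ir(2) yR yy_RR[OF e] by (intro lpolys_diff ZZ) simp_all
  ultimately have "?b \<in> II ZZ 1" by (rule II_saturated)
  from BC_I[OF this ir(2)] have "y - yy e \<in> BC" by simp
  moreover have "y = (y - yy e) + yy e" by simp
  ultimately show "y \<in> coset_class BC (yy e)" unfolding coset_class_def by blast
next
  fix y assume "y \<in> coset_class BC (yy e)"
  then obtain b r where br: "b \<in> II ZZ 1" "r \<in> RR ZZ 0" "y = b + cobar_d p m 0 r + yy e"
    by (auto simp: coset_class_def BC_def)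
  have yR: "y \<in> RR ZZ 1"
    using IIz(1)[OF br(1)] cobar_d_RR[of ZZ 0 r] br(2) yy_RR[OF e] unfolding br(3) by (intro lpolys_add ZZ) simp_all
  have "cobar_d p m 0 (0 + r + frac e) - y = (cobar_d p m 0 (frac e) - yy e) - b"
    by (simp add: cobar_d_add br(3))
  moreover have "\<dots> \<in> II UNIV 1" using br(1) II_le by (intro IIq(7) frac_yy_II) auto
  ultimately have "cobar_d p m 0 (0 + r + frac e) - y \<in> II UNIV 1" by simp
  moreover have "0 + r + frac e \<in> ext_class p m (E_pinf_J p n m) 0 (frac e)"
    unfolding ext_class_def coboundaries_def nat.case E_J_simps using IIq(2) br(2) by blast
  ultimately show "y \<in> connecting p n m 0 (ext_class p m (E_pinf_J p n m) 0 (frac e))"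
    unfolding connecting_def E_J_simps using yR by (simp only: One_nat_def[symmetric] mem_Collect_eq) blast
qed

end

theorem theorem1p1:
  fixes p n m :: nat
  assumes "prime p" and "1 \<le> n" and "n \<le> m"
  shows "(\<exists>g. g \<in> module_iso (Rnm p n m) (regular_module (Rnm p n m)) (Ext p m (E_J p n m) 0)) \<and>
    (\<forall>e\<in>exps n. ext_class p m (E_pinf_J p n m) 0 (fraction p n m e)
        \<in> carrier (Ext p m (E_pinf_J p n m) 0)) \<and>
    (\<exists>h. h \<in> module_iso (Rnm p n m)
          (cyclic_sum (Rnm p n m) (exps n) (\<lambda>e. of_nat (gen_order p n e)))
          (Ext p m (E_J p n m) 1) \<and>
        (\<forall>e\<in>exps n. h (cyclic_gen (Rnm p n m) (exps n) (\<lambda>e. of_nat (gen_order p n e)) e)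
          = connecting p n m 0 (ext_class p m (E_pinf_J p n m) 0 (fraction p n m e))))"
proof -
  interpret hopf_data p n m by unfold_locales (use assms in auto)
  interpret P: cyclic_presentation AR BC ZC "exps n" "\<lambda>e. of_nat (qq e)" yy "Ext p m (E_J p n m) 1"
    by (rule presentation)
  have "ext_class p m (E_pinf_J p n m) 0 (frac e) \<in> carrier (Ext p m (E_pinf_J p n m) 0)" if "e \<in> exps n" for e
    using fraction_cocycle[OF that] by (simp add: Ext_def)
  moreover obtain h where "h \<in> module_iso (set_ring AR) (cyclic_sum (set_ring AR) (exps n) (\<lambda>e. of_nat (qq e))) (Ext p m (E_J p n m) 1)"
    "\<forall>e\<in>exps n. h (cyclic_gen (set_ring AR) (exps n) (\<lambda>e. of_nat (qq e)) e) = coset_class BC (yy e)"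
    using P.presentation by blast
  ultimately show ?thesis using Ext_0 by (auto simp: Rnm_eq connecting_fraction)
qed

end
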